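(* Let $(R,\mathfrak{m})$ be an excellent Gorenstein normal local isolated singularity of characteristic $p>0$ with infinite perfect residue field. Suppose that the test ideal of $R$ is $\mathfrak{m}$. Let $I=J^*$, where $J$ is an ideal generated by a system of parameters of $R$. Then $\operatorname{core}(I)=*\text{-}\operatorname{core}(I)$.
   Context: Local rings are Noetherian; $R$ is an isolated singularity if $R_{\mathfrak{p}}$ is regular for every non-maximal prime $\mathfrak{p}$. A reduction of $I$ is an ideal $J\subset I$ with $JI^n=I^{n+1}$ for some $n\ge0$; $\operatorname{core}(I)$ is the intersection of all reductions of $I$. Tight closure: $x\in I^*$ iff there is $c\in R^0$ (the elements outside all minimal primes) with $cx^q\in I^{[q]}$ for all large powers $q$ of $p$, where $I^{[q]}$ is generated by the $q$-th powers of elements of $I$. A $*$-reduction of $I$ is an ideal $J$ with $J\subset I\subset J^*$; $*\text{-}\operatorname{core}(I)$ is the intersection of all $*$-reductions of $I$. The test ideal of $R$ is $\tau=\bigcap_{I\subset R}(I:I^* )$, the intersection over all ideals $I$ of $R$. *)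

theory Defs
  imports "HOL-Algebra.Algebra" "HOL-Algebra.Free_Abelian_Groups" "HOL-Library.Extended_Nat"
begin

definition Spec :: "('a, 'b) ring_scheme \<Rightarrow> 'a set set"
  where "Spec R = {P. primeideal P R}"

definition prime_chain :: "('a, 'b) ring_scheme \<Rightarrow> 'a set list \<Rightarrow> bool"
  where "prime_chain R Ps \<longleftrightarrow> Ps \<noteq> [] \<and> set Ps \<subseteq> Spec R \<and> sorted_wrt (\<subset>) Ps"

definition krull_dim :: "('a, 'b) ring_scheme \<Rightarrow> enat"
  where "krull_dim R = Sup {enat (length Ps - 1) | Ps. prime_chain R Ps}"

definition radical :: "('a, 'b) ring_scheme \<Rightarrow> 'a set \<Rightarrow> 'a set"
  where "radical R I = {x \<in> carrier R. \<exists>n::nat. x [^]\<^bsub>R\<^esub> n \<in> I}"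

text \<open>The fraction \<open>a / s\<close> is the class of all pairs \<open>(b, t)\<close> with \<open>u (a t - b s) = 0\<close> for some
  \<open>u\<close> in the multiplicative set \<open>S\<close>.\<close>

definition loc_frac :: "('a, 'b) ring_scheme \<Rightarrow> 'a set \<Rightarrow> 'a \<Rightarrow> 'a \<Rightarrow> ('a \<times> 'a) set"
  where "loc_frac R S a s = {(b, t). b \<in> carrier R \<and> t \<in> S \<and>
    (\<exists>u\<in>S. u \<otimes>\<^bsub>R\<^esub> (a \<otimes>\<^bsub>R\<^esub> t \<ominus>\<^bsub>R\<^esub> b \<otimes>\<^bsub>R\<^esub> s) = \<zero>\<^bsub>R\<^esub>)}"

definition localization :: "('a, 'b) ring_scheme \<Rightarrow> 'a set \<Rightarrow> (('a \<times> 'a) set) ring"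
  where "localization R S =
    \<lparr>carrier = {loc_frac R S a s | a s. a \<in> carrier R \<and> s \<in> S},
     monoid.mult = (\<lambda>U V. \<Union>{loc_frac R S (a \<otimes>\<^bsub>R\<^esub> b) (s \<otimes>\<^bsub>R\<^esub> t) | a s b t.
       (a, s) \<in> U \<and> (b, t) \<in> V}),
     one = loc_frac R S \<one>\<^bsub>R\<^esub> \<one>\<^bsub>R\<^esub>,
     ring.zero = loc_frac R S \<zero>\<^bsub>R\<^esub> \<one>\<^bsub>R\<^esub>,
     ring.add = (\<lambda>U V. \<Union>{loc_frac R S (a \<otimes>\<^bsub>R\<^esub> t \<oplus>\<^bsub>R\<^esub> b \<otimes>\<^bsub>R\<^esub> s) (s \<otimes>\<^bsub>R\<^esub> t) | a s b t.
       (a, s) \<in> U \<and> (b, t) \<in> V})\<rparr>"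

abbreviation loc_at :: "('a, 'b) ring_scheme \<Rightarrow> 'a set \<Rightarrow> (('a \<times> 'a) set) ring"
  where "loc_at R P \<equiv> localization R (carrier R - P)"

definition loc_max :: "('a, 'b) ring_scheme \<Rightarrow> 'a set \<Rightarrow> ('a \<times> 'a) set set"
  where "loc_max R P = {loc_frac R (carrier R - P) a s | a s. a \<in> P \<and> s \<in> carrier R - P}"

definition residue_field_at :: "('a, 'b) ring_scheme \<Rightarrow> 'a set \<Rightarrow> (('a \<times> 'a) set set) ring"
  where "residue_field_at R P = loc_at R P Quot loc_max R P"

definition to_residue_field_at :: "('a, 'b) ring_scheme \<Rightarrow> 'a set \<Rightarrow> 'a \<Rightarrow> ('a \<times> 'a) set set"
  where "to_residue_field_at R P a =
    loc_max R P +>\<^bsub>loc_at R P\<^esub> loc_frac R (carrier R - P) a \<one>\<^bsub>R\<^esub>"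

text \<open>Local rings are Noetherian by convention.\<close>

definition local_ring :: "('a, 'b) ring_scheme \<Rightarrow> 'a set \<Rightarrow> bool"
  where "local_ring R m \<longleftrightarrow> cring R \<and> noetherian_ring R \<and> maximalideal m R \<and>
    (\<forall>M. maximalideal M R \<longrightarrow> M = m)"

definition regular_local_ring :: "('a, 'b) ring_scheme \<Rightarrow> bool"
  where "regular_local_ring R \<longleftrightarrow> (\<exists>m. local_ring R m \<and>
    (\<exists>xs. set xs \<subseteq> carrier R \<and> enat (length xs) = krull_dim R \<and> Idl\<^bsub>R\<^esub> (set xs) = m))"

definition regular_ring :: "('a, 'b) ring_scheme \<Rightarrow> bool"
  where "regular_ring R \<longleftrightarrow> cring R \<and> noetherian_ring R \<and>
    (\<forall>P\<in>Spec R. regular_local_ring (loc_at R P))"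

definition isolated_singularity :: "('a, 'b) ring_scheme \<Rightarrow> 'a set \<Rightarrow> bool"
  where "isolated_singularity R m \<longleftrightarrow> local_ring R m \<and>
    (\<forall>P\<in>Spec R. P \<noteq> m \<longrightarrow> regular_local_ring (loc_at R P))"

definition integral_over :: "('a, 'b) ring_scheme \<Rightarrow> ('c, 'd) ring_scheme \<Rightarrow> ('a \<Rightarrow> 'c) \<Rightarrow> 'c \<Rightarrow> bool"
  where "integral_over R S h z \<longleftrightarrow> (\<exists>(n::nat) a. a \<in> {..<n} \<rightarrow> carrier R \<and>
    z [^]\<^bsub>S\<^esub> n \<oplus>\<^bsub>S\<^esub> (\<Oplus>\<^bsub>S\<^esub>i\<in>{..<n}. h (a i) \<otimes>\<^bsub>S\<^esub> z [^]\<^bsub>S\<^esub> i) = \<zero>\<^bsub>S\<^esub>)"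

definition normal_domain :: "('a, 'b) ring_scheme \<Rightarrow> bool"
  where "normal_domain R \<longleftrightarrow> domain R \<and>
    (let S = carrier R - {\<zero>\<^bsub>R\<^esub>}; K = localization R S; h = (\<lambda>a. loc_frac R S a \<one>\<^bsub>R\<^esub>)
     in \<forall>z\<in>carrier K. integral_over R K h z \<longrightarrow> z \<in> h ` carrier R)"

text \<open>Characteristic zero, or characteristic \<open>p\<close> with every element a \<open>p\<close>-th power.\<close>

definition perfect_field :: "('a, 'b) ring_scheme \<Rightarrow> bool"
  where "perfect_field K \<longleftrightarrow> field K \<and>
    (\<forall>p::nat. Factorial_Ring.prime p \<and> [p] \<cdot>\<^bsub>K\<^esub> \<one>\<^bsub>K\<^esub> = \<zero>\<^bsub>K\<^esub> \<longrightarrow>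
      (\<forall>x\<in>carrier K. \<exists>y\<in>carrier K. y [^]\<^bsub>K\<^esub> p = x))"

definition sop :: "('a, 'b) ring_scheme \<Rightarrow> 'a set \<Rightarrow> 'a list \<Rightarrow> bool"
  where "sop R m xs \<longleftrightarrow> set xs \<subseteq> m \<and> enat (length xs) = krull_dim R \<and>
    radical R (Idl\<^bsub>R\<^esub> (set xs)) = m"

definition mod_hom :: "('a, 'r) ring_scheme \<Rightarrow> ('a, 'b, 'm) module_scheme \<Rightarrow>
    ('a, 'c, 'n) module_scheme \<Rightarrow> ('b \<Rightarrow> 'c) set"
  where "mod_hom R M N = {f \<in> carrier M \<rightarrow> carrier N.
    (\<forall>x\<in>carrier M. \<forall>y\<in>carrier M. f (x \<oplus>\<^bsub>M\<^esub> y) = f x \<oplus>\<^bsub>N\<^esub> f y) \<and>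
    (\<forall>a\<in>carrier R. \<forall>x\<in>carrier M. f (a \<odot>\<^bsub>M\<^esub> x) = a \<odot>\<^bsub>N\<^esub> f x)}"

text \<open>The test modules \<open>N\<close> range over all modules with carrier in the type \<^typ>\<open>nat \<Rightarrow> 'a\<close>. As \<open>R\<close>
  itself has a copy there, Baer's criterion shows that this restriction on the carrier is harmless.\<close>

definition injective_module :: "('a, 'r) ring_scheme \<Rightarrow> ('a, 'e, 'm) module_scheme \<Rightarrow> bool"
  where "injective_module R E \<longleftrightarrow> module R E \<and>
    (\<forall>(N :: ('a, nat \<Rightarrow> 'a) module) H f.
      module R N \<and> submodule H R N \<and> f \<in> mod_hom R (N\<lparr>carrier := H\<rparr>) E \<longrightarrow>
      (\<exists>g \<in> mod_hom R N E. \<forall>x\<in>H. g x = f x))"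

text \<open>A finite injective resolution \<open>0 \<rightarrow> M \<rightarrow> E 0 \<rightarrow> E 1 \<rightarrow> \<dots> \<rightarrow> E n \<rightarrow> 0\<close>. For Noetherian \<open>R\<close>
  and finitely generated \<open>M\<close> the modules of the minimal injective resolution have cardinality at
  most \<open>max |R| \<aleph>\<^sub>0\<close>, so (for \<open>R \<noteq> 0\<close>) they have copies in the type \<^typ>\<open>nat \<Rightarrow> 'a\<close>.\<close>

definition finite_injective_dimension ::
    "('a, 'r) ring_scheme \<Rightarrow> ('a, 'c, 'm) module_scheme \<Rightarrow> bool"
  where "finite_injective_dimension R M \<longleftrightarrow>
    (\<exists>(n::nat) (E :: nat \<Rightarrow> ('a, nat \<Rightarrow> 'a) module) d e.
      (\<forall>i. injective_module R (E i)) \<and>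
      (\<forall>i. d i \<in> mod_hom R (E i) (E (Suc i))) \<and>
      e \<in> mod_hom R M (E 0) \<and> inj_on e (carrier M) \<and>
      e ` carrier M = {x \<in> carrier (E 0). d 0 x = \<zero>\<^bsub>E 1\<^esub>} \<and>
      (\<forall>i. d i ` carrier (E i) =
        {x \<in> carrier (E (Suc i)). d (Suc i) x = \<zero>\<^bsub>E (Suc (Suc i))\<^esub>}) \<and>
      (\<forall>i>n. carrier (E i) = {\<zero>\<^bsub>E i\<^esub>}))"

definition self_module :: "('a, 'b) ring_scheme \<Rightarrow> ('a, 'a) module"
  where "self_module R = \<lparr>carrier = carrier R, monoid.mult = monoid.mult R, one = \<one>\<^bsub>R\<^esub>,
    ring.zero = \<zero>\<^bsub>R\<^esub>, ring.add = ring.add R, smult = monoid.mult R\<rparr>"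

definition gorenstein_local :: "('a, 'b) ring_scheme \<Rightarrow> 'a set \<Rightarrow> bool"
  where "gorenstein_local R m \<longleftrightarrow> local_ring R m \<and> finite_injective_dimension R (self_module R)"

text \<open>The completion \<open>lim A / I^n\<close> as the ring of compatible sequences of cosets. Here
  \<^term>\<open>I [^]\<^bsub>ideals_set A\<^esub> (n::nat)\<close> is the ideal power, with zeroth power \<^term>\<open>carrier A\<close>.\<close>

definition completion :: "('a, 'b) ring_scheme \<Rightarrow> 'a set \<Rightarrow> (nat \<Rightarrow> 'a set) ring"
  where "completion A I = (let Q = (\<lambda>n::nat. A Quot (I [^]\<^bsub>ideals_set A\<^esub> n)) in
    \<lparr>carrier = {f. (\<forall>n. f n \<in> carrier (Q n)) \<and> (\<forall>n. f (Suc n) \<subseteq> f n)},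
     monoid.mult = (\<lambda>f g n. f n \<otimes>\<^bsub>Q n\<^esub> g n),
     one = (\<lambda>n. \<one>\<^bsub>Q n\<^esub>),
     ring.zero = (\<lambda>n. \<zero>\<^bsub>Q n\<^esub>),
     ring.add = (\<lambda>f g n. f n \<oplus>\<^bsub>Q n\<^esub> g n)\<rparr>)"

definition to_completion :: "('a, 'b) ring_scheme \<Rightarrow> 'a set \<Rightarrow> 'a \<Rightarrow> nat \<Rightarrow> 'a set"
  where "to_completion A I a = (\<lambda>n. (I [^]\<^bsub>ideals_set A\<^esub> n) +>\<^bsub>A\<^esub> a)"

text \<open>The tensor product of two \<open>R\<close>-algebras \<open>f : R \<rightarrow> A\<close> and \<open>g : R \<rightarrow> B\<close>: the free abelian group
  on \<open>A \<times> B\<close>, with the multiplication \<open>(a, b) (a', b') = (a a', b b')\<close> extended bilinearly, modulo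
  the usual bilinear relations. The subgroup spanned by these relations is already an ideal.\<close>

definition free_pairs_ring ::
    "('a, 'm) ring_scheme \<Rightarrow> ('b, 'n) ring_scheme \<Rightarrow> ('a \<times> 'b \<Rightarrow>\<^sub>0 int) ring"
  where "free_pairs_ring A B =
    \<lparr>carrier = {u. Poly_Mapping.keys u \<subseteq> carrier A \<times> carrier B},
     monoid.mult = (\<lambda>u v. frag_extend (\<lambda>(a, b). frag_extend
       (\<lambda>(a', b'). frag_of (a \<otimes>\<^bsub>A\<^esub> a', b \<otimes>\<^bsub>B\<^esub> b')) v) u),
     one = frag_of (\<one>\<^bsub>A\<^esub>, \<one>\<^bsub>B\<^esub>), ring.zero = 0, ring.add = (+)\<rparr>"

definition tensor_relations ::
    "('r, 'k) ring_scheme \<Rightarrow> ('a, 'm) ring_scheme \<Rightarrow> ('r \<Rightarrow> 'a) \<Rightarrow>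
      ('b, 'n) ring_scheme \<Rightarrow> ('r \<Rightarrow> 'b) \<Rightarrow> ('a \<times> 'b \<Rightarrow>\<^sub>0 int) set"
  where "tensor_relations R A f B g =
    {frag_of (a \<oplus>\<^bsub>A\<^esub> a', b) - frag_of (a, b) - frag_of (a', b) | a a' b.
       a \<in> carrier A \<and> a' \<in> carrier A \<and> b \<in> carrier B} \<union>
    {frag_of (a, b \<oplus>\<^bsub>B\<^esub> b') - frag_of (a, b) - frag_of (a, b') | a b b'.
       a \<in> carrier A \<and> b \<in> carrier B \<and> b' \<in> carrier B} \<union>
    {frag_of (f r \<otimes>\<^bsub>A\<^esub> a, b) - frag_of (a, g r \<otimes>\<^bsub>B\<^esub> b) | r a b.
       r \<in> carrier R \<and> a \<in> carrier A \<and> b \<in> carrier B}"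

definition tensor_ideal ::
    "('r, 'k) ring_scheme \<Rightarrow> ('a, 'm) ring_scheme \<Rightarrow> ('r \<Rightarrow> 'a) \<Rightarrow>
      ('b, 'n) ring_scheme \<Rightarrow> ('r \<Rightarrow> 'b) \<Rightarrow> ('a \<times> 'b \<Rightarrow>\<^sub>0 int) set"
  where "tensor_ideal R A f B g = Idl\<^bsub>free_pairs_ring A B\<^esub> (tensor_relations R A f B g)"

definition tensor_ring ::
    "('r, 'k) ring_scheme \<Rightarrow> ('a, 'm) ring_scheme \<Rightarrow> ('r \<Rightarrow> 'a) \<Rightarrow>
      ('b, 'n) ring_scheme \<Rightarrow> ('r \<Rightarrow> 'b) \<Rightarrow> (('a \<times> 'b \<Rightarrow>\<^sub>0 int) set) ring"
  where "tensor_ring R A f B g = free_pairs_ring A B Quot tensor_ideal R A f B g"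

definition pure_tensor ::
    "('r, 'k) ring_scheme \<Rightarrow> ('a, 'm) ring_scheme \<Rightarrow> ('r \<Rightarrow> 'a) \<Rightarrow>
      ('b, 'n) ring_scheme \<Rightarrow> ('r \<Rightarrow> 'b) \<Rightarrow> 'a \<Rightarrow> 'b \<Rightarrow> ('a \<times> 'b \<Rightarrow>\<^sub>0 int) set"
  where "pure_tensor R A f B g a b =
    tensor_ideal R A f B g +>\<^bsub>free_pairs_ring A B\<^esub> frag_of (a, b)"

text \<open>For a field \<open>k\<close> and a \<open>k\<close>-algebra \<open>h : k \<rightarrow> B\<close>. Every finite extension of \<open>k\<close> is as a set a
  finite power of \<open>k\<close>, so it has a copy with carrier in the type \<^typ>\<open>nat \<Rightarrow> 'k\<close>.\<close>

definition geometrically_regular ::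
    "('k, 'm) ring_scheme \<Rightarrow> ('b, 'n) ring_scheme \<Rightarrow> ('k \<Rightarrow> 'b) \<Rightarrow> bool"
  where "geometrically_regular k B h \<longleftrightarrow>
    (\<forall>(L :: (nat \<Rightarrow> 'k) ring) j.
      field L \<and> j \<in> ring_hom k L \<and> ring.finite_dimension L (j ` carrier k) (carrier L) \<longrightarrow>
      regular_ring (tensor_ring k B h L j))"

text \<open>The fibre over \<open>Q\<close> of \<open>h : A \<rightarrow> B\<close> is the tensor product of \<open>B\<close> with the residue field of
  \<open>A\<close> at \<open>Q\<close>, regarded as an algebra over that residue field.\<close>

definition geometrically_regular_fibres ::
    "('a, 'm) ring_scheme \<Rightarrow> ('b, 'n) ring_scheme \<Rightarrow> ('a \<Rightarrow> 'b) \<Rightarrow> bool"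
  where "geometrically_regular_fibres A B h \<longleftrightarrow> (\<forall>Q\<in>Spec A.
    let k = residue_field_at A Q; j = to_residue_field_at A Q in
      geometrically_regular k (tensor_ring A B h k j) (pure_tensor A B h k j \<one>\<^bsub>B\<^esub>))"

definition G_ring :: "('a, 'b) ring_scheme \<Rightarrow> bool"
  where "G_ring R \<longleftrightarrow> cring R \<and> noetherian_ring R \<and>
    (\<forall>P\<in>Spec R. geometrically_regular_fibres (loc_at R P)
      (completion (loc_at R P) (loc_max R P)) (to_completion (loc_at R P) (loc_max R P)))"

definition finite_type_algebra ::
    "('a, 'm) ring_scheme \<Rightarrow> ('b, 'n) ring_scheme \<Rightarrow> ('a \<Rightarrow> 'b) \<Rightarrow> bool"
  where "finite_type_algebra R S h \<longleftrightarrow> cring S \<and> h \<in> ring_hom R S \<and>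
    (\<exists>G \<subseteq> carrier S. finite G \<and> generate_ring S (h ` carrier R \<union> G) = carrier S)"

definition prime_chain_between ::
    "('a, 'b) ring_scheme \<Rightarrow> 'a set \<Rightarrow> 'a set \<Rightarrow> 'a set list \<Rightarrow> bool"
  where "prime_chain_between R P Q Ps \<longleftrightarrow> prime_chain R Ps \<and> hd Ps = P \<and> last Ps = Q"

definition maximal_prime_chain_between ::
    "('a, 'b) ring_scheme \<Rightarrow> 'a set \<Rightarrow> 'a set \<Rightarrow> 'a set list \<Rightarrow> bool"
  where "maximal_prime_chain_between R P Q Ps \<longleftrightarrow> prime_chain_between R P Q Ps \<and>
    (\<forall>Qs. prime_chain_between R P Q Qs \<and> set Ps \<subseteq> set Qs \<longrightarrow> Qs = Ps)"

definition catenary :: "('a, 'b) ring_scheme \<Rightarrow> bool"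
  where "catenary R \<longleftrightarrow> (\<forall>P\<in>Spec R. \<forall>Q\<in>Spec R. P \<subseteq> Q \<longrightarrow>
    (\<exists>n. \<forall>Ps. prime_chain_between R P Q Ps \<longrightarrow> length Ps \<le> n) \<and>
    (\<forall>Ps Qs. maximal_prime_chain_between R P Q Ps \<and> maximal_prime_chain_between R P Q Qs \<longrightarrow>
      length Ps = length Qs))"

text \<open>An algebra of finite type over a nonzero ring \<open>R\<close> has cardinality at most \<open>max |R| \<aleph>\<^sub>0\<close>, so
  it has a copy with carrier in the type \<^typ>\<open>nat \<Rightarrow> 'a\<close>.\<close>

definition universally_catenary :: "('a, 'b) ring_scheme \<Rightarrow> bool"
  where "universally_catenary R \<longleftrightarrow> cring R \<and> noetherian_ring R \<and>
    (\<forall>(S :: (nat \<Rightarrow> 'a) ring) h. finite_type_algebra R S h \<longrightarrow> catenary S)"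

definition zariski_open :: "('a, 'b) ring_scheme \<Rightarrow> 'a set set \<Rightarrow> bool"
  where "zariski_open R U \<longleftrightarrow> (\<exists>A \<subseteq> carrier R. U = {P \<in> Spec R. \<not> A \<subseteq> P})"

definition J2_ring :: "('a, 'b) ring_scheme \<Rightarrow> bool"
  where "J2_ring R \<longleftrightarrow> cring R \<and> noetherian_ring R \<and>
    (\<forall>(S :: (nat \<Rightarrow> 'a) ring) h. finite_type_algebra R S h \<longrightarrow>
      zariski_open S {P \<in> Spec S. regular_local_ring (loc_at S P)})"

definition excellent :: "('a, 'b) ring_scheme \<Rightarrow> bool"
  where "excellent R \<longleftrightarrow> universally_catenary R \<and> G_ring R \<and> J2_ring R"

definition reduction :: "('a, 'b) ring_scheme \<Rightarrow> 'a set \<Rightarrow> 'a set \<Rightarrow> bool"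
  where "reduction R J I \<longleftrightarrow> ideal J R \<and> J \<subseteq> I \<and>
    (\<exists>n::nat. ideal_prod R J (I [^]\<^bsub>ideals_set R\<^esub> n) = I [^]\<^bsub>ideals_set R\<^esub> Suc n)"

definition core :: "('a, 'b) ring_scheme \<Rightarrow> 'a set \<Rightarrow> 'a set"
  where "core R I = \<Inter>{J. reduction R J I}"

definition minimal_prime :: "('a, 'b) ring_scheme \<Rightarrow> 'a set \<Rightarrow> bool"
  where "minimal_prime R P \<longleftrightarrow> P \<in> Spec R \<and> (\<forall>Q\<in>Spec R. Q \<subseteq> P \<longrightarrow> Q = P)"

definition off_minimal_primes :: "('a, 'b) ring_scheme \<Rightarrow> 'a set"
  where "off_minimal_primes R = {c \<in> carrier R. \<forall>P. minimal_prime R P \<longrightarrow> c \<notin> P}"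

text \<open>Below, \<open>p\<close> is meant to be the prime characteristic of \<open>R\<close>.\<close>

definition frobenius_power :: "('a, 'b) ring_scheme \<Rightarrow> nat \<Rightarrow> 'a set \<Rightarrow> 'a set"
  where "frobenius_power R q I = Idl\<^bsub>R\<^esub> ((\<lambda>a. a [^]\<^bsub>R\<^esub> q) ` I)"

definition tight_closure :: "('a, 'b) ring_scheme \<Rightarrow> nat \<Rightarrow> 'a set \<Rightarrow> 'a set"
  where "tight_closure R p I = {x \<in> carrier R. \<exists>c \<in> off_minimal_primes R. \<exists>N. \<forall>e\<ge>N.
    c \<otimes>\<^bsub>R\<^esub> x [^]\<^bsub>R\<^esub> (p ^ e) \<in> frobenius_power R (p ^ e) I}"

definition star_reduction :: "('a, 'b) ring_scheme \<Rightarrow> nat \<Rightarrow> 'a set \<Rightarrow> 'a set \<Rightarrow> bool"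
  where "star_reduction R p J I \<longleftrightarrow> ideal J R \<and> J \<subseteq> I \<and> I \<subseteq> tight_closure R p J"

definition star_core :: "('a, 'b) ring_scheme \<Rightarrow> nat \<Rightarrow> 'a set \<Rightarrow> 'a set"
  where "star_core R p I = \<Inter>{J. star_reduction R p J I}"

definition ideal_colon :: "('a, 'b) ring_scheme \<Rightarrow> 'a set \<Rightarrow> 'a set \<Rightarrow> 'a set"
  where "ideal_colon R I K = {r \<in> carrier R. \<forall>x\<in>K. r \<otimes>\<^bsub>R\<^esub> x \<in> I}"

definition test_ideal :: "('a, 'b) ring_scheme \<Rightarrow> nat \<Rightarrow> 'a set"
  where "test_ideal R p = \<Inter>{ideal_colon R I (tight_closure R p I) | I. ideal I R}"

end

theory Submission
  imports Defs
begin

text \<open>Reductions and \<open>*\<close>-reductions of \<open>I = J^*\<close> are the same ideals.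

  From a finite injective resolution of \<open>R\<close> one gets, for all ideals \<open>a\<close>, the modules
  \<open>H\<^sup>i(a) = Ext\<^sup>i(R/a, R)\<close>, and one long exact sequence relating \<open>a + (s)\<close>, \<open>a\<close> and \<open>a : s\<close> is all that
  is used about them. By Nakayama's lemma nonvanishing of \<open>H\<^sup>i(P)\<close> moves to a larger prime at the cost
  of raising \<open>i\<close>; climbing along a chain of primes, or along a system of parameters, gives
  \<open>H\<^sup>i(m) = 0\<close> for \<open>i \<noteq> dim R\<close>. So every system of parameters is a regular sequence with a
  one-dimensional socle modulo it.

  As the test ideal is \<open>m\<close>, the ideal \<open>I\<close> lies in \<open>J : m\<close>, hence is \<open>J\<close> plus one generator, and
  \<open>m I = m J\<close>. A subideal \<open>K\<close> of \<open>I\<close> is, up to \<open>m J\<close> and after a change of generators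
  \<open>J = (x\<^sub>1, \<dots>, x\<^sub>d)\<close>, of the form \<open>(y, x\<^sub>k, \<dots>, x\<^sub>d)\<close>. If \<open>k = 1\<close>, it contains \<open>J\<close>. If \<open>k > 2\<close>, it is
  neither a reduction nor a \<open>*\<close>-reduction, as \<open>(y)\<close> contains no powers of a regular sequence
  \<open>x\<^sub>1, x\<^sub>2\<close>. If \<open>k = 2\<close>, everything takes place modulo \<open>(x\<^sub>2, \<dots>, x\<^sub>d)\<close>, where the single parameters
  \<open>x\<^sub>1\<close> and \<open>y\<close> can be exchanged: an equation \<open>x\<^sub>1^(n+1) = y g\<close> with \<open>g \<in> I^n\<close> raised to the \<open>q\<close>-th power
  gives \<open>c^n x\<^sub>1^q \<in> (y^q)\<close>, and conversely \<open>x\<^sub>1 \<in> (y)^*\<close> gives \<open>m x\<^sub>1 \<subseteq> m y\<close>, an integral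
  dependence.\<close>

text \<open>Evaluation at 1 turns \<open>Hom(R/a, E)\<close> into the elements of \<open>E\<close>
  killed by \<open>a\<close>, so neither quotient modules nor localizations have to be formed:
  classes are compared modulo boundaries, and vanishing at a prime means that some element outside
  it multiplies into the boundaries. The degree of nonvanishing is bounded from two sides: a longest
  chain of primes pushes it up to \<open>dim R\<close>, whereas each parameter raises it by at most
  one. The hypothesis on the test ideal acts uniformly: for every \<open>c\<close> in
  \<open>m\<close>, every \<open>z\<close> in the tight closure of \<open>L\<close> and every power
  \<open>q\<close> of \<open>p\<close>, even a small one, \<open>c z^q\<close> lies in
  \<open>L^[q]\<close>. With \<open>q = p\<close>, both \<open>I \<subseteq> m\<close> and
  \<open>m I = m J\<close> come down to \<open>m\<close> not lying in \<open>m^2\<close>. A subideal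
  \<open>K\<close> of \<open>I\<close> is known only up to \<open>m J\<close>. Nakayama's lemma
  absorbs this error twice: in \<open>I^(n+1)\<close> for reductions, and in \<open>m J^[q]\<close>
  for \<open>*\<close>-reductions, as \<open>(m J)^[q] \<subseteq> m (m J^[q])\<close> once
  \<open>q \<ge> 2\<close>. That a subideal containing \<open>J\<close> is a reduction follows from
  \<open>m I = m J\<close> by eliminating the generators of \<open>m\<close>.\<close>

no_notation Sum_Type.Plus (infixr "<+>" 65)

subsection \<open>Ideals of commutative rings\<close>

context cring
begin

lemma ideal_add_mem: "ideal I R \<Longrightarrow> x \<in> I \<Longrightarrow> y \<in> I \<Longrightarrow> x \<oplus> y \<in> I"
  by (simp add: additive_subgroup.a_closed ideal.axioms(1))

lemma ideal_mult_mem: "ideal I R \<Longrightarrow> x \<in> I \<Longrightarrow> r \<in> carrier R \<Longrightarrow> r \<otimes> x \<in> I"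
  by (rule ideal.I_l_closed)

lemma ideal_mult_mem': "ideal I R \<Longrightarrow> x \<in> I \<Longrightarrow> r \<in> carrier R \<Longrightarrow> x \<otimes> r \<in> I"
  by (rule ideal.I_r_closed)

lemma ideal_zero_mem: "ideal I R \<Longrightarrow> \<zero> \<in> I"
  by (simp add: additive_subgroup.zero_closed ideal.axioms(1))

lemma ideal_carrier: "ideal I R \<Longrightarrow> I \<subseteq> carrier R"
  by (auto intro: ideal.Icarr)

lemma ideal_uminus_mem: "ideal I R \<Longrightarrow> x \<in> I \<Longrightarrow> \<ominus> x \<in> I"
  by (simp add: additive_subgroup.a_inv_closed ideal.axioms(1))

lemma ideal_minus_mem: "ideal I R \<Longrightarrow> x \<in> I \<Longrightarrow> y \<in> I \<Longrightarrow> x \<ominus> y \<in> I"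
  by (simp add: a_minus_def ideal_add_mem ideal_uminus_mem)

lemma ideal_cancel_left: "ideal I R \<Longrightarrow> x \<oplus> y \<in> I \<Longrightarrow> x \<in> I \<Longrightarrow> y \<in> carrier R \<Longrightarrow> y \<in> I"
proof -
  assume a: "ideal I R" "x \<oplus> y \<in> I" "x \<in> I" "y \<in> carrier R"
  have x: "x \<in> carrier R" using a by (auto intro: ideal.Icarr)
  have "(x \<oplus> y) \<ominus> x = y" using a(4) x by algebra
  thus "y \<in> I" using ideal_minus_mem[OF a(1,2,3)] by simp
qed

lemma idealI':
  assumes "I \<subseteq> carrier R" "\<zero> \<in> I" "\<And>x y. x \<in> I \<Longrightarrow> y \<in> I \<Longrightarrow> x \<oplus> y \<in> I"
    "\<And>x r. x \<in> I \<Longrightarrow> r \<in> carrier R \<Longrightarrow> r \<otimes> x \<in> I"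
  shows "ideal I R"
proof (rule idealI[OF ring_axioms])
  show "subgroup I (add_monoid R)"
  proof (rule add.subgroupI)
    show "I \<noteq> {}" using assms by auto
    show "\<ominus> a \<in> I" if "a \<in> I" for a
    proof -
      have "\<ominus> a = (\<ominus> \<one>) \<otimes> a" using that assms(1) by (auto simp: l_minus)
      thus ?thesis using assms(4)[OF that, of "\<ominus> \<one>"] by simp
    qed
  qed (use assms in auto)
  show "\<And>a x. a \<in> I \<Longrightarrow> x \<in> carrier R \<Longrightarrow> x \<otimes> a \<in> I" using assms by blast
  fix a x assume "a \<in> I" "x \<in> carrier R"
  thus "a \<otimes> x \<in> I" using assms(4)[of a x] assms(1) by (metis m_comm subsetD)
qed

lemma mem_set_add: "x \<in> I <+> J \<longleftrightarrow> (\<exists>i\<in>I. \<exists>j\<in>J. x = i \<oplus> j)"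
  by (auto simp: set_add_def')

lemma set_add_upper1: "ideal I R \<Longrightarrow> ideal J R \<Longrightarrow> I \<subseteq> I <+> J"
  unfolding mem_set_add subset_iff
  by (metis ideal_zero_mem ideal.Icarr r_zero)

lemma set_add_upper2: "ideal I R \<Longrightarrow> ideal J R \<Longrightarrow> J \<subseteq> I <+> J"
  unfolding mem_set_add subset_iff
  by (metis ideal_zero_mem ideal.Icarr l_zero)

lemma set_add_least: "ideal K R \<Longrightarrow> I \<subseteq> K \<Longrightarrow> J \<subseteq> K \<Longrightarrow> I <+> J \<subseteq> K"
  unfolding mem_set_add subset_iff by (auto intro: ideal_add_mem)

lemma set_add_mono: "I \<subseteq> I' \<Longrightarrow> J \<subseteq> J' \<Longrightarrow> I <+> J \<subseteq> I' <+> J'"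
  unfolding mem_set_add subset_iff by blast

lemma mem_adjoin: "x \<in> I <+> PIdl s \<longleftrightarrow> (\<exists>y\<in>I. \<exists>r\<in>carrier R. x = y \<oplus> r \<otimes> s)"
  unfolding mem_set_add cgenideal_def by blast

lemma adjoin_ideal: "ideal I R \<Longrightarrow> s \<in> carrier R \<Longrightarrow> ideal (I <+> PIdl s) R"
  by (simp add: add_ideals cgenideal_ideal)

lemma adjoin_upper: "ideal I R \<Longrightarrow> s \<in> carrier R \<Longrightarrow> I \<subseteq> I <+> PIdl s"
  by (simp add: set_add_upper1 cgenideal_ideal)

lemma adjoin_mem: "ideal I R \<Longrightarrow> s \<in> carrier R \<Longrightarrow> s \<in> I <+> PIdl s"
  using set_add_upper2[of I "PIdl s"] cgenideal_self[of s] by (auto simp: cgenideal_ideal)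

lemma adjoin_least: "ideal J R \<Longrightarrow> I \<subseteq> J \<Longrightarrow> s \<in> J \<Longrightarrow> I <+> PIdl s \<subseteq> J"
  by (simp add: set_add_least cgenideal_minimal)

lemma mem_colon1: "r \<in> ideal_colon R I {s} \<longleftrightarrow> r \<in> carrier R \<and> r \<otimes> s \<in> I"
  by (auto simp: ideal_colon_def)

lemma colon_ideal:
  assumes "ideal I R" "S \<subseteq> carrier R" shows "ideal (ideal_colon R I S) R"
proof (rule idealI')
  show "ideal_colon R I S \<subseteq> carrier R" by (auto simp: ideal_colon_def)
  show "\<zero> \<in> ideal_colon R I S"
    using assms by (auto simp: ideal_colon_def subset_iff ideal_zero_mem)
  show "x \<oplus> y \<in> ideal_colon R I S" if "x \<in> ideal_colon R I S" "y \<in> ideal_colon R I S" for x y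
    using that assms by (auto simp: ideal_colon_def subset_iff l_distr ideal_add_mem)
  show "r \<otimes> x \<in> ideal_colon R I S" if "x \<in> ideal_colon R I S" "r \<in> carrier R" for x r
    using that assms by (auto simp: ideal_colon_def subset_iff m_assoc ideal_mult_mem)
qed

lemma colon1_ideal: "ideal I R \<Longrightarrow> s \<in> carrier R \<Longrightarrow> ideal (ideal_colon R I {s}) R"
  by (simp add: colon_ideal)

lemma colon_upper: "ideal I R \<Longrightarrow> S \<subseteq> carrier R \<Longrightarrow> I \<subseteq> ideal_colon R I S"
  by (auto simp: ideal_colon_def ideal.Icarr intro!: ideal_mult_mem')

lemma proper_iff: "ideal I R \<Longrightarrow> I \<noteq> carrier R \<longleftrightarrow> \<one> \<notin> I"
  using ideal.one_imp_carrier by force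

lemma colon_prime: "primeideal P R \<Longrightarrow> s \<in> carrier R \<Longrightarrow> s \<notin> P \<Longrightarrow> ideal_colon R P {s} = P"
  using primeideal.I_prime[of P R _ s] ideal_mult_mem'[of P _ s] ideal.Icarr[of P R]
  unfolding set_eq_iff mem_colon1 by (meson primeideal.axioms(1))

lemma primeideal_ideal: "primeideal P R \<Longrightarrow> ideal P R"
  by (rule primeideal.axioms(1))

lemma prime_one: "primeideal P R \<Longrightarrow> \<one> \<notin> P"
  using primeideal.I_notcarr[of P R] proper_iff[OF primeideal_ideal] by auto

lemma prime_compl_mult:
  "primeideal P R \<Longrightarrow> s \<in> carrier R - P \<Longrightarrow> t \<in> carrier R - P \<Longrightarrow> s \<otimes> t \<in> carrier R - P"
  using primeideal.I_prime[of P R s t] by auto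

lemma genideal_eqI: "ideal I R \<Longrightarrow> S \<subseteq> I \<Longrightarrow> (\<And>K. ideal K R \<Longrightarrow> S \<subseteq> K \<Longrightarrow> I \<subseteq> K) \<Longrightarrow> Idl S = I"
  by (intro equalityI genideal_minimal) (auto simp: genideal_def)

lemma genideal_empty: "Idl {} = {\<zero>}"
  by (rule genideal_eqI) (auto simp: zeroideal ideal_zero_mem)

lemma genideal_insert:
  assumes "s \<in> carrier R" "S \<subseteq> carrier R"
  shows "Idl (insert s S) = Idl S <+> PIdl s"
proof (rule genideal_eqI)
  have i: "ideal (Idl S) R" using assms genideal_ideal by blast
  show "ideal (Idl S <+> PIdl s) R" using adjoin_ideal i assms by blast
  show "insert s S \<subseteq> Idl S <+> PIdl s"
    using adjoin_mem[OF i assms(1)] adjoin_upper[OF i assms(1)] genideal_self[OF assms(2)] by blast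
  show "Idl S <+> PIdl s \<subseteq> K" if "ideal K R" "insert s S \<subseteq> K" for K
    using that by (intro adjoin_least) (auto simp: genideal_minimal)
qed

lemma genideal_Un:
  assumes "S \<subseteq> carrier R" "T \<subseteq> carrier R"
  shows "Idl (S \<union> T) = Idl S <+> Idl T"
proof (rule genideal_eqI)
  have i: "ideal (Idl S) R" "ideal (Idl T) R" using assms genideal_ideal by blast+
  show "ideal (Idl S <+> Idl T) R" using i add_ideals by blast
  show "S \<union> T \<subseteq> Idl S <+> Idl T"
    using set_add_upper1[OF i] set_add_upper2[OF i] assms genideal_self by blast
  show "Idl S <+> Idl T \<subseteq> K" if "ideal K R" "S \<union> T \<subseteq> K" for K
    using that by (intro set_add_least) (auto simp: genideal_minimal)
qed

end

lemma (in noetherian_ring) ideal_ACC: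
  assumes "\<And>n. ideal (f n) R" "\<And>n::nat. f n \<subseteq> f (Suc n)"
  shows "\<exists>N. \<forall>n\<ge>N. f n = f N"
proof -
  have mono: "i \<le> j \<Longrightarrow> f i \<subseteq> f j" for i j by (rule lift_Suc_mono_le[of f]) (use assms in auto)
  have "subset.chain {I. ideal I R} (range f)"
    unfolding subset.chain_def using assms(1) mono nat_le_linear by blast
  hence "\<Union>(range f) \<in> range f" by (intro ideal_chain_is_trivial) auto
  then obtain N where "\<Union>(range f) = f N" by blast
  thus ?thesis using mono by (intro exI[of _ N]) blast
qed

lemma (in noetherian_ring) wf_ideals: "wf {(J, I). ideal I R \<and> ideal J R \<and> I \<subset> J}"
proof (rule ccontr)
  assume "\<not> ?thesis"
  then obtain f where f: "\<And>n. (f (Suc n), f n) \<in> {(J, I). ideal I R \<and> ideal J R \<and> I \<subset> J}"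
    unfolding wf_iff_no_infinite_down_chain by blast
  have "\<exists>N. \<forall>n\<ge>N. f n = f N"
  proof (rule ideal_ACC)
    show "ideal (f n) R" "f n \<subseteq> f (Suc n)" for n using f[of n] by auto
  qed
  then obtain N where "\<forall>n\<ge>N. f n = f N" ..
  hence "f (Suc N) = f N" by (metis le_add2 plus_1_eq_Suc)
  thus False using f[of N] by auto
qed

text \<open>Noetherian induction: the inductive hypothesis speaks of the strictly larger
  ideals.\<close>

lemma (in noetherian_ring) ideal_induct [consumes 1, case_names ideal]:
  assumes "ideal I R"
    and step: "\<And>I. ideal I R \<Longrightarrow> (\<And>J. ideal J R \<Longrightarrow> I \<subset> J \<Longrightarrow> P J) \<Longrightarrow> P I"
  shows "P I"
  using wf_ideals assms(1)
proof (induction I rule: wf_induct_rule)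
  case (less I)
  show ?case by (rule step) (use less in auto)
qed

lemma (in noetherian_ring) ideal_maximal_exists:
  assumes "ideal I R" "Q I"
  shows "\<exists>J. ideal J R \<and> I \<subseteq> J \<and> Q J \<and> (\<forall>K. ideal K R \<longrightarrow> J \<subset> K \<longrightarrow> \<not> Q K)"
  using assms
proof (induction I rule: ideal_induct)
  case (ideal I)
  show ?case
  proof (cases "\<exists>K. ideal K R \<and> I \<subset> K \<and> Q K")
    case True
    then obtain K where "ideal K R" "I \<subset> K" "Q K" by blast
    thus ?thesis using ideal.IH[of K] by (meson order.strict_implies_order order_trans)
  next
    case False
    thus ?thesis using ideal by blast
  qed
qed

subsection \<open>Associated primes and prime avoidance\<close>

locale noetherian_cring = noetherian_ring + cring

context noetherian_cring
begin

text \<open>The associated primes of the module \<open>R/I\<close>: primes that are annihilators of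
  a class \<open>u + I\<close>.\<close>

definition assoc_primes :: "'a set \<Rightarrow> 'a set set"
  where "assoc_primes I = {P. primeideal P R \<and> (\<exists>u\<in>carrier R. P = ideal_colon R I {u})}"

text \<open>A maximal element among the annihilators of nonzero elements of \<open>R/I\<close> is
  prime.\<close>

lemma colon_in_assoc_prime:
  assumes I: "ideal I R" and r: "r \<in> carrier R" "r \<notin> I"
  shows "\<exists>P\<in>assoc_primes I. ideal_colon R I {r} \<subseteq> P"
proof -
  define Q where "Q = (\<lambda>J. \<exists>u\<in>carrier R - I. J = ideal_colon R I {u})"
  have "ideal (ideal_colon R I {r}) R" "Q (ideal_colon R I {r})"
    unfolding Q_def using assms colon1_ideal by auto
  from ideal_maximal_exists[of _ Q, OF this] obtain J where J: "ideal J R"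
    "ideal_colon R I {r} \<subseteq> J" "Q J" and max: "\<And>K. ideal K R \<Longrightarrow> J \<subset> K \<Longrightarrow> \<not> Q K" by blast
  then obtain u where u: "u \<in> carrier R" "u \<notin> I" "J = ideal_colon R I {u}" unfolding Q_def by blast
  have "primeideal J R"
  proof (rule primeidealI[OF J(1) is_cring])
    show "carrier R \<noteq> J" using u mem_colon1[of \<one> I u] by auto
    fix a b assume ab: "a \<in> carrier R" "b \<in> carrier R" "a \<otimes> b \<in> J"
    show "a \<in> J \<or> b \<in> J"
    proof (rule ccontr)
      assume n: "\<not> (a \<in> J \<or> b \<in> J)"
      hence bu: "b \<otimes> u \<notin> I" using ab u mem_colon1 by auto
      \<comment> \<open>The class of \<open>b u\<close> is nonzero, and its annihilator contains
        \<open>J\<close> and also \<open>a\<close>, against maximality of \<open>J\<close>.\<close>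
      let ?K = "ideal_colon R I {b \<otimes> u}"
      have "J \<subseteq> ?K" using u ab I
        by (auto simp: mem_colon1) (metis ideal_mult_mem m_closed m_lcomm)
      moreover have "a \<in> ?K" using ab u by (auto simp: mem_colon1 m_assoc)
      ultimately have "J \<subset> ?K" using n by blast
      moreover have "Q ?K" unfolding Q_def using bu ab u by blast
      ultimately show False using max[of ?K] colon1_ideal[OF I] ab u by auto
    qed
  qed
  thus ?thesis using J u unfolding assoc_primes_def by blast
qed

text \<open>If \<open>P\<close> is the annihilator of \<open>u\<close> in \<open>R/I\<close>, then
  \<open>R/P\<close> embeds into \<open>R/I\<close> with quotient \<open>R/(I + (u))\<close>, and
  the only associated prime of \<open>R/P\<close> is \<open>P\<close>. So passing from
  \<open>I\<close> to the larger ideal \<open>I + (u)\<close> loses at most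
  \<open>P\<close>.\<close>

lemma finite_assoc_primes: "ideal I R \<Longrightarrow> finite (assoc_primes I)"
proof (induction I rule: ideal_induct)
  case (ideal I)
  show ?case
  proof (cases "I = carrier R")
    case True
    have "assoc_primes I = {}" unfolding assoc_primes_def using True prime_one mem_colon1 by force
    thus ?thesis by simp
  next
    case False
    hence "\<one> \<notin> I" using ideal(1) proper_iff by blast
    from colon_in_assoc_prime[OF ideal(1) one_closed this] obtain P where "P \<in> assoc_primes I" by blast
    then obtain u where u: "u \<in> carrier R" "P = ideal_colon R I {u}" and P: "primeideal P R"
      unfolding assoc_primes_def by blast
    have uI: "u \<notin> I" using prime_one[OF P] u mem_colon1[of \<one>] by auto
    let ?J = "I <+> PIdl u"
    have J: "ideal ?J R" "I \<subseteq> ?J" "u \<in> ?J"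
      using adjoin_ideal adjoin_upper adjoin_mem ideal(1) u(1) by blast+
    have "finite (assoc_primes ?J)" using ideal.IH[of ?J] J uI by blast
    moreover have "assoc_primes I \<subseteq> insert P (assoc_primes ?J)"
    proof
      fix Q assume "Q \<in> assoc_primes I"
      then obtain v where v: "v \<in> carrier R" "Q = ideal_colon R I {v}" and Q: "primeideal Q R"
        unfolding assoc_primes_def by blast
      show "Q \<in> insert P (assoc_primes ?J)"
      proof (cases "Q = ideal_colon R ?J {v}")
        case True
        thus ?thesis using Q v unfolding assoc_primes_def by blast
      next
        case False
        \<comment> \<open>If the annihilator of \<open>v\<close> grows modulo \<open>?J\<close>,
          some \<open>a\<close> outside \<open>Q\<close> has \<open>a v\<close> congruent to
          \<open>s u\<close> modulo \<open>I\<close>. This common class is nonzero in the copy of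
          \<open>R/Q\<close> generated by \<open>v\<close> and in the copy of \<open>R/P\<close>
          generated by \<open>u\<close>, so its annihilator is both \<open>Q\<close> and
          \<open>P\<close>.\<close>
        have "Q \<subseteq> ideal_colon R ?J {v}" using v J by (auto simp: mem_colon1)
        then obtain a where "a \<in> ideal_colon R ?J {v}" and aQ: "a \<notin> Q" using False by blast
        hence a: "a \<in> carrier R" "a \<otimes> v \<in> ?J" "a \<notin> Q" using mem_colon1 by auto
        from a(2) obtain i s where i: "i \<in> I" "s \<in> carrier R" "a \<otimes> v = i \<oplus> s \<otimes> u"
          unfolding mem_adjoin by blast
        have iR: "i \<in> carrier R" by (rule ideal.Icarr[OF ideal(1) i(1)])
        have eq: "b \<otimes> (a \<otimes> v) \<in> I \<longleftrightarrow> b \<otimes> (s \<otimes> u) \<in> I" if b: "b \<in> carrier R" for b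
        proof -
          have e: "b \<otimes> (a \<otimes> v) = b \<otimes> i \<oplus> b \<otimes> (s \<otimes> u)" using b i iR u by (simp add: r_distr)
          have bi: "b \<otimes> i \<in> I" using b i ideal(1) ideal_mult_mem by blast
          show ?thesis unfolding e using bi b i u ideal(1)
            by (meson ideal_add_mem ideal_cancel_left m_closed)
        qed
        have s: "s \<notin> P"
        proof
          assume "s \<in> P"
          hence "s \<otimes> u \<in> I" using u mem_colon1 by auto
          hence "\<one> \<otimes> (s \<otimes> u) \<in> I" using i u by simp
          hence "a \<otimes> v \<in> I" using eq[of \<one>] a v by simp
          thus False using a v mem_colon1 by blast
        qed
        have "b \<in> Q \<longleftrightarrow> b \<in> P" if b: "b \<in> carrier R" for b
        proof -
          have "b \<in> Q \<longleftrightarrow> b \<otimes> a \<in> Q" using a b Q primeideal.I_prime[OF Q b a(1)]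
            ideal_mult_mem'[OF primeideal_ideal[OF Q]] by blast
          also have "\<dots> \<longleftrightarrow> b \<otimes> (a \<otimes> v) \<in> I" using v a b by (simp add: mem_colon1 m_assoc)
          also have "\<dots> \<longleftrightarrow> b \<otimes> (s \<otimes> u) \<in> I" by (rule eq[OF b])
          also have "\<dots> \<longleftrightarrow> b \<otimes> s \<in> P" using u i b by (simp add: mem_colon1 m_assoc)
          also have "\<dots> \<longleftrightarrow> b \<in> P" using s i b primeideal.I_prime[OF P b i(2)]
            ideal_mult_mem'[OF primeideal_ideal[OF P]] by blast
          finally show ?thesis .
        qed
        hence "Q = P" using v u mem_colon1 by blast
        thus ?thesis by simp
      qed
    qed
    ultimately show ?thesis by (meson finite.insertI finite_subset)
  qed
qed

end

lemma (in cring) prime_avoid_aux: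
  assumes P: "primeideal P R" and I: "ideal I R" "\<not> I \<subseteq> P" and "finite F"
    and "\<And>Q. Q \<in> F \<Longrightarrow> ideal Q R \<and> \<not> Q \<subseteq> P"
  shows "\<exists>z\<in>I. z \<notin> P \<and> (\<forall>Q\<in>F. z \<in> Q)"
  using assms(4,5)
proof (induction F)
  case empty
  thus ?case using I by auto
next
  case (insert Q F)
  then obtain z where z: "z \<in> I" "z \<notin> P" "\<forall>Q\<in>F. z \<in> Q" by auto
  obtain y where y: "y \<in> Q" "y \<notin> P" using insert.prems by blast
  have yR: "y \<in> carrier R" "z \<in> carrier R"
    using y(1) z(1) I(1) insert.prems[of Q] by (auto intro: ideal.Icarr)
  have "y \<otimes> z \<in> I" "y \<otimes> z \<in> Q" "\<forall>Q\<in>F. y \<otimes> z \<in> Q"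
    using y z yR I insert.prems by (auto intro: ideal_mult_mem ideal_mult_mem')
  moreover have "y \<otimes> z \<notin> P" using primeideal.I_prime[OF P yR] y z by blast
  ultimately show ?case by blast
qed

lemma (in cring) prime_avoidance:
  assumes "ideal I R" "finite F" "\<And>Q. Q \<in> F \<Longrightarrow> primeideal Q R" "I \<subseteq> \<Union>F"
  shows "\<exists>Q\<in>F. I \<subseteq> Q"
proof -
  have "\<exists>x\<in>I. x \<notin> \<Union>F" if "card F = n" "finite F" "\<And>Q. Q \<in> F \<Longrightarrow> primeideal Q R \<and> \<not> I \<subseteq> Q" for n F
    using that
  proof (induction n arbitrary: F)
    case 0
    thus ?case using ideal_zero_mem[OF assms(1)] by auto
  next
    case (Suc n)
    then obtain P G where F: "F = insert P G" "P \<notin> G" "card G = n" "finite G"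
      by (metis card_Suc_eq finite_insert)
    show ?case
    proof (cases "\<exists>Q\<in>G. Q \<subseteq> P")
      case True
      then obtain Q where Q: "Q \<in> G" "Q \<subseteq> P" by blast
      have "card (insert P (G - {Q})) = n"
        using F Q by (metis Diff_iff card.insert card.remove finite_Diff)
      moreover have "\<Union>(insert P (G - {Q})) = \<Union>F" using F Q by auto
      moreover have "\<exists>x\<in>I. x \<notin> \<Union>(insert P (G - {Q}))"
        by (rule Suc.IH) (use calculation(1) Suc.prems F in auto)
      ultimately show ?thesis by simp
    next
      case False
      obtain x where x: "x \<in> I" "x \<notin> \<Union>G" using Suc.IH[of G] Suc.prems F by auto
      have P: "primeideal P R" "\<not> I \<subseteq> P" using Suc.prems F by auto
      obtain z where z: "z \<in> I" "z \<notin> P" "\<forall>Q\<in>G. z \<in> Q"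
        using prime_avoid_aux[OF P(1) assms(1) P(2), of G] False F Suc.prems primeideal_ideal by auto
      have xR: "x \<in> carrier R" "z \<in> carrier R"
        using ideal.Icarr[OF assms(1)] x(1) z(1) by auto
      show ?thesis
      proof (cases "x \<in> P")
        case False
        thus ?thesis using x F by auto
      next
        case True
        have "x \<oplus> z \<notin> P" using True z xR ideal_cancel_left[OF primeideal_ideal[OF P(1)]] by blast
        moreover have "x \<oplus> z \<notin> Q" if "Q \<in> G" for Q
          
        proof
          assume "x \<oplus> z \<in> Q"
          hence "z \<oplus> x \<in> Q" using xR a_comm by simp
          moreover have "ideal Q R" using that F Suc.prems primeideal_ideal by blast
          ultimately have "x \<in> Q" using ideal_cancel_left that z xR by blast
          thus False using x that by blast
        qed
        ultimately show ?thesis using x z F ideal_add_mem[OF assms(1)] by blast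
      qed
    qed
  qed
  from this[of F] assms show ?thesis by blast
qed

text \<open>If each element of \<open>M\<close> is a zero divisor on \<open>R/c\<close>, then
  \<open>M\<close> is covered by the finitely many associated primes and hence lies in a single one,
  which is the annihilator of one element \<open>u\<close>.\<close>

lemma (in noetherian_cring) zero_divisors_socle:
  assumes c: "ideal c R" and M: "ideal M R"
    and zd: "\<And>y. y \<in> M \<Longrightarrow> \<exists>r\<in>carrier R - c. y \<otimes> r \<in> c"
  shows "\<exists>u\<in>carrier R - c. \<forall>y\<in>M. y \<otimes> u \<in> c"
proof -
  have "M \<subseteq> \<Union>(assoc_primes c)"
  proof
    fix y assume y: "y \<in> M"
    then obtain r where r: "r \<in> carrier R" "r \<notin> c" "y \<otimes> r \<in> c" using zd by blast
    have "y \<in> ideal_colon R c {r}" using r y ideal.Icarr[OF M y] by (simp add: mem_colon1)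
    thus "y \<in> \<Union>(assoc_primes c)" using colon_in_assoc_prime[OF c r(1,2)] by blast
  qed
  from prime_avoidance[OF M finite_assoc_primes[OF c] _ this]
  obtain P where P: "P \<in> assoc_primes c" "M \<subseteq> P" unfolding assoc_primes_def by blast
  then obtain u where u: "u \<in> carrier R" "P = ideal_colon R c {u}" "primeideal P R"
    unfolding assoc_primes_def by blast
  have "u \<notin> c" using prime_one[OF u(3)] u mem_colon1[of \<one>] by auto
  thus ?thesis using u P mem_colon1 by blast
qed

subsection \<open>Modules and injective resolutions\<close>

context module
begin

lemma smult_r_a_minus:
  "r \<in> carrier R \<Longrightarrow> x \<in> carrier M \<Longrightarrow> y \<in> carrier M \<Longrightarrow>
    r \<odot>\<^bsub>M\<^esub> (x \<ominus>\<^bsub>M\<^esub> y) = r \<odot>\<^bsub>M\<^esub> x \<ominus>\<^bsub>M\<^esub> r \<odot>\<^bsub>M\<^esub> y"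
  by (simp add: a_minus_def smult_r_distr smult_r_minus)

lemma smult_l_a_minus:
  "r \<in> carrier R \<Longrightarrow> t \<in> carrier R \<Longrightarrow> x \<in> carrier M \<Longrightarrow>
    (r \<ominus> t) \<odot>\<^bsub>M\<^esub> x = r \<odot>\<^bsub>M\<^esub> x \<ominus>\<^bsub>M\<^esub> t \<odot>\<^bsub>M\<^esub> x"
  by (simp add: a_minus_def smult_l_distr smult_l_minus)

lemma smult_comm:
  "r \<in> carrier R \<Longrightarrow> t \<in> carrier R \<Longrightarrow> x \<in> carrier M \<Longrightarrow>
    r \<odot>\<^bsub>M\<^esub> (t \<odot>\<^bsub>M\<^esub> x) = t \<odot>\<^bsub>M\<^esub> (r \<odot>\<^bsub>M\<^esub> x)"
  by (metis R.m_comm smult_assoc1)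

lemma minus_cancel: "x \<in> carrier M \<Longrightarrow> y \<in> carrier M \<Longrightarrow> (x \<ominus>\<^bsub>M\<^esub> y) \<oplus>\<^bsub>M\<^esub> y = x"
  by (simp add: a_minus_def M.a_assoc M.l_neg)

lemma add_minus_cancel: "x \<in> carrier M \<Longrightarrow> y \<in> carrier M \<Longrightarrow> (x \<oplus>\<^bsub>M\<^esub> y) \<ominus>\<^bsub>M\<^esub> x = y"
  by (simp add: a_minus_def M.a_comm[of x y] M.a_assoc M.r_neg)

lemma submodule_mem: "submodule H R M \<Longrightarrow> x \<in> H \<Longrightarrow> x \<in> carrier M"
  using submoduleE(1) by blast

lemma submodule_add: "submodule H R M \<Longrightarrow> x \<in> H \<Longrightarrow> y \<in> H \<Longrightarrow> x \<oplus>\<^bsub>M\<^esub> y \<in> H"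
  by (rule submoduleE(5))

lemma submodule_minus: "submodule H R M \<Longrightarrow> x \<in> H \<Longrightarrow> y \<in> H \<Longrightarrow> x \<ominus>\<^bsub>M\<^esub> y \<in> H"
  by (simp add: a_minus_def submoduleE(3,5))

lemma submodule_smult: "submodule H R M \<Longrightarrow> r \<in> carrier R \<Longrightarrow> x \<in> H \<Longrightarrow> r \<odot>\<^bsub>M\<^esub> x \<in> H"
  by (rule submoduleE(4))

lemma submodule_zero: "submodule H R M \<Longrightarrow> \<zero>\<^bsub>M\<^esub> \<in> H"
  using submoduleE(2)[of H] submodule_minus[of H] submoduleE(1)[of H]
  by (metis M.r_neg a_minus_def all_not_in_conv submodule_mem)

lemma submoduleI':
  assumes "H \<subseteq> carrier M" "\<zero>\<^bsub>M\<^esub> \<in> H" "\<And>x y. x \<in> H \<Longrightarrow> y \<in> H \<Longrightarrow> x \<oplus>\<^bsub>M\<^esub> y \<in> H"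
    "\<And>r x. r \<in> carrier R \<Longrightarrow> x \<in> H \<Longrightarrow> r \<odot>\<^bsub>M\<^esub> x \<in> H"
  shows "submodule H R M"
proof (rule submoduleI)
  fix x assume x: "x \<in> H"
  have "(\<ominus> \<one>) \<odot>\<^bsub>M\<^esub> x = \<ominus>\<^bsub>M\<^esub> x" using x assms(1) by (simp add: smult_l_minus subset_iff)
  thus "\<ominus>\<^bsub>M\<^esub> x \<in> H" using assms(4)[of "\<ominus> \<one>" x] x by simp
qed (use assms in auto)

lemma mem_sum: "x \<in> H <+>\<^bsub>M\<^esub> K \<longleftrightarrow> (\<exists>h\<in>H. \<exists>k\<in>K. x = h \<oplus>\<^bsub>M\<^esub> k)"
  by (auto simp: set_add_def')

lemma submodule_sum:
  assumes H: "submodule H R M" and K: "submodule K R M"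
  shows "submodule (H <+>\<^bsub>M\<^esub> K) R M"
proof (rule submoduleI')
  note mem = submodule_mem[OF H] submodule_mem[OF K]
  show "H <+>\<^bsub>M\<^esub> K \<subseteq> carrier M" using mem by (auto simp: mem_sum)
  show "\<zero>\<^bsub>M\<^esub> \<in> H <+>\<^bsub>M\<^esub> K" unfolding mem_sum
    by (metis H K M.l_zero M.zero_closed submodule_zero)
  show "x \<oplus>\<^bsub>M\<^esub> y \<in> H <+>\<^bsub>M\<^esub> K" if xy: "x \<in> H <+>\<^bsub>M\<^esub> K" "y \<in> H <+>\<^bsub>M\<^esub> K" for x y
  proof -
    obtain h k h' k' where e: "h \<in> H" "k \<in> K" "x = h \<oplus>\<^bsub>M\<^esub> k" "h' \<in> H" "k' \<in> K" "y = h' \<oplus>\<^bsub>M\<^esub> k'"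
      using xy unfolding mem_sum by blast
    have "x \<oplus>\<^bsub>M\<^esub> y = (h \<oplus>\<^bsub>M\<^esub> h') \<oplus>\<^bsub>M\<^esub> (k \<oplus>\<^bsub>M\<^esub> k')"
      using e mem by (simp add: M.a_ac)
    thus ?thesis using e submodule_add[OF H] submodule_add[OF K] mem_sum by metis
  qed
  show "r \<odot>\<^bsub>M\<^esub> x \<in> H <+>\<^bsub>M\<^esub> K" if "r \<in> carrier R" "x \<in> H <+>\<^bsub>M\<^esub> K" for r x
    using that mem submodule_smult[OF H] submodule_smult[OF K] unfolding mem_sum
    by (metis smult_r_distr)
qed

lemma sum_upper1: "submodule H R M \<Longrightarrow> submodule K R M \<Longrightarrow> H \<subseteq> H <+>\<^bsub>M\<^esub> K"
  unfolding mem_sum subset_iff by (metis M.r_zero submodule_mem submodule_zero)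

lemma sum_upper2: "submodule H R M \<Longrightarrow> submodule K R M \<Longrightarrow> K \<subseteq> H <+>\<^bsub>M\<^esub> K"
  unfolding mem_sum subset_iff by (metis M.l_zero submodule_mem submodule_zero)

lemma sum_least: "submodule L R M \<Longrightarrow> H \<subseteq> L \<Longrightarrow> K \<subseteq> L \<Longrightarrow> H <+>\<^bsub>M\<^esub> K \<subseteq> L"
  by (auto simp: mem_sum intro!: submodule_add)

lemma submodule_cyclic: "x \<in> carrier M \<Longrightarrow> submodule ((\<lambda>r. r \<odot>\<^bsub>M\<^esub> x) ` carrier R) R M"
proof (rule submoduleI')
  assume x: "x \<in> carrier M"
  show "(\<lambda>r. r \<odot>\<^bsub>M\<^esub> x) ` carrier R \<subseteq> carrier M" using x by auto
  show "\<zero>\<^bsub>M\<^esub> \<in> (\<lambda>r. r \<odot>\<^bsub>M\<^esub> x) ` carrier R" using x by (auto intro!: image_eqI[of _ _ \<zero>])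
  show "y \<oplus>\<^bsub>M\<^esub> z \<in> (\<lambda>r. r \<odot>\<^bsub>M\<^esub> x) ` carrier R"
    if "y \<in> (\<lambda>r. r \<odot>\<^bsub>M\<^esub> x) ` carrier R" "z \<in> (\<lambda>r. r \<odot>\<^bsub>M\<^esub> x) ` carrier R" for y z
    using that x by (auto simp flip: smult_l_distr)
  show "t \<odot>\<^bsub>M\<^esub> y \<in> (\<lambda>r. r \<odot>\<^bsub>M\<^esub> x) ` carrier R"
    if "t \<in> carrier R" "y \<in> (\<lambda>r. r \<odot>\<^bsub>M\<^esub> x) ` carrier R" for t y
    using that x by (auto simp flip: smult_assoc1)
qed

end

text \<open>An injective resolution of \<open>R\<close>, where \<open>v0\<close> is the image of \<open>1\<close>. Injectivity is only required for
  the embeddings \<open>R/(a : s) \<rightarrow> R/a\<close> given by multiplication by \<open>s\<close>.\<close>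

locale injective_resolution = noetherian_cring R for R :: "('a, 'r) ring_scheme" (structure) +
  fixes E :: "nat \<Rightarrow> ('a, 'e, 'm) module_scheme" and d :: "nat \<Rightarrow> 'e \<Rightarrow> 'e" and v0 :: 'e and n0 :: nat
  assumes E_module: "module R (E i)"
    and d_hom: "d i \<in> mod_hom R (E i) (E (Suc i))"
    and E_lift: "ideal a R \<Longrightarrow> s \<in> carrier R \<Longrightarrow> e \<in> carrier (E i) \<Longrightarrow>
      (\<And>r. r \<in> ideal_colon R a {s} \<Longrightarrow> r \<odot>\<^bsub>E i\<^esub> e = \<zero>\<^bsub>E i\<^esub>) \<Longrightarrow>
      \<exists>e'\<in>carrier (E i). (\<forall>r\<in>a. r \<odot>\<^bsub>E i\<^esub> e' = \<zero>\<^bsub>E i\<^esub>) \<and> s \<odot>\<^bsub>E i\<^esub> e' = e"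
    and exact: "d i ` carrier (E i) = {x \<in> carrier (E (Suc i)). d (Suc i) x = \<zero>\<^bsub>E (Suc (Suc i))\<^esub>}"
    and v0: "v0 \<in> carrier (E 0)" "r \<in> carrier R \<Longrightarrow> r \<odot>\<^bsub>E 0\<^esub> v0 = \<zero>\<^bsub>E 0\<^esub> \<Longrightarrow> r = \<zero>"
    and ker0: "{x \<in> carrier (E 0). d 0 x = \<zero>\<^bsub>E 1\<^esub>} = (\<lambda>r. r \<odot>\<^bsub>E 0\<^esub> v0) ` carrier R"
    and E_bound: "i > n0 \<Longrightarrow> carrier (E i) = {\<zero>\<^bsub>E i\<^esub>}"
begin

text \<open>This is \<open>Hom(R/a, E i)\<close>, a homomorphism being determined by its value at 1.
  The sets \<open>Z\<close> and \<open>B\<close> below are the cocycles and the boundaries of the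
  complex \<open>Hom(R/a, E)\<close>, which starts in degree 0.\<close>

definition kil :: "nat \<Rightarrow> 'a set \<Rightarrow> 'e set"
  where "kil i a = {x \<in> carrier (E i). \<forall>r\<in>a. r \<odot>\<^bsub>E i\<^esub> x = \<zero>\<^bsub>E i\<^esub>}"

definition Z :: "nat \<Rightarrow> 'a set \<Rightarrow> 'e set"
  where "Z i a = {x \<in> kil i a. d i x = \<zero>\<^bsub>E (Suc i)\<^esub>}"

fun B :: "nat \<Rightarrow> 'a set \<Rightarrow> 'e set" where
  "B 0 a = {\<zero>\<^bsub>E 0\<^esub>}"
| "B (Suc i) a = d i ` kil i a"

sublocale E: module R "E i" for i by (rule E_module)

lemma d_closed [simp]: "x \<in> carrier (E i) \<Longrightarrow> d i x \<in> carrier (E (Suc i))"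
  using d_hom[of i] by (auto simp: mod_hom_def)

lemma d_add: "x \<in> carrier (E i) \<Longrightarrow> y \<in> carrier (E i) \<Longrightarrow> d i (x \<oplus>\<^bsub>E i\<^esub> y) = d i x \<oplus>\<^bsub>E (Suc i)\<^esub> d i y"
  using d_hom[of i] by (auto simp: mod_hom_def)

lemma d_smult: "r \<in> carrier R \<Longrightarrow> x \<in> carrier (E i) \<Longrightarrow> d i (r \<odot>\<^bsub>E i\<^esub> x) = r \<odot>\<^bsub>E (Suc i)\<^esub> d i x"
  using d_hom[of i] by (auto simp: mod_hom_def)

lemma d_zero [simp]: "d i \<zero>\<^bsub>E i\<^esub> = \<zero>\<^bsub>E (Suc i)\<^esub>"
  using d_smult[of \<zero> "\<zero>\<^bsub>E i\<^esub>" i] by simp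

lemma d_minus: "x \<in> carrier (E i) \<Longrightarrow> y \<in> carrier (E i) \<Longrightarrow> d i (x \<ominus>\<^bsub>E i\<^esub> y) = d i x \<ominus>\<^bsub>E (Suc i)\<^esub> d i y"
  using d_add[of "x \<ominus>\<^bsub>E i\<^esub> y" i y] E.minus_cancel[of x i y]
  by (metis E.M.add.inv_closed E.M.add.inv_solve_right E.M.add.m_closed a_minus_def d_closed)

lemma d_d [simp]: "x \<in> carrier (E i) \<Longrightarrow> d (Suc i) (d i x) = \<zero>\<^bsub>E (Suc (Suc i))\<^esub>"
  using exact[of i] by blast

lemma kil_mem: "x \<in> kil i a \<Longrightarrow> x \<in> carrier (E i)"
  by (simp add: kil_def)

lemma kil_submodule: "a \<subseteq> carrier R \<Longrightarrow> submodule (kil i a) R (E i)"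
  by (rule E.submoduleI')
    (auto simp: kil_def E.smult_r_distr subset_iff E.smult_comm)

lemma Z_submodule: "a \<subseteq> carrier R \<Longrightarrow> submodule (Z i a) R (E i)"
  using kil_submodule[of a i] unfolding Z_def
  by (intro E.submoduleI')
    (auto simp: d_add d_smult kil_mem E.submodule_add E.submodule_smult E.submodule_zero)

lemma B_submodule: "a \<subseteq> carrier R \<Longrightarrow> submodule (B i a) R (E i)"
proof (cases i)
  case (Suc j)
  assume "a \<subseteq> carrier R"
  note k = kil_submodule[OF this, of j]
  show ?thesis unfolding Suc B.simps
  proof (rule E.submoduleI')
    show "d j ` kil j a \<subseteq> carrier (E (Suc j))" using kil_mem by auto
    show "\<zero>\<^bsub>E (Suc j)\<^esub> \<in> d j ` kil j a" using E.submodule_zero[OF k] by (metis d_zero imageI)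
    show "x \<oplus>\<^bsub>E (Suc j)\<^esub> y \<in> d j ` kil j a" if "x \<in> d j ` kil j a" "y \<in> d j ` kil j a" for x y
      using that E.submodule_add[OF k] kil_mem d_add by (auto simp flip: d_add)
    show "r \<odot>\<^bsub>E (Suc j)\<^esub> x \<in> d j ` kil j a" if "r \<in> carrier R" "x \<in> d j ` kil j a" for r x
      using that E.submodule_smult[OF k] kil_mem by (auto simp flip: d_smult)
  qed
qed (auto intro!: E.submoduleI')

lemma Z_mem: "x \<in> Z i a \<Longrightarrow> x \<in> carrier (E i)"
  using kil_mem by (auto simp: Z_def)

lemma Z_d: "x \<in> Z i a \<Longrightarrow> d i x = \<zero>\<^bsub>E (Suc i)\<^esub>"
  by (simp add: Z_def)

lemma Z_kil: "x \<in> Z i a \<Longrightarrow> x \<in> kil i a"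
  by (simp add: Z_def)

lemma B_le_Z: "a \<subseteq> carrier R \<Longrightarrow> B i a \<subseteq> Z i a"
proof (cases i)
  case (Suc j)
  assume a: "a \<subseteq> carrier R"
  have "d j x \<in> kil (Suc j) a" if "x \<in> kil j a" for x
  proof -
    have "r \<odot>\<^bsub>E (Suc j)\<^esub> d j x = \<zero>\<^bsub>E (Suc j)\<^esub>" if "r \<in> a" for r
      using that \<open>x \<in> kil j a\<close> a by (auto simp: kil_def subset_iff simp flip: d_smult)
    thus ?thesis using that by (simp add: kil_def)
  qed
  thus ?thesis unfolding Suc by (auto simp: Z_def kil_mem)
qed (use E.submodule_zero[OF Z_submodule] in auto)

lemma B_mem: "a \<subseteq> carrier R \<Longrightarrow> x \<in> B i a \<Longrightarrow> x \<in> carrier (E i)"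
  using B_le_Z Z_mem by blast

lemma kil_anti: "a \<subseteq> b \<Longrightarrow> kil i b \<subseteq> kil i a"
  by (auto simp: kil_def)

lemma Z_anti: "a \<subseteq> b \<Longrightarrow> Z i b \<subseteq> Z i a"
  using kil_anti[of a b i] by (auto simp: Z_def)

lemma B_anti: "a \<subseteq> b \<Longrightarrow> B i b \<subseteq> B i a"
  using kil_anti by (cases i) (auto simp: image_mono)

lemma kil_adjoin:
  assumes "ideal a R" "s \<in> carrier R"
  shows "x \<in> kil i (a <+> PIdl s) \<longleftrightarrow> x \<in> kil i a \<and> s \<odot>\<^bsub>E i\<^esub> x = \<zero>\<^bsub>E i\<^esub>" (is "?l \<longleftrightarrow> ?r")
proof
  show "?l \<Longrightarrow> ?r"
    using adjoin_mem[OF assms] kil_anti[OF adjoin_upper[OF assms]] by (auto simp: kil_def)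
  assume r: ?r
  have "y \<odot>\<^bsub>E i\<^esub> x = \<zero>\<^bsub>E i\<^esub>" if y: "y \<in> a <+> PIdl s" for y
  proof -
    obtain z r where z: "z \<in> a" "r \<in> carrier R" "y = z \<oplus> r \<otimes> s" using y unfolding mem_adjoin by blast
    have "z \<in> carrier R" using ideal.Icarr[OF assms(1) z(1)] .
    thus ?thesis using r z assms(2) by (simp add: kil_def E.smult_l_distr E.smult_assoc1)
  qed
  thus ?l using r by (simp add: kil_def)
qed

lemma Z_adjoin:
  "ideal a R \<Longrightarrow> s \<in> carrier R \<Longrightarrow> x \<in> Z i (a <+> PIdl s) \<longleftrightarrow> x \<in> Z i a \<and> s \<odot>\<^bsub>E i\<^esub> x = \<zero>\<^bsub>E i\<^esub>"
  by (auto simp: Z_def kil_adjoin)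

text \<open>Multiplication by \<open>s\<close> embeds \<open>R/(a : s)\<close> into
  \<open>R/a\<close>. Applying \<open>Hom\<close> to this embedding gives multiplication by
  \<open>s\<close> from \<open>kil i a\<close> to \<open>kil i (a : s)\<close>.\<close>

lemma smult_kil_colon:
  "s \<in> carrier R \<Longrightarrow> x \<in> kil i a \<Longrightarrow> s \<odot>\<^bsub>E i\<^esub> x \<in> kil i (ideal_colon R a {s})"
  by (auto simp: kil_def mem_colon1 E.smult_assoc1[symmetric])

lemma smult_Z_colon:
  "s \<in> carrier R \<Longrightarrow> x \<in> Z i a \<Longrightarrow> s \<odot>\<^bsub>E i\<^esub> x \<in> Z i (ideal_colon R a {s})"
  using smult_kil_colon by (auto simp: Z_def d_smult kil_mem)

lemma smult_B_colon:
  "s \<in> carrier R \<Longrightarrow> x \<in> B i a \<Longrightarrow> s \<odot>\<^bsub>E i\<^esub> x \<in> B i (ideal_colon R a {s})"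
  using smult_kil_colon[of s] by (cases i) (auto simp flip: d_smult simp: kil_mem)

text \<open>Surjectivity of the restriction map to \<open>R/(a : s)\<close>. This is the point where
  the injectivity of the \<open>E i\<close> enters the homological argument.\<close>

lemma kil_lift:
  assumes "ideal a R" "s \<in> carrier R" "x \<in> kil i (ideal_colon R a {s})"
  obtains y where "y \<in> kil i a" "s \<odot>\<^bsub>E i\<^esub> y = x"
  using E_lift[OF assms(1,2), of x i] assms(3) unfolding kil_def by blast

text \<open>For a boundary \<open>x = d w\<close>, the element \<open>w\<close> is lifted instead of
  \<open>x\<close>; then \<open>d\<close> of the lift is a cocycle.\<close>

lemma boundary_lift:
  assumes a: "ideal a R" and s: "s \<in> carrier R" and x: "x \<in> B i (ideal_colon R a {s})"
  obtains y where "y \<in> kil i a" "d i y = \<zero>\<^bsub>E (Suc i)\<^esub>" "s \<odot>\<^bsub>E i\<^esub> y = x"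
proof (cases i)
  case 0
  hence "x = \<zero>\<^bsub>E i\<^esub>" using x by simp
  hence "s \<odot>\<^bsub>E i\<^esub> \<zero>\<^bsub>E i\<^esub> = x" using s by simp
  thus ?thesis using that[OF E.submodule_zero[OF kil_submodule[OF ideal_carrier[OF a]]] d_zero] by blast
next
  case (Suc j)
  then obtain w where w: "w \<in> kil j (ideal_colon R a {s})" "x = d j w" using x by auto
  obtain w' where w': "w' \<in> kil j a" "s \<odot>\<^bsub>E j\<^esub> w' = w" using kil_lift[OF a s w(1)] by blast
  have "d j w' \<in> B i a" using w' Suc by simp
  hence "d j w' \<in> Z i a" using B_le_Z[OF ideal_carrier[OF a]] by blast
  moreover have "s \<odot>\<^bsub>E i\<^esub> d j w' = x" using w w' s kil_mem[OF w'(1)] Suc by (simp flip: d_smult)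
  ultimately show ?thesis using that[OF Z_kil Z_d] by blast
qed

text \<open>Exactness of
  \<open>H\<^sup>i(a + (s)) \<rightarrow> H\<^sup>i(a) \<rightarrow> H\<^sup>i(a : s) \<rightarrow> H\<^sup>i\<^sup>+\<^sup>1(a + (s))\<close>
  for \<open>H\<^sup>i(a) = Ext\<^sup>i(R/a, R) = Z i a / B i a\<close>, where the middle map is multiplication by \<open>s\<close>. An
  element \<open>w\<close> of \<open>H\<^sup>i(a : s)\<close> is lifted to \<open>w'\<close> with \<open>s w' = w\<close>, and then goes to \<open>d w'\<close>.\<close>

lemma cocycle_adjust:
  assumes a: "ideal a R" and s: "s \<in> carrier R" and v: "v \<in> Z i a"
    and sv: "s \<odot>\<^bsub>E i\<^esub> v \<in> B i (ideal_colon R a {s})"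
  obtains b where "b \<in> B i a" "v \<ominus>\<^bsub>E i\<^esub> b \<in> Z i (a <+> PIdl s)"
proof (cases i)
  case 0
  have "v \<ominus>\<^bsub>E i\<^esub> \<zero>\<^bsub>E i\<^esub> = v" using Z_mem[OF v] by (simp add: a_minus_def)
  moreover have "s \<odot>\<^bsub>E i\<^esub> v = \<zero>\<^bsub>E i\<^esub>" using sv 0 by simp
  ultimately show ?thesis using that[of "\<zero>\<^bsub>E i\<^esub>"] 0 v Z_adjoin[OF a s] by simp
next
  case (Suc j)
  then obtain w where w: "w \<in> kil j (ideal_colon R a {s})" "s \<odot>\<^bsub>E i\<^esub> v = d j w" using sv by auto
  obtain w' where w': "w' \<in> kil j a" "s \<odot>\<^bsub>E j\<^esub> w' = w" using kil_lift[OF a s w(1)] by blast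
  have b: "d j w' \<in> B i a" using w' Suc by simp
  have aR: "a \<subseteq> carrier R" using a ideal_carrier by blast
  have "v \<ominus>\<^bsub>E i\<^esub> d j w' \<in> Z i a"
    using b v B_le_Z[OF aR] E.submodule_minus[OF Z_submodule[OF aR]] by blast
  moreover have "s \<odot>\<^bsub>E i\<^esub> (v \<ominus>\<^bsub>E i\<^esub> d j w') = \<zero>\<^bsub>E i\<^esub>"
  proof -
    have "s \<odot>\<^bsub>E i\<^esub> (v \<ominus>\<^bsub>E i\<^esub> d j w') = s \<odot>\<^bsub>E i\<^esub> v \<ominus>\<^bsub>E i\<^esub> s \<odot>\<^bsub>E i\<^esub> d j w'"
      using s v b B_mem[OF aR] by (intro E.smult_r_a_minus) (auto simp: Z_mem)
    also have "s \<odot>\<^bsub>E i\<^esub> d j w' = s \<odot>\<^bsub>E i\<^esub> v"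
      using w w' s kil_mem Suc by (simp flip: d_smult)
    finally show ?thesis using s v by (simp add: Z_mem a_minus_def E.M.r_neg)
  qed
  ultimately show ?thesis using that[OF b] Z_adjoin[OF a s] by simp
qed

lemma connecting:
  assumes a: "ideal a R" and s: "s \<in> carrier R" and w: "w \<in> Z i (ideal_colon R a {s})"
  obtains w' where "w' \<in> kil i a" "s \<odot>\<^bsub>E i\<^esub> w' = w" "d i w' \<in> Z (Suc i) (a <+> PIdl s)"
proof -
  obtain w' where w': "w' \<in> kil i a" "s \<odot>\<^bsub>E i\<^esub> w' = w" using kil_lift[OF a s Z_kil[OF w]] by blast
  have aR: "a \<subseteq> carrier R" using a ideal_carrier by blast
  have "d i w' \<in> B (Suc i) a" using w' by simp
  hence "d i w' \<in> Z (Suc i) a" using B_le_Z[OF aR] by blast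
  moreover have "s \<odot>\<^bsub>E (Suc i)\<^esub> d i w' = \<zero>\<^bsub>E (Suc i)\<^esub>"
    using w' s w Z_d by (simp flip: d_smult add: kil_mem)
  ultimately show ?thesis using that w' Z_adjoin[OF a s] by blast
qed

text \<open>Exactness at \<open>H^i(a : s)\<close>, up to a multiplier: if \<open>t\<close> kills
  the connecting image of a class, then \<open>t\<close> times that class comes from
  \<open>H^i(a)\<close>. The factor \<open>t\<close> stands for a denominator when vanishing is only
  known after localization.\<close>

lemma connecting_boundary:
  assumes a: "ideal a R" and s: "s \<in> carrier R" and w: "w' \<in> kil i a" and t: "t \<in> carrier R"
    and b: "t \<odot>\<^bsub>E (Suc i)\<^esub> d i w' \<in> B (Suc i) (a <+> PIdl s)"
  obtains v where "v \<in> Z i a" "s \<odot>\<^bsub>E i\<^esub> v = t \<odot>\<^bsub>E i\<^esub> (s \<odot>\<^bsub>E i\<^esub> w')"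
proof -
  obtain u where u: "u \<in> kil i (a <+> PIdl s)" "t \<odot>\<^bsub>E (Suc i)\<^esub> d i w' = d i u" using b by auto
  have uk: "u \<in> kil i a" "s \<odot>\<^bsub>E i\<^esub> u = \<zero>\<^bsub>E i\<^esub>" using u kil_adjoin[OF a s] by auto
  \<comment> \<open>The element \<open>u\<close> has the same differential as \<open>t w'\<close>
    and is killed by \<open>s\<close>, so the difference is a cocycle with the same multiple by
    \<open>s\<close>.\<close>
  let ?v = "t \<odot>\<^bsub>E i\<^esub> w' \<ominus>\<^bsub>E i\<^esub> u"
  have aR: "a \<subseteq> carrier R" using a ideal_carrier by blast
  have wm: "w' \<in> carrier (E i)" "u \<in> carrier (E i)" using w uk kil_mem by auto
  have "?v \<in> kil i a"
    using w uk t E.submodule_minus[OF kil_submodule[OF aR]] E.submodule_smult[OF kil_submodule[OF aR]] by blast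
  moreover have "d i ?v = \<zero>\<^bsub>E (Suc i)\<^esub>"
    using u(2) wm t by (simp add: d_minus d_smult) (simp add: a_minus_def E.M.r_neg)
  ultimately have "?v \<in> Z i a" by (simp add: Z_def)
  moreover have "s \<odot>\<^bsub>E i\<^esub> ?v = t \<odot>\<^bsub>E i\<^esub> (s \<odot>\<^bsub>E i\<^esub> w')"
    using wm t s uk by (simp add: E.smult_r_a_minus E.smult_comm[of s t]) (simp add: a_minus_def)
  ultimately show ?thesis using that by blast
qed

text \<open>The kernel of \<open>H^i(a + (s)) \<rightarrow> H^i(a)\<close> is the image of
  \<open>H^(i-1)(a : s)\<close>, so it is zero when the latter vanishes.\<close>

lemma boundary_adjoin:
  assumes a: "ideal a R" and s: "s \<in> carrier R" and z: "z \<in> Z i (a <+> PIdl s)" "z \<in> B i a"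
    and vanish: "\<And>j. i = Suc j \<Longrightarrow> Z j (ideal_colon R a {s}) \<subseteq> B j (ideal_colon R a {s})"
  shows "z \<in> B i (a <+> PIdl s)"
proof (cases i)
  case 0
  thus ?thesis using z by simp
next
  case (Suc j)
  then obtain w where w: "w \<in> kil j a" "z = d j w" using z by auto
  have aR: "a \<subseteq> carrier R" using a ideal_carrier by blast
  have sz: "s \<odot>\<^bsub>E i\<^esub> z = \<zero>\<^bsub>E i\<^esub>" using z Z_adjoin[OF a s] by blast
  have "d j (s \<odot>\<^bsub>E j\<^esub> w) = \<zero>\<^bsub>E (Suc j)\<^esub>" using w s sz Suc kil_mem[OF w(1)] by (simp add: d_smult)
  hence "s \<odot>\<^bsub>E j\<^esub> w \<in> Z j (ideal_colon R a {s})" using smult_kil_colon[OF s w(1)] by (simp add: Z_def)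
  hence sb: "s \<odot>\<^bsub>E j\<^esub> w \<in> B j (ideal_colon R a {s})" using vanish Suc by blast
  \<comment> \<open>Subtracting the cocycle \<open>u\<close> leaves the differential of
    \<open>w\<close> unchanged and makes \<open>w\<close> killed by \<open>s\<close> as
    well.\<close>
  obtain u where u: "u \<in> kil j a" "d j u = \<zero>\<^bsub>E i\<^esub>" "s \<odot>\<^bsub>E j\<^esub> u = s \<odot>\<^bsub>E j\<^esub> w"
    using boundary_lift[OF a s sb] Suc by metis
  have m: "u \<in> carrier (E j)" "w \<in> carrier (E j)" using u w kil_mem by auto
  have "w \<ominus>\<^bsub>E j\<^esub> u \<in> kil j a" using E.submodule_minus[OF kil_submodule[OF aR]] u w by blast
  moreover have "s \<odot>\<^bsub>E j\<^esub> (w \<ominus>\<^bsub>E j\<^esub> u) = \<zero>\<^bsub>E j\<^esub>"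
    using m s u by (simp add: E.smult_r_a_minus) (simp add: a_minus_def E.M.r_neg)
  ultimately have "w \<ominus>\<^bsub>E j\<^esub> u \<in> kil j (a <+> PIdl s)" using kil_adjoin[OF a s] by blast
  moreover have "d j (w \<ominus>\<^bsub>E j\<^esub> u) = z"
    using m u w Suc by (simp add: d_minus) (simp add: a_minus_def)
  ultimately show ?thesis unfolding Suc by (auto intro!: image_eqI[of z])
qed

end

section \<open>The modules \<open>H^i(a)\<close> are Noetherian\<close>

context injective_resolution
begin

lemma Z_zero_mem: "x \<in> Z 0 a \<Longrightarrow> \<exists>r\<in>carrier R. x = r \<odot>\<^bsub>E 0\<^esub> v0"
  using ker0 Z_mem[of x 0 a] Z_d[of x 0 a] by auto

lemma d_v0: "d 0 v0 = \<zero>\<^bsub>E (Suc 0)\<^esub>"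
proof -
  have "v0 \<in> (\<lambda>r. r \<odot>\<^bsub>E 0\<^esub> v0) ` carrier R" using v0(1) by (auto intro!: image_eqI[of _ _ \<one>])
  thus ?thesis unfolding ker0[symmetric] by simp
qed

lemma v0_Z: "v0 \<in> Z 0 {\<zero>}"
  using v0(1) d_v0 by (simp add: Z_def kil_def)

lemma Z_Suc_zero: "Z (Suc i) {\<zero>} \<subseteq> B (Suc i) {\<zero>}"
proof
  fix x assume x: "x \<in> Z (Suc i) {\<zero>}"
  hence "x \<in> d i ` carrier (E i)" using exact[of i] Z_mem Z_d by auto
  moreover have "kil i {\<zero>} = carrier (E i)" by (auto simp: kil_def)
  ultimately show "x \<in> B (Suc i) {\<zero>}" by simp
qed

text \<open>Submodules of \<open>H^i(a)\<close> are represented by their preimages, which lie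
  between the boundaries and the cocycles.\<close>

definition acc :: "nat \<Rightarrow> 'a set \<Rightarrow> bool"
  where "acc i a \<longleftrightarrow> (\<forall>U. (\<forall>n::nat. submodule (U n) R (E i) \<and> B i a \<subseteq> U n \<and> U n \<subseteq> Z i a \<and>
    U n \<subseteq> U (Suc n)) \<longrightarrow> (\<exists>N. \<forall>n\<ge>N. U n = U N))"

lemma accD:
  assumes "acc i a" "\<And>n::nat. submodule (U n) R (E i)" "\<And>n. B i a \<subseteq> U n" "\<And>n. U n \<subseteq> Z i a"
    "\<And>n. U n \<subseteq> U (Suc n)"
  obtains N where "\<And>n. n \<ge> N \<Longrightarrow> U n = U N"
  using assms unfolding acc_def by meson

text \<open>Cocycles of degree 0 are multiples of \<open>v0\<close>, so a chain of submodules of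
  them is controlled by a chain of ideals of coefficients.\<close>

lemma acc_0: "acc 0 a"
  unfolding acc_def
proof (intro allI impI)
  fix U :: "nat \<Rightarrow> 'e set"
  assume "\<forall>n. submodule (U n) R (E 0) \<and> B 0 a \<subseteq> U n \<and> U n \<subseteq> Z 0 a \<and> U n \<subseteq> U (Suc n)"
  hence U: "\<And>n. submodule (U n) R (E 0)" "\<And>n. U n \<subseteq> Z 0 a" "\<And>n. U n \<subseteq> U (Suc n)" by auto
  define f where "f = (\<lambda>n. {r \<in> carrier R. r \<odot>\<^bsub>E 0\<^esub> v0 \<in> U n})"
  have "ideal (f n) R" for n
    by (rule idealI') (auto simp: f_def v0 E.submodule_zero[OF U(1)] E.smult_l_distr E.smult_assoc1
      intro: E.submodule_add[OF U(1)] E.submodule_smult[OF U(1)])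
  moreover have "f n \<subseteq> f (Suc n)" for n using U(3) unfolding f_def by blast
  ultimately obtain N where N: "\<forall>n\<ge>N. f n = f N" using ideal_ACC[of f] by blast
  have "U n = (\<lambda>r. r \<odot>\<^bsub>E 0\<^esub> v0) ` f n" for n
    using Z_zero_mem U(2)[of n] unfolding f_def by blast
  thus "\<exists>N. \<forall>n\<ge>N. U n = U N" using N by metis
qed

lemma acc_zero: "acc i {\<zero>}"
proof (cases i)
  case (Suc j)
  show ?thesis unfolding Suc acc_def using Z_Suc_zero[of j] by blast
qed (simp add: acc_0)

text \<open>In the exact sequence \<open>H^i(a : s) \<rightarrow> H^(i+1)(a + (s)) \<rightarrow>
  H^(i+1)(a)\<close> the middle term is Noetherian if the outer ones are. A chain in the middle is
  stationary once its images on the right and its preimages on the left are.\<close>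

lemma acc_step:
  assumes a: "ideal a R" and s: "s \<in> carrier R"
    and acc1: "acc i (ideal_colon R a {s})" and acc2: "acc (Suc i) a"
  shows "acc (Suc i) (a <+> PIdl s)"
  unfolding acc_def
proof (intro allI impI)
  let ?a' = "a <+> PIdl s" and ?b = "ideal_colon R a {s}"
  fix U :: "nat \<Rightarrow> 'e set"
  assume "\<forall>n. submodule (U n) R (E (Suc i)) \<and> B (Suc i) ?a' \<subseteq> U n \<and> U n \<subseteq> Z (Suc i) ?a' \<and> U n \<subseteq> U (Suc n)"
  hence U: "\<And>n. submodule (U n) R (E (Suc i))" "\<And>n. B (Suc i) ?a' \<subseteq> U n" "\<And>n. U n \<subseteq> Z (Suc i) ?a'"
    "\<And>n. U n \<subseteq> U (Suc n)" by auto
  have mono: "U n \<subseteq> U k" if "n \<le> k" for n k by (rule lift_Suc_mono_le[of U, OF U(4) that])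
  have aR: "a \<subseteq> carrier R" "?a' \<subseteq> carrier R" "?b \<subseteq> carrier R"
    using a ideal_carrier adjoin_ideal[OF a s] by (auto simp: mem_colon1)
  have aa: "a \<subseteq> ?a'" using adjoin_upper[OF a s] .
  note Bs = B_submodule[OF aR(1), of "Suc i"]
  obtain N1 where N1: "\<And>n. n \<ge> N1 \<Longrightarrow> U n <+>\<^bsub>E (Suc i)\<^esub> B (Suc i) a = U N1 <+>\<^bsub>E (Suc i)\<^esub> B (Suc i) a"
  proof (rule accD[OF acc2, of "\<lambda>n. U n <+>\<^bsub>E (Suc i)\<^esub> B (Suc i) a"])
    show "submodule (U n <+>\<^bsub>E (Suc i)\<^esub> B (Suc i) a) R (E (Suc i))" for n
      using E.submodule_sum[OF U(1) Bs] .
    show "B (Suc i) a \<subseteq> U n <+>\<^bsub>E (Suc i)\<^esub> B (Suc i) a" for n using E.sum_upper2[OF U(1) Bs] .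
    have "U n \<subseteq> Z (Suc i) a" for n using U(3)[of n] Z_anti[OF aa, of "Suc i"] by blast
    thus "U n <+>\<^bsub>E (Suc i)\<^esub> B (Suc i) a \<subseteq> Z (Suc i) a" for n
      by (intro E.sum_least Z_submodule B_le_Z aR) auto
    show "U n <+>\<^bsub>E (Suc i)\<^esub> B (Suc i) a \<subseteq> U (Suc n) <+>\<^bsub>E (Suc i)\<^esub> B (Suc i) a" for n
      using U(4)[of n] unfolding E.mem_sum subset_iff by blast
  qed blast
  \<comment> \<open>The preimage of \<open>U n\<close> under the connecting map, which sends the
    class of \<open>s w\<close> to that of \<open>d w\<close>.\<close>
  define W where "W = (\<lambda>n. {s \<odot>\<^bsub>E i\<^esub> w | w. w \<in> kil i a \<and> d i w \<in> U n})"
  note kils = kil_submodule[OF aR(1), of i]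
  obtain N2 where N2: "\<And>n. n \<ge> N2 \<Longrightarrow> W n = W N2"
  proof (rule accD[OF acc1, of W])
    show "submodule (W n) R (E i)" for n
    proof (rule E.submoduleI')
      show "W n \<subseteq> carrier (E i)" unfolding W_def using s kil_mem by auto
      show "\<zero>\<^bsub>E i\<^esub> \<in> W n" unfolding W_def
        using s E.submodule_zero[OF kils] E.submodule_zero[OF U(1)[of n]]
        by (auto intro!: exI[of _ "\<zero>\<^bsub>E i\<^esub>"])
      show "x \<oplus>\<^bsub>E i\<^esub> y \<in> W n" if xy: "x \<in> W n" "y \<in> W n" for x y
      proof -
        obtain w w' where w: "w \<in> kil i a" "d i w \<in> U n" "x = s \<odot>\<^bsub>E i\<^esub> w"
          "w' \<in> kil i a" "d i w' \<in> U n" "y = s \<odot>\<^bsub>E i\<^esub> w'" using xy unfolding W_def by blast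
        have "w \<oplus>\<^bsub>E i\<^esub> w' \<in> kil i a" "d i (w \<oplus>\<^bsub>E i\<^esub> w') \<in> U n"
          "x \<oplus>\<^bsub>E i\<^esub> y = s \<odot>\<^bsub>E i\<^esub> (w \<oplus>\<^bsub>E i\<^esub> w')"
          using w s E.submodule_add[OF kils] E.submodule_add[OF U(1)[of n]] kil_mem
          by (auto simp: d_add E.smult_r_distr)
        thus ?thesis unfolding W_def by blast
      qed
      show "r \<odot>\<^bsub>E i\<^esub> x \<in> W n" if rx: "r \<in> carrier R" "x \<in> W n" for r x
      proof -
        obtain w where w: "w \<in> kil i a" "d i w \<in> U n" "x = s \<odot>\<^bsub>E i\<^esub> w" using rx unfolding W_def by blast
        have wm: "w \<in> carrier (E i)" using w kil_mem by blast
        have "r \<odot>\<^bsub>E i\<^esub> w \<in> kil i a" "d i (r \<odot>\<^bsub>E i\<^esub> w) \<in> U n"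
          "r \<odot>\<^bsub>E i\<^esub> x = s \<odot>\<^bsub>E i\<^esub> (r \<odot>\<^bsub>E i\<^esub> w)"
          using w wm s rx E.submodule_smult[OF kils] E.submodule_smult[OF U(1)[of n]]
          by (auto simp: d_smult E.smult_comm[of r s])
        thus ?thesis unfolding W_def by blast
      qed
    qed
    show "B i ?b \<subseteq> W n" for n
    proof
      fix x assume x: "x \<in> B i ?b"
      obtain w where "w \<in> kil i a" "d i w = \<zero>\<^bsub>E (Suc i)\<^esub>" "s \<odot>\<^bsub>E i\<^esub> w = x"
        using boundary_lift[OF a s x] by blast
      thus "x \<in> W n" unfolding W_def using E.submodule_zero[OF U(1)[of n]] by fastforce
    qed
    show "W n \<subseteq> Z i ?b" for n
    proof
      fix x assume "x \<in> W n"
      then obtain w where w: "w \<in> kil i a" "d i w \<in> U n" "x = s \<odot>\<^bsub>E i\<^esub> w" unfolding W_def by blast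
      have "s \<odot>\<^bsub>E (Suc i)\<^esub> d i w = \<zero>\<^bsub>E (Suc i)\<^esub>" using w U(3)[of n] Z_adjoin[OF a s] by blast
      thus "x \<in> Z i ?b" using w s kil_mem[OF w(1)] smult_kil_colon[OF s w(1)] by (simp add: Z_def d_smult)
    qed
    show "W n \<subseteq> W (Suc n)" for n using U(4)[of n] unfolding W_def by blast
  qed blast
  define N where "N = max N1 N2"
  have "U n \<subseteq> U N" if n: "n \<ge> N" for n
  proof
    fix v assume v: "v \<in> U n"
    have UN: "U N \<subseteq> U n" using mono n by blast
    \<comment> \<open>Modulo \<open>U N\<close>, the element \<open>v\<close> is a boundary
      \<open>d w\<close> for \<open>a\<close>, that is, a value of the connecting map at
      \<open>s w\<close>. As \<open>W n = W N\<close>, the element \<open>s w\<close> equals some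
      \<open>s w'\<close> with \<open>d w'\<close> in \<open>U N\<close>, and \<open>w\<close> and
      \<open>w'\<close> differ by an element killed by \<open>a + (s)\<close>, whose differential is
      a boundary.\<close>
    have "v \<in> U n <+>\<^bsub>E (Suc i)\<^esub> B (Suc i) a" using v E.sum_upper1[OF U(1) Bs] by blast
    also have "\<dots> = U N <+>\<^bsub>E (Suc i)\<^esub> B (Suc i) a" using N1[of n] N1[of N] n by (simp add: N_def)
    finally obtain u w where u: "u \<in> U N" "w \<in> kil i a" "v = u \<oplus>\<^bsub>E (Suc i)\<^esub> d i w"
      unfolding E.mem_sum by auto
    have m: "u \<in> carrier (E (Suc i))" "w \<in> carrier (E i)"
      using u E.submodule_mem[OF U(1)] kil_mem by auto
    have "v \<ominus>\<^bsub>E (Suc i)\<^esub> u = d i w" using m u by (simp add: E.add_minus_cancel)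
    hence dw: "d i w \<in> U n" using E.submodule_minus[OF U(1)[of n]] v u UN by (metis subsetD)
    hence "s \<odot>\<^bsub>E i\<^esub> w \<in> W n" unfolding W_def using u by blast
    hence "s \<odot>\<^bsub>E i\<^esub> w \<in> W N" using N2[of n] N2[of N] n by (simp add: N_def)
    then obtain w' where w': "w' \<in> kil i a" "d i w' \<in> U N" "s \<odot>\<^bsub>E i\<^esub> w = s \<odot>\<^bsub>E i\<^esub> w'"
      unfolding W_def by blast
    have m': "w' \<in> carrier (E i)" using w' kil_mem by blast
    have "s \<odot>\<^bsub>E i\<^esub> (w \<ominus>\<^bsub>E i\<^esub> w') = \<zero>\<^bsub>E i\<^esub>"
      using w' m m' s by (simp add: E.smult_r_a_minus) (simp add: a_minus_def E.M.r_neg)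
    hence "w \<ominus>\<^bsub>E i\<^esub> w' \<in> kil i ?a'"
      using E.submodule_minus[OF kils] u w' kil_adjoin[OF a s] by blast
    hence "d i (w \<ominus>\<^bsub>E i\<^esub> w') \<in> U N" using U(2)[of N] by auto
    hence "d i (w \<ominus>\<^bsub>E i\<^esub> w') \<oplus>\<^bsub>E (Suc i)\<^esub> d i w' \<in> U N" using w' E.submodule_add[OF U(1)] by blast
    hence "d i w \<in> U N" using m m' by (simp add: d_minus E.minus_cancel)
    thus "v \<in> U N" using u E.submodule_add[OF U(1)] by blast
  qed
  thus "\<exists>N. \<forall>n\<ge>N. U n = U N" using mono by (intro exI[of _ N]) blast
qed

text \<open>Generators of \<open>a\<close> are adjoined one at a time, beginning with the zero
  ideal. The colon ideals that arise are arbitrary, but they are needed only one degree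
  lower.\<close>

lemma acc_ideal: "ideal a R \<Longrightarrow> acc i a"
proof (induction i arbitrary: a)
  case 0
  show ?case by (rule acc_0)
next
  case (Suc i)
  obtain A where A: "A \<subseteq> carrier R" "finite A" "a = Idl A" using finetely_gen[OF Suc.prems] by blast
  have "acc (Suc i) (Idl A)" using A(2,1)
  proof (induction A)
    case empty
    show ?case unfolding genideal_empty by (rule acc_zero)
  next
    case (insert s A)
    hence A: "ideal (Idl A) R" "s \<in> carrier R" using genideal_ideal by auto
    show ?case unfolding genideal_insert[OF A(2), of A] using insert A
      by (subst genideal_insert) (auto intro!: acc_step Suc.IH colon1_ideal)
  qed
  thus ?case using A by simp
qed

text \<open>\<open>H\<^sup>i(a)\<close> has a nonzero localization at the prime \<open>Q\<close>.\<close>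

definition nonzero_at :: "nat \<Rightarrow> 'a set \<Rightarrow> 'a set \<Rightarrow> bool"
  where "nonzero_at i a Q \<longleftrightarrow> (\<exists>v\<in>Z i a. \<forall>s\<in>carrier R - Q. s \<odot>\<^bsub>E i\<^esub> v \<notin> B i a)"

section \<open>Moving nonvanishing cohomology to larger primes\<close>

lemma nonzero_at_mono: "nonzero_at i a P \<Longrightarrow> P \<subseteq> Q \<Longrightarrow> nonzero_at i a Q"
  unfolding nonzero_at_def by blast

text \<open>Otherwise multiplication by \<open>x\<close> would be surjective on the finitely generated module
  \<open>H\<^sup>i(P)\<close> localized at \<open>Q\<close>, against Nakayama's lemma.\<close>

lemma nonzero_at_step:
  assumes P: "primeideal P R" and Q: "primeideal Q R" and x: "x \<in> Q" "x \<notin> P"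
    and nz: "nonzero_at i P Q"
  shows "nonzero_at (Suc i) (P <+> PIdl x) Q"
proof (rule ccontr)
  assume neg: "\<not> ?thesis"
  obtain v where v: "v \<in> Z i P" "\<And>s. s \<in> carrier R - Q \<Longrightarrow> s \<odot>\<^bsub>E i\<^esub> v \<notin> B i P"
    using nz unfolding nonzero_at_def by blast
  have Pi: "ideal P R" and Qi: "ideal Q R" using P Q primeideal_ideal by auto
  have PR: "P \<subseteq> carrier R" using Pi ideal_carrier by blast
  have xR: "x \<in> carrier R" by (rule ideal.Icarr[OF Qi x(1)])
  note Zs = Z_submodule[OF PR, of i] and Bs = B_submodule[OF PR, of i]
  \<comment> \<open>After localization at \<open>Q\<close> the connecting map out of
    \<open>H^i(P : x) = H^i(P)\<close> is zero by assumption, so multiplication by \<open>x\<close>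
    is onto; \<open>t\<close> is the denominator.\<close>
  have div: "\<exists>w'\<in>Z i P. \<exists>t\<in>carrier R - Q. t \<odot>\<^bsub>E i\<^esub> w = x \<odot>\<^bsub>E i\<^esub> w'" if w: "w \<in> Z i P" for w
  proof -
    have "w \<in> Z i (ideal_colon R P {x})" using w colon_prime[OF P xR x(2)] by simp
    then obtain w' where w': "w' \<in> kil i P" "x \<odot>\<^bsub>E i\<^esub> w' = w" "d i w' \<in> Z (Suc i) (P <+> PIdl x)"
      using connecting[OF Pi xR] by blast
    then obtain t where t: "t \<in> carrier R - Q" "t \<odot>\<^bsub>E (Suc i)\<^esub> d i w' \<in> B (Suc i) (P <+> PIdl x)"
      using neg unfolding nonzero_at_def by blast
    then obtain u where "u \<in> Z i P" "x \<odot>\<^bsub>E i\<^esub> u = t \<odot>\<^bsub>E i\<^esub> (x \<odot>\<^bsub>E i\<^esub> w')"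
      using connecting_boundary[OF Pi xR w'(1), of t] by blast
    thus ?thesis using t w' by metis
  qed
  \<comment> \<open>A sequence of successive quotients by \<open>x\<close>: up to denominators,
    \<open>f n\<close> is \<open>v\<close> divided by \<open>x^n\<close>.\<close>
  have "\<exists>f. \<forall>n. (f n \<in> Z i P \<and> (n = 0 \<longrightarrow> f n = v)) \<and>
    (\<exists>t\<in>carrier R - Q. t \<odot>\<^bsub>E i\<^esub> f n = x \<odot>\<^bsub>E i\<^esub> f (Suc n))"
  proof (rule dependent_nat_choice)
    show "\<exists>w. w \<in> Z i P \<and> ((0::nat) = 0 \<longrightarrow> w = v)" using v by blast
    fix w and n :: nat
    assume "w \<in> Z i P \<and> (n = 0 \<longrightarrow> w = v)"
    thus "\<exists>w'. (w' \<in> Z i P \<and> (Suc n = 0 \<longrightarrow> w' = v)) \<and>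
      (\<exists>t\<in>carrier R - Q. t \<odot>\<^bsub>E i\<^esub> w = x \<odot>\<^bsub>E i\<^esub> w')" using div by blast
  qed
  then obtain f where f: "\<And>n. f n \<in> Z i P" "f 0 = v"
    "\<And>n. \<exists>t\<in>carrier R - Q. t \<odot>\<^bsub>E i\<^esub> f n = x \<odot>\<^bsub>E i\<^esub> f (Suc n)" by blast
  then obtain t where t: "\<And>n. t n \<in> carrier R - Q" "\<And>n. t n \<odot>\<^bsub>E i\<^esub> f n = x \<odot>\<^bsub>E i\<^esub> f (Suc n)" by metis
  have tR: "t n \<in> carrier R" for n using t by blast
  have fE: "f n \<in> carrier (E i)" for n using f Z_mem by blast
  define S where "S = (\<lambda>n. (\<lambda>r. r \<odot>\<^bsub>E i\<^esub> f n) ` carrier R <+>\<^bsub>E i\<^esub> B i P)"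
  have Ss: "submodule (S n) R (E i)" for n
    unfolding S_def by (intro E.submodule_sum E.submodule_cyclic fE Bs)
  have memS: "y \<in> S n \<longleftrightarrow> (\<exists>r\<in>carrier R. \<exists>b\<in>B i P. y = r \<odot>\<^bsub>E i\<^esub> f n \<oplus>\<^bsub>E i\<^esub> b)" for y n
    unfolding S_def E.mem_sum by blast
  have BE: "b \<in> carrier (E i)" if "b \<in> B i P" for b using that B_mem[OF PR] by blast
  have shift: "\<exists>r\<in>carrier R. \<exists>b\<in>B i P. t n \<odot>\<^bsub>E i\<^esub> y = (r \<otimes> x) \<odot>\<^bsub>E i\<^esub> f (Suc n) \<oplus>\<^bsub>E i\<^esub> b"
    if "y \<in> S n" for y n
  proof -
    obtain r b where r: "r \<in> carrier R" "b \<in> B i P" "y = r \<odot>\<^bsub>E i\<^esub> f n \<oplus>\<^bsub>E i\<^esub> b"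
      using \<open>y \<in> S n\<close> unfolding memS by blast
    have "t n \<odot>\<^bsub>E i\<^esub> y = r \<odot>\<^bsub>E i\<^esub> (t n \<odot>\<^bsub>E i\<^esub> f n) \<oplus>\<^bsub>E i\<^esub> t n \<odot>\<^bsub>E i\<^esub> b"
      using r tR fE BE by (simp add: E.smult_r_distr E.smult_comm[of r "t n"])
    also have "\<dots> = (r \<otimes> x) \<odot>\<^bsub>E i\<^esub> f (Suc n) \<oplus>\<^bsub>E i\<^esub> t n \<odot>\<^bsub>E i\<^esub> b"
      using r xR fE by (simp add: t(2) E.smult_assoc1)
    finally show ?thesis using r tR E.submodule_smult[OF Bs] by blast
  qed
  \<comment> \<open>The classes that become multiples of \<open>f n\<close> after localization at
    \<open>Q\<close>. They ascend because \<open>t n\<close> times \<open>f n\<close> is a multiple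
    of \<open>f (Suc n)\<close>.\<close>
  define U where "U = (\<lambda>n. {w \<in> Z i P. \<exists>s\<in>carrier R - Q. s \<odot>\<^bsub>E i\<^esub> w \<in> S n})"
  have oneQ: "\<one> \<in> carrier R - Q" using prime_one[OF Q] by simp
  obtain N where N: "\<And>n. n \<ge> N \<Longrightarrow> U n = U N"
  proof (rule accD[OF acc_ideal[OF Pi], of U])
    show "submodule (U n) R (E i)" for n
    proof (rule E.submoduleI')
      show "U n \<subseteq> carrier (E i)" unfolding U_def using Z_mem by blast
      show "\<zero>\<^bsub>E i\<^esub> \<in> U n" unfolding U_def
        using E.submodule_zero[OF Zs] E.submodule_zero[OF Ss[of n]] oneQ by auto
      show "y \<oplus>\<^bsub>E i\<^esub> z \<in> U n" if yz: "y \<in> U n" "z \<in> U n" for y z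
      proof -
        obtain s s' where s: "y \<in> Z i P" "s \<in> carrier R - Q" "s \<odot>\<^bsub>E i\<^esub> y \<in> S n"
          "z \<in> Z i P" "s' \<in> carrier R - Q" "s' \<odot>\<^bsub>E i\<^esub> z \<in> S n" using yz unfolding U_def by blast
        have "(s \<otimes> s') \<odot>\<^bsub>E i\<^esub> (y \<oplus>\<^bsub>E i\<^esub> z) = s' \<odot>\<^bsub>E i\<^esub> (s \<odot>\<^bsub>E i\<^esub> y) \<oplus>\<^bsub>E i\<^esub> s \<odot>\<^bsub>E i\<^esub> (s' \<odot>\<^bsub>E i\<^esub> z)"
          using s Z_mem[OF s(1)] Z_mem[OF s(4)]
          by (simp add: E.smult_r_distr E.smult_assoc1 E.smult_comm[of s' s])
        also have "\<dots> \<in> S n"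
          using E.submodule_add[OF Ss E.submodule_smult[OF Ss _ s(3)] E.submodule_smult[OF Ss _ s(6)]] s(2,5)
          by blast
        finally show ?thesis unfolding U_def
          using prime_compl_mult[OF Q s(2) s(5)] E.submodule_add[OF Zs s(1) s(4)] by blast
      qed
      show "r \<odot>\<^bsub>E i\<^esub> y \<in> U n" if ry: "r \<in> carrier R" "y \<in> U n" for r y
      proof -
        obtain s where s: "y \<in> Z i P" "s \<in> carrier R - Q" "s \<odot>\<^bsub>E i\<^esub> y \<in> S n"
          using ry unfolding U_def by blast
        have "s \<odot>\<^bsub>E i\<^esub> (r \<odot>\<^bsub>E i\<^esub> y) = r \<odot>\<^bsub>E i\<^esub> (s \<odot>\<^bsub>E i\<^esub> y)"
          using s ry Z_mem[OF s(1)] by (intro E.smult_comm) auto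
        also have "\<dots> \<in> S n" using s ry E.submodule_smult[OF Ss] by blast
        finally show ?thesis unfolding U_def using s ry E.submodule_smult[OF Zs] by blast
      qed
    qed
    show "B i P \<subseteq> U n" for n
    proof
      fix b assume b: "b \<in> B i P"
      have "b \<in> S n" unfolding S_def using E.sum_upper2[OF E.submodule_cyclic[OF fE] Bs] b by blast
      thus "b \<in> U n" unfolding U_def using b B_le_Z[OF PR] oneQ BE
        by (auto intro!: bexI[of _ \<one>])
    qed
    show "U n \<subseteq> Z i P" for n unfolding U_def by blast
    show "U n \<subseteq> U (Suc n)" for n
    proof
      fix y assume "y \<in> U n"
      then obtain s where s: "y \<in> Z i P" "s \<in> carrier R - Q" "s \<odot>\<^bsub>E i\<^esub> y \<in> S n" unfolding U_def by blast
      then obtain r b where r: "r \<in> carrier R" "b \<in> B i P"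
        "t n \<odot>\<^bsub>E i\<^esub> (s \<odot>\<^bsub>E i\<^esub> y) = (r \<otimes> x) \<odot>\<^bsub>E i\<^esub> f (Suc n) \<oplus>\<^bsub>E i\<^esub> b" using shift[OF s(3)] by blast
      have "(t n \<otimes> s) \<odot>\<^bsub>E i\<^esub> y = (r \<otimes> x) \<odot>\<^bsub>E i\<^esub> f (Suc n) \<oplus>\<^bsub>E i\<^esub> b"
        using s tR Z_mem[OF s(1)] by (simp add: E.smult_assoc1 r(3))
      hence "(t n \<otimes> s) \<odot>\<^bsub>E i\<^esub> y \<in> S (Suc n)" unfolding memS using r xR by blast
      thus "y \<in> U (Suc n)" unfolding U_def using prime_compl_mult[OF Q t(1) s(2)] s by blast
    qed
  qed blast
  have "f (Suc N) \<in> S (Suc N)" unfolding memS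
    using E.submodule_zero[OF Bs] fE[of "Suc N"]
    by (intro bexI[of _ \<one>] bexI[of _ "\<zero>\<^bsub>E i\<^esub>"]) simp_all
  hence "f (Suc N) \<in> U (Suc N)" unfolding U_def using f oneQ fE by (auto intro!: bexI[of _ \<one>])
  hence "f (Suc N) \<in> U N" using N[of "Suc N"] by simp
  then obtain s where s: "s \<in> carrier R - Q" "s \<odot>\<^bsub>E i\<^esub> f (Suc N) \<in> S N" unfolding U_def by blast
  then obtain r b where r: "r \<in> carrier R" "b \<in> B i P"
    "t N \<odot>\<^bsub>E i\<^esub> (s \<odot>\<^bsub>E i\<^esub> f (Suc N)) = (r \<otimes> x) \<odot>\<^bsub>E i\<^esub> f (Suc N) \<oplus>\<^bsub>E i\<^esub> b" using shift[OF s(2)] by blast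
  \<comment> \<open>At the stationary index, \<open>f (Suc N)\<close> is at \<open>Q\<close> a
    multiple of \<open>f N\<close>, hence of \<open>x f (Suc N)\<close>. This gives an annihilator
    of its class congruent to \<open>t N s\<close> modulo \<open>x\<close>, thus outside
    \<open>Q\<close>.\<close>
  define k where "k = t N \<otimes> s \<ominus> r \<otimes> x"
  have kR: "k \<in> carrier R" unfolding k_def using tR s r xR by simp
  have "k \<odot>\<^bsub>E i\<^esub> f (Suc N) = b"
    unfolding k_def using s tR r xR fE BE
    by (simp add: E.smult_l_a_minus E.smult_assoc1[of "t N"] r(3))
      (simp add: E.add_minus_cancel)
  moreover have "k \<notin> Q"
  proof
    assume "k \<in> Q"
    hence "k \<oplus> r \<otimes> x \<in> Q" using r x Qi by (intro ideal_add_mem ideal_mult_mem) auto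
    moreover have "s \<in> carrier R" using s by blast
    hence "k \<oplus> r \<otimes> x = t N \<otimes> s" unfolding k_def using tR[of N] r(1) xR by algebra
    ultimately show False using prime_compl_mult[OF Q t(1) s(1)] by auto
  qed
  ultimately have "\<exists>s\<in>carrier R - Q. s \<odot>\<^bsub>E i\<^esub> f (Suc N) \<in> B i P" using r kR by blast
  \<comment> \<open>Vanishing at \<open>Q\<close> passes from \<open>f (Suc n)\<close> back to
    \<open>f n\<close>, and so reaches \<open>f 0 = v\<close>.\<close>
  moreover have "\<exists>s\<in>carrier R - Q. s \<odot>\<^bsub>E i\<^esub> f n \<in> B i P"
    if tor: "\<exists>s\<in>carrier R - Q. s \<odot>\<^bsub>E i\<^esub> f (Suc n) \<in> B i P" for n
  proof -
    obtain s where s: "s \<in> carrier R - Q" "s \<odot>\<^bsub>E i\<^esub> f (Suc n) \<in> B i P" using tor by blast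
    have "(s \<otimes> t n) \<odot>\<^bsub>E i\<^esub> f n = s \<odot>\<^bsub>E i\<^esub> (x \<odot>\<^bsub>E i\<^esub> f (Suc n))"
      using s tR fE by (simp add: E.smult_assoc1 t(2))
    also have "\<dots> = x \<odot>\<^bsub>E i\<^esub> (s \<odot>\<^bsub>E i\<^esub> f (Suc n))" using s xR fE by (intro E.smult_comm) auto
    also have "\<dots> \<in> B i P" using s xR E.submodule_smult[OF Bs] by blast
    finally show ?thesis using prime_compl_mult[OF Q s(1) t(1)] by blast
  qed
  ultimately have "\<exists>s\<in>carrier R - Q. s \<odot>\<^bsub>E i\<^esub> f 0 \<in> B i P"
    by (rule_tac inc_induct[of 0 "Suc N" "\<lambda>n. \<exists>s\<in>carrier R - Q. s \<odot>\<^bsub>E i\<^esub> f n \<in> B i P"]) auto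
  thus False using v f by blast
qed

text \<open>If \<open>x s\<close> lies in \<open>a\<close> but neither \<open>x\<close> nor
  \<open>s\<close> does, both \<open>a : s\<close> and \<open>a + (s)\<close> are strictly larger
  than \<open>a\<close>. By exactness at \<open>H^i(a)\<close>, one of them still has nonzero
  cohomology at \<open>Q\<close> in the same degree, and Noetherian induction ends at a
  prime.\<close>

lemma nonzero_at_prime:
  assumes Q: "primeideal Q R"
  shows "ideal a R \<Longrightarrow> nonzero_at i a Q \<Longrightarrow> \<exists>q. primeideal q R \<and> a \<subseteq> q \<and> q \<subseteq> Q \<and> nonzero_at i q Q"
proof (induction a rule: ideal_induct)
  case (ideal a)
  obtain v where v: "v \<in> Z i a" "\<And>s. s \<in> carrier R - Q \<Longrightarrow> s \<odot>\<^bsub>E i\<^esub> v \<notin> B i a"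
    using ideal.prems unfolding nonzero_at_def by blast
  have aR: "a \<subseteq> carrier R" using ideal(1) ideal_carrier by blast
  note Zs = Z_submodule[OF aR, of i] and Bs = B_submodule[OF aR, of i]
  have vE: "v \<in> carrier (E i)" using v Z_mem by blast
  have aQ: "a \<subseteq> Q"
  proof
    fix y assume y: "y \<in> a"
    have "y \<odot>\<^bsub>E i\<^esub> v = \<zero>\<^bsub>E i\<^esub>" using y Z_kil[OF v(1)] by (simp add: kil_def)
    thus "y \<in> Q" using v(2)[of y] E.submodule_zero[OF Bs] y aR by auto
  qed
  show ?case
  proof (cases "primeideal a R")
    case True
    thus ?thesis using aQ ideal.prems by blast
  next
    case False
    have "carrier R \<noteq> a" using aQ prime_one[OF Q] by blast
    then obtain x s where xs: "x \<in> carrier R" "s \<in> carrier R" "x \<otimes> s \<in> a" "x \<notin> a" "s \<notin> a"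
      using ideal.primeidealCD[OF ideal(1) is_cring False] by blast
    let ?b = "ideal_colon R a {s}" and ?a' = "a <+> PIdl s"
    have b: "ideal ?b R" "a \<subset> ?b"
      using colon1_ideal[OF ideal(1) xs(2)] colon_upper[OF ideal(1), of "{s}"] xs by (auto simp: mem_colon1)
    have a': "ideal ?a' R" "a \<subset> ?a'"
      using adjoin_ideal[OF ideal(1) xs(2)] adjoin_upper[OF ideal(1) xs(2)]
        adjoin_mem[OF ideal(1) xs(2)] xs by auto
    show ?thesis
    proof (cases "nonzero_at i ?b Q")
      case True
      thus ?thesis using ideal.IH[OF b] b by blast
    next
      case False
      then obtain t where t: "t \<in> carrier R - Q" "t \<odot>\<^bsub>E i\<^esub> (s \<odot>\<^bsub>E i\<^esub> v) \<in> B i ?b"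
        using smult_Z_colon[OF xs(2) v(1)] unfolding nonzero_at_def by blast
      have tR: "t \<in> carrier R" using t by blast
      have "s \<odot>\<^bsub>E i\<^esub> (t \<odot>\<^bsub>E i\<^esub> v) \<in> B i ?b" using t xs vE E.smult_comm[of s t v i] by simp
      moreover have tv: "t \<odot>\<^bsub>E i\<^esub> v \<in> Z i a" using tR v E.submodule_smult[OF Zs] by blast
      ultimately obtain b where bb: "b \<in> B i a" "t \<odot>\<^bsub>E i\<^esub> v \<ominus>\<^bsub>E i\<^esub> b \<in> Z i ?a'"
        using cocycle_adjust[OF ideal(1) xs(2)] by blast
      let ?w = "t \<odot>\<^bsub>E i\<^esub> v \<ominus>\<^bsub>E i\<^esub> b"
      have "nonzero_at i ?a' Q" unfolding nonzero_at_def
      proof (intro bexI[OF _ bb(2)] ballI notI)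
        fix r assume r: "r \<in> carrier R - Q" "r \<odot>\<^bsub>E i\<^esub> ?w \<in> B i ?a'"
        have "r \<odot>\<^bsub>E i\<^esub> ?w \<in> B i a" using r B_anti[of a ?a' i] a' by blast
        hence "r \<odot>\<^bsub>E i\<^esub> ?w \<oplus>\<^bsub>E i\<^esub> r \<odot>\<^bsub>E i\<^esub> b \<in> B i a"
          using r bb E.submodule_add[OF Bs] E.submodule_smult[OF Bs] by blast
        moreover have "r \<odot>\<^bsub>E i\<^esub> ?w \<oplus>\<^bsub>E i\<^esub> r \<odot>\<^bsub>E i\<^esub> b = (r \<otimes> t) \<odot>\<^bsub>E i\<^esub> v"
          using r tR vE B_mem[OF aR bb(1)]
          by (simp add: E.smult_r_distr[symmetric] E.minus_cancel E.smult_assoc1)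
        ultimately show False using v(2) prime_compl_mult[OF Q _ t(1), of r] r by auto
      qed
      thus ?thesis using ideal.IH[OF a'] a' by blast
    qed
  qed
qed

text \<open>Adjoining an element of \<open>Q\<close> outside \<open>P\<close> costs one degree, and
  passing on to a prime above costs none.\<close>

lemma nonzero_at_climb:
  assumes Q: "primeideal Q R"
  shows "ideal P R \<Longrightarrow> primeideal P R \<Longrightarrow> P \<subseteq> Q \<Longrightarrow> nonzero_at i P Q \<Longrightarrow>
    \<exists>j\<ge>i. (P \<noteq> Q \<longrightarrow> j > i) \<and> nonzero_at j Q Q"
proof (induction P arbitrary: i rule: ideal_induct)
  case (ideal P)
  show ?case
  proof (cases "P = Q")
    case True
    thus ?thesis using ideal.prems by blast
  next
    case False
    then obtain x where x: "x \<in> Q" "x \<notin> P" using ideal.prems by blast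
    have xR: "x \<in> carrier R" by (rule ideal.Icarr[OF primeideal_ideal[OF Q] x(1)])
    let ?a = "P <+> PIdl x"
    have a: "ideal ?a R" "P \<subseteq> ?a" "x \<in> ?a"
      using adjoin_ideal[OF ideal(1) xR] adjoin_upper[OF ideal(1) xR] adjoin_mem[OF ideal(1) xR] by auto
    have "nonzero_at (Suc i) ?a Q" using nonzero_at_step ideal.prems Q x by blast
    then obtain q where q: "primeideal q R" "?a \<subseteq> q" "q \<subseteq> Q" "nonzero_at (Suc i) q Q"
      using nonzero_at_prime[OF Q a(1)] by blast
    have "P \<subset> q" using q a x by blast
    then obtain j where "j \<ge> Suc i" "nonzero_at j Q Q"
      using ideal.IH[of q "Suc i"] q primeideal_ideal by blast
    thus ?thesis by (intro exI[of _ j]) auto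
  qed
qed

lemma nonzero_at_zero: "primeideal Q R \<Longrightarrow> nonzero_at 0 {\<zero>} Q"
  unfolding nonzero_at_def
  using v0_Z v0(2) ideal_zero_mem[OF primeideal_ideal] by (intro bexI[of _ v0]) auto

lemma nonzero_at_prime_climb:
  assumes "primeideal Q R" "ideal a R" "nonzero_at i a Q"
  shows "\<exists>j\<ge>i. nonzero_at j Q Q"
  using nonzero_at_prime[OF assms] nonzero_at_climb[OF assms(1)] primeideal_ideal by meson

text \<open>The lower bound for the degree: every strict inclusion in a chain of primes raises it by
  at least one.\<close>

lemma nonzero_at_chain:
  "Ps \<noteq> [] \<Longrightarrow> (\<And>P. P \<in> set Ps \<Longrightarrow> primeideal P R) \<Longrightarrow> sorted_wrt (\<subset>) Ps \<Longrightarrow>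
    \<exists>j\<ge>length Ps - 1. nonzero_at j (last Ps) (last Ps)"
proof (induction Ps rule: rev_induct)
  case (snoc Q Ps)
  have Q: "primeideal Q R" using snoc.prems by auto
  show ?case
  proof (cases "Ps = []")
    case True
    thus ?thesis using nonzero_at_prime_climb[OF Q zeroideal nonzero_at_zero[OF Q]] by auto
  next
    case False
    let ?P = "last Ps"
    have P: "primeideal ?P R" "?P \<subset> Q"
      using snoc.prems False by (auto simp: sorted_wrt_append)
    obtain j where j: "j \<ge> length Ps - 1" "nonzero_at j ?P ?P"
      using snoc.IH[OF False] snoc.prems by (auto simp: sorted_wrt_append)
    have "nonzero_at j ?P Q" using nonzero_at_mono[OF j(2)] P by blast
    then obtain k where "k > j" "nonzero_at k Q Q"
      using nonzero_at_climb[OF Q primeideal_ideal[OF P(1)] P(1)] P by blast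
    thus ?thesis using j by (intro exI[of _ k]) auto
  qed
qed simp

text \<open>The upper bound for the degree: an element \<open>y\<close> of the list that already
  lies in the current prime changes nothing, any other raises the degree by exactly one. When the
  list is used up, the current prime can only be \<open>M\<close>.\<close>

lemma nonzero_at_list:
  assumes M: "primeideal M R"
  shows "set ys \<subseteq> M \<Longrightarrow> ideal a R \<Longrightarrow> nonzero_at i a M \<Longrightarrow>
    (\<And>q. primeideal q R \<Longrightarrow> a \<subseteq> q \<Longrightarrow> set ys \<subseteq> q \<Longrightarrow> q \<subseteq> M \<Longrightarrow> q = M) \<Longrightarrow>
    \<exists>j\<ge>i. j \<le> i + length ys \<and> nonzero_at j M M"
proof (induction ys arbitrary: a i)
  case Nil
  from nonzero_at_prime[OF M Nil.prems(2,3)] obtain q where q: "primeideal q R" "a \<subseteq> q" "q \<subseteq> M" "nonzero_at i q M"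
    by blast
  hence "q = M" using Nil by auto
  thus ?case using q by auto
next
  case (Cons y ys)
  from nonzero_at_prime[OF M Cons.prems(2,3)] obtain q where q: "primeideal q R" "a \<subseteq> q" "q \<subseteq> M" "nonzero_at i q M"
    by blast
  have qi: "ideal q R" using q primeideal_ideal by blast
  show ?case
  proof (cases "y \<in> q")
    case True
    have "\<exists>j\<ge>i. j \<le> i + length ys \<and> nonzero_at j M M"
    proof (rule Cons.IH[OF _ qi q(4)])
      fix q' assume "primeideal q' R" "q \<subseteq> q'" "set ys \<subseteq> q'" "q' \<subseteq> M"
      thus "q' = M" using Cons.prems(4)[of q'] True q(2) by auto
    qed (use Cons.prems in auto)
    thus ?thesis by auto
  next
    case False
    have y: "y \<in> M" "y \<in> carrier R" using Cons.prems(1) ideal.Icarr[OF primeideal_ideal[OF M]] by auto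
    have nz: "nonzero_at (Suc i) (q <+> PIdl y) M" using nonzero_at_step[OF q(1) M y(1) False q(4)] .
    have "\<exists>j\<ge>Suc i. j \<le> Suc i + length ys \<and> nonzero_at j M M"
    proof (rule Cons.IH[OF _ adjoin_ideal[OF qi y(2)] nz])
      fix q' assume q': "primeideal q' R" "q <+> PIdl y \<subseteq> q'" "set ys \<subseteq> q'" "q' \<subseteq> M"
      thus "q' = M" using Cons.prems(4)[of q'] q(2)
          subset_trans[OF adjoin_upper[OF qi y(2)] q'(2)] subsetD[OF q'(2) adjoin_mem[OF qi y(2)]] by simp
    qed (use Cons.prems in auto)
    thus ?thesis by (auto dest: Suc_leD)
  qed
qed

lemma nonzero_at_bound: "primeideal Q R \<Longrightarrow> nonzero_at i a Q \<Longrightarrow> a \<subseteq> carrier R \<Longrightarrow> i \<le> n0"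
proof (rule ccontr)
  assume a: "primeideal Q R" "nonzero_at i a Q" "a \<subseteq> carrier R" "\<not> i \<le> n0"
  then obtain v where v: "v \<in> Z i a" "\<forall>s\<in>carrier R - Q. s \<odot>\<^bsub>E i\<^esub> v \<notin> B i a"
    unfolding nonzero_at_def by blast
  have "v = \<zero>\<^bsub>E i\<^esub>" using v E_bound[of i] a Z_mem by auto
  hence "\<one> \<odot>\<^bsub>E i\<^esub> v \<in> B i a" using E.submodule_zero[OF B_submodule[OF a(3)]] by simp
  thus False using v prime_one[OF a(1)] by auto
qed

lemma vanish_adjoin:
  assumes a: "ideal a R" and s: "s \<in> carrier R" and "Z i a \<subseteq> B i a"
    and "\<And>j. i = Suc j \<Longrightarrow> Z j (ideal_colon R a {s}) \<subseteq> B j (ideal_colon R a {s})"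
  shows "Z i (a <+> PIdl s) \<subseteq> B i (a <+> PIdl s)"
  using boundary_adjoin[OF a s] assms(3,4) Z_anti[OF adjoin_upper[OF a s], of i] by blast

text \<open>If \<open>H^(i+1)(a + (s))\<close> vanishes,
  \<open>H^i(a) \<rightarrow> H^i(a : s)\<close> is onto, and this already holds for
  cocycles.\<close>

lemma divide_cocycle:
  assumes a: "ideal a R" and s: "s \<in> carrier R" and w: "w \<in> Z i (ideal_colon R a {s})"
    and vanish: "Z (Suc i) (a <+> PIdl s) \<subseteq> B (Suc i) (a <+> PIdl s)"
  obtains v where "v \<in> Z i a" "s \<odot>\<^bsub>E i\<^esub> v = w"
proof -
  obtain w' where w': "w' \<in> kil i a" "s \<odot>\<^bsub>E i\<^esub> w' = w" "d i w' \<in> Z (Suc i) (a <+> PIdl s)"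
    using connecting[OF a s w] by blast
  have "\<one> \<odot>\<^bsub>E (Suc i)\<^esub> d i w' \<in> B (Suc i) (a <+> PIdl s)" using w' vanish kil_mem by auto
  from connecting_boundary[OF a s w'(1) one_closed this]
  obtain v where "v \<in> Z i a" "s \<odot>\<^bsub>E i\<^esub> v = \<one> \<odot>\<^bsub>E i\<^esub> (s \<odot>\<^bsub>E i\<^esub> w')" by blast
  thus ?thesis using that w' Z_mem[OF w] by simp
qed

text \<open>The map \<open>H^i(c') \<rightarrow> H^i(c)\<close> is injective when
  \<open>H^(i-1)\<close> vanishes for all ideals above \<open>c\<close>: the generators of
  \<open>c'\<close> are adjoined to \<open>c\<close> one by one.\<close>

lemma boundary_upward:
  assumes c: "ideal c R" and c': "ideal c' R" "c \<subseteq> c'" and z: "z \<in> Z i c'" "z \<in> B i c"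
    and vanish: "\<And>j b. i = Suc j \<Longrightarrow> ideal b R \<Longrightarrow> c \<subseteq> b \<Longrightarrow> Z j b \<subseteq> B j b"
  shows "z \<in> B i c'"
proof -
  obtain A where A: "A \<subseteq> carrier R" "finite A" "c' = Idl A" using finetely_gen[OF c'(1)] by blast
  have "z \<in> B i (c <+> Idl A')" if "finite A'" "A' \<subseteq> A" for A' using that
  proof (induction A')
    case empty
    have "c <+> {\<zero>} = c" using ideal_carrier[OF c] by (auto simp: mem_set_add subset_iff)
    thus ?case using z by (simp add: genideal_empty)
  next
    case (insert s F)
    let ?a = "c <+> Idl F"
    have F: "F \<subseteq> carrier R" "s \<in> carrier R" using insert A by auto
    have i: "ideal (Idl F) R" using genideal_ideal[OF F(1)] .
    have a: "ideal ?a R" "c \<subseteq> ?a" using add_ideals[OF c i] set_add_upper1[OF c i] by auto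
    have eq: "c <+> Idl (insert s F) = ?a <+> PIdl s"
      using genideal_insert[OF F(2,1)] add.set_mult_assoc[of c "Idl F" "PIdl s"]
        ideal_carrier[OF c] ideal_carrier[OF i] ideal_carrier[OF cgenideal_ideal[OF F(2)]]
      by (simp add: set_add_defs)
    have "?a <+> PIdl s \<subseteq> c'"
      using c' insert.prems A genideal_self[OF A(1)] genideal_minimal[OF c'(1), of F]
      by (intro adjoin_least set_add_least) auto
    hence "z \<in> Z i (?a <+> PIdl s)" using z Z_anti by blast
    thus ?case unfolding eq
    proof (rule boundary_adjoin[OF a(1) F(2)])
      show "z \<in> B i ?a" using insert by auto
      fix j assume "i = Suc j"
      moreover have "c \<subseteq> ideal_colon R ?a {s}" using a colon_upper[OF a(1), of "{s}"] F by auto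
      ultimately show "Z j (ideal_colon R ?a {s}) \<subseteq> B j (ideal_colon R ?a {s})"
        using vanish colon1_ideal[OF a(1) F(2)] by blast
    qed
  qed
  from this[OF A(2)] have "z \<in> B i (c <+> c')" using A by auto
  moreover have "c' \<subseteq> c <+> c'" using set_add_upper2[OF c c'(1)] .
  ultimately show ?thesis using B_anti by blast
qed

end

subsection \<open>Systems of parameters in Gorenstein rings\<close>

context noetherian_cring
begin

lemma local_proper_subset:
  assumes "local_ring R M" "ideal I R" "I \<noteq> carrier R"
  shows "I \<subseteq> M"
proof -
  obtain J where J: "ideal J R" "I \<subseteq> J" "J \<noteq> carrier R"
    "\<And>K. ideal K R \<Longrightarrow> J \<subset> K \<Longrightarrow> \<not> K \<noteq> carrier R"
    using ideal_maximal_exists[OF assms(2), of "\<lambda>J. J \<noteq> carrier R"] assms(3) by auto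
  have "maximalideal J R"
    by (rule maximalidealI[OF J(1)]) (use J in auto)
  thus ?thesis using assms(1) J unfolding local_ring_def by blast
qed

lemma local_unit:
  assumes "local_ring R M" "x \<in> carrier R - M"
  shows "x \<in> Units R"
proof -
  have x: "x \<in> carrier R" using assms by blast
  have "PIdl x = carrier R"
    using local_proper_subset[OF assms(1) cgenideal_ideal[OF x]] cgenideal_self[OF x] assms by blast
  then obtain r where "r \<in> carrier R" "\<one> = r \<otimes> x" unfolding cgenideal_def by blast
  thus ?thesis unfolding Units_def using x m_comm by (auto intro!: bexI[of _ r])
qed

lemma local_prime: "local_ring R M \<Longrightarrow> primeideal M R"
  using maximalideal_prime by (auto simp: local_ring_def)

lemma local_one_minus_unit:
  assumes "local_ring R M" "a \<in> M"
  shows "\<one> \<ominus> a \<in> Units R"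
proof (rule local_unit[OF assms(1)])
  have M: "primeideal M R" using local_prime[OF assms(1)] .
  have aR: "a \<in> carrier R" using ideal.Icarr[OF primeideal_ideal[OF M] assms(2)] .
  have "\<one> \<ominus> a \<notin> M"
  proof
    assume "\<one> \<ominus> a \<in> M"
    hence "(\<one> \<ominus> a) \<oplus> a \<in> M" using assms(2) ideal_add_mem[OF primeideal_ideal[OF M]] by blast
    moreover have "(\<one> \<ominus> a) \<oplus> a = \<one>" using aR by algebra
    ultimately show False using prime_one[OF M] by simp
  qed
  thus "\<one> \<ominus> a \<in> carrier R - M" using aR by simp
qed

end

lemma (in cring) prime_pow: "primeideal P R \<Longrightarrow> x \<in> carrier R \<Longrightarrow> x [^] (n::nat) \<in> P \<Longrightarrow> x \<in> P"
proof (induction n)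
  case 0
  thus ?case using prime_one by auto
next
  case (Suc n)
  thus ?case using primeideal.I_prime[of P R "x [^] n" x] by auto
qed

text \<open>The ideal generated by a regular sequence of length \<open>t\<close>, with only the
  ideal and the length kept.\<close>

inductive regular_ideal :: "('a, 'r) ring_scheme \<Rightarrow> 'a set \<Rightarrow> nat \<Rightarrow> bool"
  for R (structure) where
  zero: "regular_ideal R {\<zero>} 0"
| adjoin: "regular_ideal R c t \<Longrightarrow> y \<in> carrier R \<Longrightarrow> (\<And>r. r \<in> carrier R \<Longrightarrow> r \<otimes> y \<in> c \<Longrightarrow> r \<in> c) \<Longrightarrow>
    regular_ideal R (c <+> PIdl y) (Suc t)"

lemma (in cring) regular_ideal_ideal: "regular_ideal R c t \<Longrightarrow> ideal c R"
  by (induction rule: regular_ideal.induct) (auto intro: zeroideal adjoin_ideal)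

context injective_resolution
begin

text \<open>The class of \<open>v\<close> generates \<open>H^i(c)\<close> and has annihilator
  \<open>c\<close>; thus \<open>H^i(c)\<close> is a copy of \<open>R/c\<close>.\<close>

definition is_generator :: "nat \<Rightarrow> 'a set \<Rightarrow> 'e \<Rightarrow> bool"
  where "is_generator i c v \<longleftrightarrow> v \<in> Z i c \<and>
    (\<forall>z\<in>Z i c. \<exists>r\<in>carrier R. \<exists>b\<in>B i c. z = r \<odot>\<^bsub>E i\<^esub> v \<oplus>\<^bsub>E i\<^esub> b) \<and>
    (\<forall>r\<in>carrier R. r \<odot>\<^bsub>E i\<^esub> v \<in> B i c \<longrightarrow> r \<in> c)"

text \<open>As \<open>c : y = c\<close> and \<open>H^(t+1)(c) = 0\<close>, the module
  \<open>H^(t+1)(c + (y))\<close> is the cokernel of multiplication by \<open>y\<close> on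
  \<open>H^t(c) = R/c\<close>. Its generator is the connecting image \<open>d f0\<close> of
  \<open>v\<close>, where \<open>y f0 = v\<close>.\<close>

lemma is_generator_adjoin:
  assumes c: "ideal c R" and y: "y \<in> carrier R" and reg: "ideal_colon R c {y} = c"
    and v: "is_generator t c v" and vanish: "Z (Suc t) c \<subseteq> B (Suc t) c"
  shows "\<exists>v'. is_generator (Suc t) (c <+> PIdl y) v'"
proof -
  let ?c = "c <+> PIdl y"
  have cR: "c \<subseteq> carrier R" using c ideal_carrier by blast
  note ks = kil_submodule[OF cR, of t] and Bs = B_submodule[OF cR, of t]
  have vZ: "v \<in> Z t c" and gen: "\<And>z. z \<in> Z t c \<Longrightarrow> \<exists>r\<in>carrier R. \<exists>b\<in>B t c. z = r \<odot>\<^bsub>E t\<^esub> v \<oplus>\<^bsub>E t\<^esub> b"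
    and ann: "\<And>r. r \<in> carrier R \<Longrightarrow> r \<odot>\<^bsub>E t\<^esub> v \<in> B t c \<Longrightarrow> r \<in> c"
    using v unfolding is_generator_def by auto
  have "v \<in> Z t (ideal_colon R c {y})" using vZ reg by simp
  then obtain f0 where f0: "f0 \<in> kil t c" "y \<odot>\<^bsub>E t\<^esub> f0 = v" "d t f0 \<in> Z (Suc t) ?c"
    using connecting[OF c y] by blast
  have m0: "f0 \<in> carrier (E t)" "v \<in> carrier (E t)" using f0 kil_mem vZ Z_mem by auto
  have "\<exists>r\<in>carrier R. \<exists>b\<in>B (Suc t) ?c. w = r \<odot>\<^bsub>E (Suc t)\<^esub> d t f0 \<oplus>\<^bsub>E (Suc t)\<^esub> b" if w: "w \<in> Z (Suc t) ?c" for w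
  proof -
    have "w \<in> B (Suc t) c" using w vanish Z_anti[OF adjoin_upper[OF c y]] by blast
    then obtain f where f: "f \<in> kil t c" "w = d t f" by auto
    have mf: "f \<in> carrier (E t)" using f kil_mem by blast
    have "d t (y \<odot>\<^bsub>E t\<^esub> f) = \<zero>\<^bsub>E (Suc t)\<^esub>" using w f y mf Z_adjoin[OF c y] by (simp add: d_smult)
    hence "y \<odot>\<^bsub>E t\<^esub> f \<in> Z t c" using E.submodule_smult[OF ks y f(1)] by (simp add: Z_def)
    then obtain r b where r: "r \<in> carrier R" "b \<in> B t c" "y \<odot>\<^bsub>E t\<^esub> f = r \<odot>\<^bsub>E t\<^esub> v \<oplus>\<^bsub>E t\<^esub> b"
      using gen by blast
    then obtain g where g: "g \<in> kil t c" "d t g = \<zero>\<^bsub>E (Suc t)\<^esub>" "y \<odot>\<^bsub>E t\<^esub> g = b" 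
      using boundary_lift[OF c y] unfolding reg by metis
    have mg: "g \<in> carrier (E t)" using g kil_mem by blast
    \<comment> \<open>The correction makes \<open>f\<close> killed by \<open>y\<close>:
      \<open>r f0\<close> accounts for the multiple of \<open>v\<close> in \<open>y f\<close>, and
      the cocycle \<open>g\<close> for the boundary part.\<close>
    let ?h = "f \<ominus>\<^bsub>E t\<^esub> (r \<odot>\<^bsub>E t\<^esub> f0 \<oplus>\<^bsub>E t\<^esub> g)"
    have k: "r \<odot>\<^bsub>E t\<^esub> f0 \<oplus>\<^bsub>E t\<^esub> g \<in> kil t c"
      using E.submodule_add[OF ks E.submodule_smult[OF ks r(1) f0(1)] g(1)] .
    have "y \<odot>\<^bsub>E t\<^esub> (r \<odot>\<^bsub>E t\<^esub> f0 \<oplus>\<^bsub>E t\<^esub> g) = y \<odot>\<^bsub>E t\<^esub> f"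
      using y r m0 mg by (simp add: E.smult_r_distr E.smult_comm[of y r] f0 g)
    hence "y \<odot>\<^bsub>E t\<^esub> ?h = \<zero>\<^bsub>E t\<^esub>"
      using y mf kil_mem[OF k] by (simp add: E.smult_r_a_minus) (simp add: a_minus_def E.M.r_neg)
    hence h: "?h \<in> kil t ?c" using kil_adjoin[OF c y] E.submodule_minus[OF ks f(1) k] by blast
    have "f = (r \<odot>\<^bsub>E t\<^esub> f0 \<oplus>\<^bsub>E t\<^esub> g) \<oplus>\<^bsub>E t\<^esub> ?h"
      using E.minus_cancel[OF mf kil_mem[OF k]] mf kil_mem[OF k] by (simp add: E.M.a_comm)
    hence "d t f = d t (r \<odot>\<^bsub>E t\<^esub> f0 \<oplus>\<^bsub>E t\<^esub> g) \<oplus>\<^bsub>E (Suc t)\<^esub> d t ?h"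
      using d_add[OF kil_mem[OF k], of ?h] mf kil_mem[OF k] by simp
    also have "d t (r \<odot>\<^bsub>E t\<^esub> f0 \<oplus>\<^bsub>E t\<^esub> g) = r \<odot>\<^bsub>E (Suc t)\<^esub> d t f0"
      using r m0 mg g by (simp add: d_add d_smult)
    finally have "w = r \<odot>\<^bsub>E (Suc t)\<^esub> d t f0 \<oplus>\<^bsub>E (Suc t)\<^esub> d t ?h" using f by simp
    moreover have "d t ?h \<in> B (Suc t) ?c" using h by simp
    ultimately show ?thesis using r by blast
  qed
  moreover have "r \<in> ?c" if r: "r \<in> carrier R" "r \<odot>\<^bsub>E (Suc t)\<^esub> d t f0 \<in> B (Suc t) ?c" for r
  proof -
    obtain z where z: "z \<in> Z t c" "y \<odot>\<^bsub>E t\<^esub> z = r \<odot>\<^bsub>E t\<^esub> (y \<odot>\<^bsub>E t\<^esub> f0)"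
      using connecting_boundary[OF c y f0(1) r] by blast
    then obtain r1 b where r1: "r1 \<in> carrier R" "b \<in> B t c" "z = r1 \<odot>\<^bsub>E t\<^esub> v \<oplus>\<^bsub>E t\<^esub> b" using gen by blast
    have mb: "b \<in> carrier (E t)" using B_mem[OF cR r1(2)] .
    have "r \<odot>\<^bsub>E t\<^esub> v = (y \<otimes> r1) \<odot>\<^bsub>E t\<^esub> v \<oplus>\<^bsub>E t\<^esub> y \<odot>\<^bsub>E t\<^esub> b"
      using z f0 r1 y mb m0 by (simp add: E.smult_r_distr E.smult_assoc1)
    hence "(r \<ominus> y \<otimes> r1) \<odot>\<^bsub>E t\<^esub> v = y \<odot>\<^bsub>E t\<^esub> b"
      using r r1 y mb m0 by (simp add: E.smult_l_a_minus E.add_minus_cancel)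
    hence "r \<ominus> y \<otimes> r1 \<in> c" using ann r r1 y E.submodule_smult[OF Bs y r1(2)] by simp
    moreover have "r = (r \<ominus> y \<otimes> r1) \<oplus> r1 \<otimes> y" using r(1) r1(1) y by algebra
    ultimately show ?thesis unfolding mem_adjoin using r1 by blast
  qed
  ultimately have "is_generator (Suc t) ?c (d t f0)" unfolding is_generator_def using f0 by blast
  thus ?thesis by blast
qed

text \<open>For a regular sequence of length \<open>t\<close>, cohomology is concentrated in degree
  \<open>t\<close>, where it is \<open>R/c\<close>. The last clause, about larger ideals, says that
  the grade of \<open>c\<close> is at least \<open>t\<close>; all three are proved together because
  each is needed for the next generator.\<close>

lemma regular_ideal_cohomology:
  assumes "regular_ideal R c t"
  shows "(\<forall>j. j \<noteq> t \<longrightarrow> Z j c \<subseteq> B j c) \<and> (\<exists>v. is_generator t c v) \<and>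
    (\<forall>c' j. ideal c' R \<longrightarrow> c \<subseteq> c' \<longrightarrow> j < t \<longrightarrow> Z j c' \<subseteq> B j c')"
  using assms
proof (induction rule: regular_ideal.induct)
  case zero
  have "Z j {\<zero>} \<subseteq> B j {\<zero>}" if "j \<noteq> 0" for j using that Z_Suc_zero[of "j - 1"] by simp
  moreover have "is_generator 0 {\<zero>} v0"
    unfolding is_generator_def
  proof (intro conjI ballI impI)
    show "v0 \<in> Z 0 {\<zero>}" by (rule v0_Z)
    fix z assume "z \<in> Z 0 {\<zero>}"
    then obtain r where "r \<in> carrier R" "z = r \<odot>\<^bsub>E 0\<^esub> v0" using Z_zero_mem by blast
    thus "\<exists>r\<in>carrier R. \<exists>b\<in>B 0 {\<zero>}. z = r \<odot>\<^bsub>E 0\<^esub> v0 \<oplus>\<^bsub>E 0\<^esub> b" using v0 by auto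
  next
    fix r assume "r \<in> carrier R" "r \<odot>\<^bsub>E 0\<^esub> v0 \<in> B 0 {\<zero>}"
    thus "r \<in> {\<zero>}" using v0 by auto
  qed
  ultimately show ?case by auto
next
  case (adjoin c t y)
  let ?c = "c <+> PIdl y"
  have c: "ideal c R" using regular_ideal_ideal adjoin.hyps(1) by blast
  have y: "y \<in> carrier R" by fact
  have reg: "ideal_colon R c {y} = c"
    using adjoin.hyps(3) colon_upper[OF c, of "{y}"] y by (auto simp: mem_colon1)
  obtain v where v: "is_generator t c v" using adjoin.IH by blast
  have van: "\<And>j. j \<noteq> t \<Longrightarrow> Z j c \<subseteq> B j c" using adjoin.IH by blast
  have up: "\<And>c' j. ideal c' R \<Longrightarrow> c \<subseteq> c' \<Longrightarrow> j < t \<Longrightarrow> Z j c' \<subseteq> B j c'" using adjoin.IH by blast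
  have gen: "\<exists>v'. is_generator (Suc t) ?c v'"
    using is_generator_adjoin[OF c y reg v] van[of "Suc t"] by simp
  have up': "Z j c' \<subseteq> B j c'" if c': "ideal c' R" "?c \<subseteq> c'" and j: "j < Suc t" for c' j
  proof (cases "j < t")
    case True
    thus ?thesis using up c' adjoin_upper[OF c y] by blast
  next
    case False
    hence jt: "j = t" using j by simp
    have cc: "c \<subseteq> c'" "y \<in> c'" using c' adjoin_upper[OF c y] adjoin_mem[OF c y] by auto
    have cR: "c \<subseteq> carrier R" using c ideal_carrier by blast
    show ?thesis unfolding jt
    proof
      fix z assume z: "z \<in> Z t c'"
      \<comment> \<open>In the new degree \<open>t\<close> a cocycle of \<open>c'\<close> is
        \<open>r v\<close> plus a boundary. It is killed by \<open>y\<close>, so \<open>r y\<close>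
        and then \<open>r\<close> lie in \<open>c\<close>, and the summand \<open>r v\<close>
        disappears.\<close>
      hence "z \<in> Z t c" using Z_anti[OF cc(1)] by blast
      then obtain r b where r: "r \<in> carrier R" "b \<in> B t c" "z = r \<odot>\<^bsub>E t\<^esub> v \<oplus>\<^bsub>E t\<^esub> b"
        using v unfolding is_generator_def by blast
      have m: "v \<in> carrier (E t)" "b \<in> carrier (E t)"
        using v Z_mem B_mem[OF cR r(2)] unfolding is_generator_def by auto
      have "y \<odot>\<^bsub>E t\<^esub> z = \<zero>\<^bsub>E t\<^esub>" using Z_kil[OF z] cc by (simp add: kil_def)
      hence "(r \<otimes> y) \<odot>\<^bsub>E t\<^esub> v \<oplus>\<^bsub>E t\<^esub> y \<odot>\<^bsub>E t\<^esub> b = \<zero>\<^bsub>E t\<^esub>"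
        using r y m by (simp add: E.smult_r_distr E.smult_assoc1 E.smult_comm[of y r])
      hence "(r \<otimes> y) \<odot>\<^bsub>E t\<^esub> v = \<ominus>\<^bsub>E t\<^esub> (y \<odot>\<^bsub>E t\<^esub> b)"
        using r y m by (metis E.M.minus_equality E.M.minus_minus E.smult_closed m_closed E.M.a_comm)
      hence "(r \<otimes> y) \<odot>\<^bsub>E t\<^esub> v \<in> B t c"
        using E.submodule_smult[OF B_submodule[OF cR] y r(2)] E.submoduleE(3)[OF B_submodule[OF cR]] by simp
      hence "r \<otimes> y \<in> c" using v r y unfolding is_generator_def by blast
      hence rc: "r \<in> c" using adjoin.hyps(3) r by blast
      hence "r \<odot>\<^bsub>E t\<^esub> v = \<zero>\<^bsub>E t\<^esub>" using v Z_kil unfolding is_generator_def kil_def by blast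
      hence zB: "z \<in> B t c" using r m by simp
      show "z \<in> B t c'"
        using boundary_upward[OF c c'(1) cc(1) z zB] up by blast
    qed
  qed
  have van': "Z j ?c \<subseteq> B j ?c" if j: "j \<noteq> Suc t" for j
  proof (cases "j < Suc t")
    case True
    thus ?thesis using up' adjoin_ideal[OF c y] by blast
  next
    case False
    show ?thesis
    proof (rule vanish_adjoin[OF c y])
      show "Z j c \<subseteq> B j c" using van[of j] False by simp
      fix k assume "j = Suc k"
      thus "Z k (ideal_colon R c {y}) \<subseteq> B k (ideal_colon R c {y})"
        unfolding reg using van[of k] False j by simp
    qed
  qed
  show ?case using van' gen up' by blast
qed

end

section \<open>Depth, dimension and the socle over a local ring\<close>

locale local_injective_resolution = injective_resolution +
  fixes M assumes local: "local_ring R M"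
begin

lemma M_prime: "primeideal M R"
  using local by (rule local_prime)

lemma M_ideal: "ideal M R"
  using M_prime by (rule primeideal_ideal)

text \<open>Elements outside \<open>M\<close> are units, so localization at \<open>M\<close> changes
  nothing.\<close>

lemma vanish_iff:
  assumes a: "ideal a R"
  shows "Z i a \<subseteq> B i a \<longleftrightarrow> \<not> nonzero_at i a M"
proof
  have aR: "a \<subseteq> carrier R" using a ideal_carrier by blast
  show "\<not> nonzero_at i a M" if "Z i a \<subseteq> B i a"
    using that prime_one[OF M_prime] Z_mem unfolding nonzero_at_def
    by (metis DiffI E.smult_one one_closed subsetD)
  assume n: "\<not> nonzero_at i a M"
  show "Z i a \<subseteq> B i a"
  proof
    fix v assume v: "v \<in> Z i a"
    then obtain s where s: "s \<in> carrier R - M" "s \<odot>\<^bsub>E i\<^esub> v \<in> B i a" using n unfolding nonzero_at_def by blast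
    have u: "s \<in> Units R" using local_unit[OF local s(1)] .
    have "inv s \<odot>\<^bsub>E i\<^esub> (s \<odot>\<^bsub>E i\<^esub> v) \<in> B i a"
      using E.submodule_smult[OF B_submodule[OF aR] _ s(2)] u by simp
    moreover have "inv s \<odot>\<^bsub>E i\<^esub> (s \<odot>\<^bsub>E i\<^esub> v) = v"
      using u Z_mem[OF v] by (simp add: E.smult_assoc1[symmetric] Units_closed)
    ultimately show "v \<in> B i a" by simp
  qed
qed

text \<open>The degree is both the depth of \<open>R\<close> and its injective dimension.\<close>

lemma nonzero_at_unique:
  assumes "nonzero_at i M M" "nonzero_at j M M"
  shows "i = j"
proof -
  let ?S = "{j. nonzero_at j M M}"
  have "?S \<subseteq> {..n0}" using nonzero_at_bound[OF M_prime] ideal_carrier[OF M_ideal] by auto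
  hence fin: "finite ?S" by (rule finite_subset) simp
  \<comment> \<open>The largest degree with nonzero \<open>H^r(M)\<close>; it exists as the
    resolution is finite.\<close>
  define r where "r = Max ?S"
  have r: "nonzero_at r M M" using Max_in[OF fin] assms unfolding r_def by blast
  have r_max: "k \<le> r" if "nonzero_at k M M" for k using Max_ge[OF fin] that unfolding r_def by blast
  \<comment> \<open>A maximal ideal inside \<open>M\<close> generated by a regular sequence. Modulo
    it all elements of \<open>M\<close> are zero divisors, whence a socle element \<open>u\<close>
    with \<open>c : u = M\<close>.\<close>
  define Q where "Q = (\<lambda>c. c \<subseteq> M \<and> (\<exists>t. regular_ideal R c t))"
  have "Q {\<zero>}" unfolding Q_def using ideal_zero_mem[OF M_ideal] regular_ideal.zero by blast
  from ideal_maximal_exists[of _ Q, OF zeroideal this]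
  obtain c where c: "ideal c R" "Q c" and cmax: "\<And>K. ideal K R \<Longrightarrow> c \<subset> K \<Longrightarrow> \<not> Q K" by blast
  obtain t where cM: "c \<subseteq> M" and t: "regular_ideal R c t" using c unfolding Q_def by blast
  have "\<exists>u\<in>carrier R - c. \<forall>y\<in>M. y \<otimes> u \<in> c"
  proof (rule zero_divisors_socle[OF c(1) M_ideal], rule ccontr)
    fix y assume y: "y \<in> M" "\<not> (\<exists>r\<in>carrier R - c. y \<otimes> r \<in> c)"
    have yR: "y \<in> carrier R" using ideal.Icarr[OF M_ideal y(1)] .
    have "regular_ideal R (c <+> PIdl y) (Suc t)"
      by (rule regular_ideal.adjoin[OF t yR]) (use y yR m_comm in auto)
    moreover have "c <+> PIdl y \<subseteq> M" using adjoin_least[OF M_ideal cM y(1)] .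
    ultimately have "\<not> c \<subset> c <+> PIdl y"
      using cmax[OF adjoin_ideal[OF c(1) yR]] unfolding Q_def by blast
    hence "y \<otimes> \<one> \<in> c" using adjoin_upper[OF c(1) yR] adjoin_mem[OF c(1) yR] yR by auto
    thus False using y cM prime_one[OF M_prime] by blast
  qed
  then obtain u where u: "u \<in> carrier R" "u \<notin> c" "\<And>y. y \<in> M \<Longrightarrow> y \<otimes> u \<in> c" by blast
  have "ideal_colon R c {u} \<noteq> carrier R" using u mem_colon1[of \<one> c u] by auto
  hence "ideal_colon R c {u} \<subseteq> M" using local_proper_subset[OF local colon1_ideal[OF c(1) u(1)]] by blast
  moreover have "M \<subseteq> ideal_colon R c {u}" using u(3) ideal.Icarr[OF M_ideal] by (auto simp: mem_colon1)
  ultimately have colon: "ideal_colon R c {u} = M" by blast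
  note coh = regular_ideal_cohomology[OF t]
  \<comment> \<open>Otherwise nonvanishing would climb to \<open>M\<close> in a degree beyond
    \<open>r\<close>.\<close>
  have "\<not> nonzero_at (Suc r) (c <+> PIdl u) M"
    using nonzero_at_prime_climb[OF M_prime adjoin_ideal[OF c(1) u(1)], of "Suc r"] r_max by fastforce
  hence van: "Z (Suc r) (c <+> PIdl u) \<subseteq> B (Suc r) (c <+> PIdl u)"
    using vanish_iff[OF adjoin_ideal[OF c(1) u(1)]] by blast
  \<comment> \<open>If \<open>r\<close> were not \<open>t\<close>, then \<open>H^r(c) = 0\<close>;
    but \<open>u\<close> maps \<open>H^r(c)\<close> onto \<open>H^r(c : u) = H^r(M)\<close>, which
    is nonzero.\<close>
  have rt: "r = t"
  proof (rule ccontr)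
    assume "r \<noteq> t"
    hence v0: "Z r c \<subseteq> B r c" using coh by blast
    have "Z r M \<subseteq> B r M"
    proof
      fix w assume "w \<in> Z r M"
      then obtain v where "v \<in> Z r c" "u \<odot>\<^bsub>E r\<^esub> v = w"
        using divide_cocycle[OF c(1) u(1) _ van, of w] colon by auto
      thus "w \<in> B r M" using smult_B_colon[OF u(1), of v r c] colon v0 by auto
    qed
    thus False using r vanish_iff[OF M_ideal] by blast
  qed
  have "k = t" if k: "nonzero_at k M M" for k
  proof -
    have "\<not> k < t" using coh M_ideal cM vanish_iff[OF M_ideal, of k] k by blast
    thus ?thesis using r_max[OF k] rt by simp
  qed
  thus ?thesis using assms by metis
qed

lemma sop_prime:
  assumes "sop R M xs" "primeideal q R" "set xs \<subseteq> q" "q \<subseteq> M"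
  shows "q = M"
proof
  show "M \<subseteq> q"
  proof
    fix y assume "y \<in> M"
    hence "y \<in> radical R (Idl (set xs))" using assms unfolding sop_def by simp
    then obtain n :: nat where "y \<in> carrier R" "y [^] n \<in> Idl (set xs)" unfolding radical_def by blast
    thus "y \<in> q" using prime_pow[OF assms(2)] genideal_minimal[OF primeideal_ideal[OF assms(2)] assms(3)] by blast
  qed
qed (rule assms)

text \<open>A chain of primes of maximal length forces a nonzero degree at least
  \<open>length xs\<close>, the list \<open>xs\<close> one at most \<open>length xs\<close>, and
  there is only one degree.\<close>

lemma nonzero_at_dim:
  assumes sop: "sop R M xs" and r: "nonzero_at r M M"
  shows "r = length xs"
proof -
  \<comment> \<open>A finite supremum of naturals is attained. The chain \<open>[M]\<close> excludes
    the case of dimension 0, in which \<open>length xs - 1\<close> would not be smaller.\<close>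
  have "\<exists>Ps. prime_chain R Ps \<and> length Ps - 1 \<ge> length xs"
  proof (rule ccontr)
    assume n: "\<nexists>Ps. prime_chain R Ps \<and> length xs \<le> length Ps - 1"
    have "prime_chain R [M]" using M_prime by (simp add: prime_chain_def Spec_def)
    hence pos: "length xs > 0" using n by auto
    have "krull_dim R \<le> enat (length xs - 1)" unfolding krull_dim_def
    proof (rule Sup_least)
      fix e assume "e \<in> {enat (length Ps - 1) |Ps. prime_chain R Ps}"
      then obtain Ps where Ps: "e = enat (length Ps - 1)" "prime_chain R Ps" by blast
      hence "length Ps - 1 < length xs" using n by force
      thus "e \<le> enat (length xs - 1)" using Ps by simp
    qed
    thus False using sop pos unfolding sop_def by (metis One_nat_def diff_less enat_ord_simps(1) less_one linorder_not_le)
  qed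
  then obtain Ps where Ps: "prime_chain R Ps" "length Ps - 1 \<ge> length xs" by blast
  hence pr: "Ps \<noteq> []" "\<And>P. P \<in> set Ps \<Longrightarrow> primeideal P R" "sorted_wrt (\<subset>) Ps"
    unfolding prime_chain_def Spec_def by auto
  obtain j where j: "j \<ge> length Ps - 1" "nonzero_at j (last Ps) (last Ps)" using nonzero_at_chain[OF pr] by blast
  have P: "primeideal (last Ps) R" using pr by simp
  have "last Ps \<subseteq> M" using local_proper_subset[OF local primeideal_ideal[OF P]] primeideal.I_notcarr[OF P] by blast
  then obtain k where k: "k \<ge> j" "nonzero_at k M M"
    using nonzero_at_climb[OF M_prime primeideal_ideal[OF P] P] nonzero_at_mono[OF j(2)] by blast
  have "set xs \<subseteq> M" using sop unfolding sop_def by blast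
  from nonzero_at_list[OF M_prime this zeroideal nonzero_at_zero[OF M_prime]] sop_prime[OF sop]
  obtain l where "l \<le> length xs" "nonzero_at l M M" by auto
  hence "l \<le> length xs" "r = l" "r = k" using nonzero_at_unique[OF r] k(2) by auto
  thus ?thesis using k(1) j(1) Ps(2) by linarith
qed

text \<open>The parameters not among the first \<open>t\<close> raise the degree by at most
  \<open>length xs - t\<close>, so starting below \<open>t\<close> one would reach a nonzero
  \<open>H^j(M)\<close> with \<open>j < length xs\<close>.\<close>

lemma sop_vanish:
  assumes sop: "sop R M xs" and c: "ideal c R" "set (take t xs) \<subseteq> c" and i: "i < t" "t \<le> length xs"
  shows "Z i c \<subseteq> B i c"
proof (rule ccontr)
  assume "\<not> ?thesis"
  hence nz: "nonzero_at i c M" using vanish_iff[OF c(1)] by blast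
  have "set (drop t xs) \<subseteq> M" using sop set_drop_subset[of t xs] unfolding sop_def by blast
  from nonzero_at_list[OF M_prime this c(1) nz]
  obtain j where "j \<le> i + length (drop t xs)" "nonzero_at j M M"
  proof (rule exE)
    fix q assume q: "primeideal q R" "c \<subseteq> q" "set (drop t xs) \<subseteq> q" "q \<subseteq> M"
    have "set xs = set (take t xs) \<union> set (drop t xs)" by (metis append_take_drop_id set_append)
    thus "q = M" using sop_prime[OF sop q(1) _ q(4)] q c by blast
  qed blast
  thus False using nonzero_at_dim[OF sop] i by fastforce
qed

lemma sop_carrier: "sop R M xs \<Longrightarrow> set xs \<subseteq> carrier R"
  using ideal_carrier[OF M_ideal] unfolding sop_def by blast

text \<open>Let \<open>v\<close> generate \<open>H^t(c) = R/c\<close>. If \<open>r\<close> times the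
  parameter lies in \<open>c\<close>, then \<open>r v\<close> is a cocycle of the ideal enlarged by
  that parameter. The latter contains \<open>t + 1\<close> parameters and has no cohomology in
  degree \<open>t\<close>, so \<open>r v\<close> is a boundary and \<open>r\<close> lies in
  \<open>c\<close>.\<close>

lemma sop_regular_step:
  assumes sop: "sop R M xs" and t: "t < length xs" and c: "regular_ideal R (Idl (set (take t xs))) t"
    and r: "r \<in> carrier R" "r \<otimes> xs ! t \<in> Idl (set (take t xs))"
  shows "r \<in> Idl (set (take t xs))"
proof -
  let ?c = "Idl (set (take t xs))" and ?x = "xs ! t"
  have xR: "?x \<in> carrier R" using sop_carrier[OF sop] t by auto
  have tR: "set (take t xs) \<subseteq> carrier R" using sop_carrier[OF sop] set_take_subset by fast
  have ci: "ideal ?c R" using genideal_ideal[OF tR] .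
  have cR: "?c \<subseteq> carrier R" using ideal_carrier[OF ci] .
  obtain v where v: "is_generator t ?c v" using regular_ideal_cohomology[OF c] by blast
  have vZ: "v \<in> Z t ?c" and ann: "\<And>r. r \<in> carrier R \<Longrightarrow> r \<odot>\<^bsub>E t\<^esub> v \<in> B t ?c \<Longrightarrow> r \<in> ?c"
    using v unfolding is_generator_def by auto
  have vE: "v \<in> carrier (E t)" using Z_mem[OF vZ] .
  have "?x \<odot>\<^bsub>E t\<^esub> (r \<odot>\<^bsub>E t\<^esub> v) = (r \<otimes> ?x) \<odot>\<^bsub>E t\<^esub> v"
    using r(1) xR vE by (simp add: E.smult_assoc1 E.smult_comm[of ?x r])
  also have "\<dots> = \<zero>\<^bsub>E t\<^esub>" using r(2) Z_kil[OF vZ] unfolding kil_def by blast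
  finally have "r \<odot>\<^bsub>E t\<^esub> v \<in> Z t (?c <+> PIdl ?x)"
    using Z_adjoin[OF ci xR] E.submodule_smult[OF Z_submodule[OF cR] r(1) vZ] by blast
  moreover have "Z t (?c <+> PIdl ?x) \<subseteq> B t (?c <+> PIdl ?x)"
  proof (rule sop_vanish[OF sop adjoin_ideal[OF ci xR], of "Suc t"])
    show "set (take (Suc t) xs) \<subseteq> ?c <+> PIdl ?x"
      using adjoin_mem[OF ci xR] adjoin_upper[OF ci xR] genideal_self[OF tR] t
      by (auto simp: take_Suc_conv_app_nth)
  qed (use t in auto)
  ultimately have "r \<odot>\<^bsub>E t\<^esub> v \<in> B t ?c" using B_anti[OF adjoin_upper[OF ci xR], of t] by blast
  thus ?thesis using ann r by blast
qed

lemma sop_regular_ideal: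
  assumes sop: "sop R M xs"
  shows "t \<le> length xs \<Longrightarrow> regular_ideal R (Idl (set (take t xs))) t"
proof (induction t)
  case 0
  show ?case by (simp add: genideal_empty regular_ideal.zero)
next
  case (Suc t)
  have xR: "xs ! t \<in> carrier R" using sop_carrier[OF sop] Suc.prems by auto
  have tR: "set (take t xs) \<subseteq> carrier R" using sop_carrier[OF sop] set_take_subset by fast
  have "Idl (set (take (Suc t) xs)) = Idl (set (take t xs)) <+> PIdl (xs ! t)"
    using genideal_insert[OF xR tR] Suc.prems by (simp add: take_Suc_conv_app_nth)
  moreover have "regular_ideal R (Idl (set (take t xs)) <+> PIdl (xs ! t)) (Suc t)"
    using Suc sop_regular_step[OF sop] xR by (intro regular_ideal.adjoin) auto
  ultimately show ?case by simp
qed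

lemma sop_last_regular:
  assumes "sop R M (ws @ [w])" "r \<in> carrier R" "r \<otimes> w \<in> Idl (set ws)"
  shows "r \<in> Idl (set ws)"
  using sop_regular_step[OF assms(1), of "length ws" r] sop_regular_ideal[OF assms(1), of "length ws"] assms(2,3)
  by simp

text \<open>In the top degree, \<open>u\<close> maps \<open>H(c) = R/c\<close> onto
  \<open>H(c : u) = H(M)\<close>. As \<open>M u'\<close> lies in \<open>c\<close>, the element
  \<open>u' v\<close> is a cocycle of \<open>M\<close>, so \<open>u' v = u v'\<close> with
  \<open>v'\<close> a multiple \<open>r v\<close> up to a boundary; comparing gives that
  \<open>u' - r u\<close> kills the class of \<open>v\<close>.\<close>

lemma sop_simple_socle:
  assumes sop: "sop R M xs" and u: "u \<in> carrier R" "u \<notin> Idl (set xs)" "\<And>y. y \<in> M \<Longrightarrow> y \<otimes> u \<in> Idl (set xs)"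
    and u': "u' \<in> carrier R" "\<And>y. y \<in> M \<Longrightarrow> y \<otimes> u' \<in> Idl (set xs)"
  shows "\<exists>r\<in>carrier R. u' \<ominus> r \<otimes> u \<in> Idl (set xs)"
proof -
  let ?c = "Idl (set xs)" and ?n = "length xs"
  have ci: "ideal ?c R" using genideal_ideal[OF sop_carrier[OF sop]] .
  have cR: "?c \<subseteq> carrier R" using ideal_carrier[OF ci] .
  have "regular_ideal R ?c ?n" using sop_regular_ideal[OF sop, of ?n] by simp
  then obtain v where v: "is_generator ?n ?c v" using regular_ideal_cohomology by blast
  have vZ: "v \<in> Z ?n ?c" and ann: "\<And>r. r \<in> carrier R \<Longrightarrow> r \<odot>\<^bsub>E ?n\<^esub> v \<in> B ?n ?c \<Longrightarrow> r \<in> ?c"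
    using v unfolding is_generator_def by auto
  have vE: "v \<in> carrier (E ?n)" using Z_mem[OF vZ] .
  have "ideal_colon R ?c {u} \<noteq> carrier R" using u mem_colon1[of \<one> ?c u] by auto
  hence "ideal_colon R ?c {u} \<subseteq> M" using local_proper_subset[OF local colon1_ideal[OF ci u(1)]] by blast
  moreover have "M \<subseteq> ideal_colon R ?c {u}" using u(3) ideal.Icarr[OF M_ideal] by (auto simp: mem_colon1)
  ultimately have colon: "ideal_colon R ?c {u} = M" by blast
  have a: "ideal (?c <+> PIdl u) R" using adjoin_ideal[OF ci u(1)] .
  have van: "Z (Suc ?n) (?c <+> PIdl u) \<subseteq> B (Suc ?n) (?c <+> PIdl u)"
  proof (rule ccontr)
    assume "\<not> ?thesis"
    hence "nonzero_at (Suc ?n) (?c <+> PIdl u) M" using vanish_iff[OF a] by blast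
    then obtain j where "j \<ge> Suc ?n" "nonzero_at j M M" using nonzero_at_prime_climb[OF M_prime a] by blast
    thus False using nonzero_at_dim[OF sop] by fastforce
  qed
  have "r \<odot>\<^bsub>E ?n\<^esub> (u' \<odot>\<^bsub>E ?n\<^esub> v) = \<zero>\<^bsub>E ?n\<^esub>" if r: "r \<in> M" for r
  proof -
    have rR: "r \<in> carrier R" using ideal.Icarr[OF M_ideal r] .
    have "r \<odot>\<^bsub>E ?n\<^esub> (u' \<odot>\<^bsub>E ?n\<^esub> v) = (r \<otimes> u') \<odot>\<^bsub>E ?n\<^esub> v" using rR u' vE by (simp add: E.smult_assoc1)
    also have "\<dots> = \<zero>\<^bsub>E ?n\<^esub>" using u'(2)[OF r] Z_kil[OF vZ] unfolding kil_def by blast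
    finally show ?thesis .
  qed
  hence "u' \<odot>\<^bsub>E ?n\<^esub> v \<in> Z ?n M" using vZ vE u' by (simp add: Z_def kil_def d_smult)
  then obtain v' where v': "v' \<in> Z ?n ?c" "u \<odot>\<^bsub>E ?n\<^esub> v' = u' \<odot>\<^bsub>E ?n\<^esub> v"
    using divide_cocycle[OF ci u(1) _ van] colon by metis
  then obtain r b where r: "r \<in> carrier R" "b \<in> B ?n ?c" "v' = r \<odot>\<^bsub>E ?n\<^esub> v \<oplus>\<^bsub>E ?n\<^esub> b"
    using v unfolding is_generator_def by blast
  have mb: "b \<in> carrier (E ?n)" using B_mem[OF cR r(2)] .
  have "u' \<odot>\<^bsub>E ?n\<^esub> v = (r \<otimes> u) \<odot>\<^bsub>E ?n\<^esub> v \<oplus>\<^bsub>E ?n\<^esub> u \<odot>\<^bsub>E ?n\<^esub> b"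
    using v'(2)[symmetric] r u(1) mb vE by (simp add: E.smult_r_distr E.smult_assoc1 E.smult_comm[of u r])
  hence "(u' \<ominus> r \<otimes> u) \<odot>\<^bsub>E ?n\<^esub> v = u \<odot>\<^bsub>E ?n\<^esub> b"
    using r u(1) u'(1) mb vE by (simp add: E.smult_l_a_minus E.add_minus_cancel)
  hence "u' \<ominus> r \<otimes> u \<in> ?c"
    using ann r u(1) u'(1) E.submodule_smult[OF B_submodule[OF cR] u(1) r(2)] by simp
  thus ?thesis using r by blast
qed

end

text \<open>A copy of \<open>R\<close> as a module over itself in the type over which the test modules in
  \<^const>\<open>injective_module\<close> range.\<close>

definition const_module :: "('a, 'r) ring_scheme \<Rightarrow> ('a, nat \<Rightarrow> 'a) module"
  where "const_module R = \<lparr>carrier = (\<lambda>r _. r) ` carrier R, monoid.mult = (\<lambda>f g. f), one = (\<lambda>_. \<one>\<^bsub>R\<^esub>),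
    ring.zero = (\<lambda>_. \<zero>\<^bsub>R\<^esub>), ring.add = (\<lambda>f g n. f n \<oplus>\<^bsub>R\<^esub> g n), smult = (\<lambda>r f n. r \<otimes>\<^bsub>R\<^esub> f n)\<rparr>"

lemma (in cring) const_module_module: "module R (const_module R)"
proof (rule moduleI[OF is_cring])
  show "abelian_group (const_module R)"
  proof (rule abelian_groupI)
    fix f assume "f \<in> carrier (const_module R)"
    then obtain r where "r \<in> carrier R" "f = (\<lambda>_. r)" by (auto simp: const_module_def)
    thus "\<exists>g\<in>carrier (const_module R). g \<oplus>\<^bsub>const_module R\<^esub> f = \<zero>\<^bsub>const_module R\<^esub>"
      by (intro bexI[of _ "\<lambda>_. \<ominus> r"]) (auto simp: const_module_def l_neg)
  qed (auto simp: const_module_def a_ac)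
qed (auto simp: const_module_def l_distr r_distr m_assoc)

text \<open>The map \<open>y + r s \<mapsto> r e\<close> on \<open>a + (s)\<close> is well defined
  since \<open>a : s\<close> kills \<open>e\<close>. An extension of it to \<open>R\<close> is
  multiplication by the value at 1, which is the required \<open>e'\<close>.\<close>

lemma (in cring) injective_module_lift:
  assumes inj: "injective_module R E" and a: "ideal a R" and s: "s \<in> carrier R" and e: "e \<in> carrier E"
    and kill: "\<And>r. r \<in> ideal_colon R a {s} \<Longrightarrow> r \<odot>\<^bsub>E\<^esub> e = \<zero>\<^bsub>E\<^esub>"
  shows "\<exists>e'\<in>carrier E. (\<forall>r\<in>a. r \<odot>\<^bsub>E\<^esub> e' = \<zero>\<^bsub>E\<^esub>) \<and> s \<odot>\<^bsub>E\<^esub> e' = e"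
proof -
  interpret E: module R E using inj by (simp add: injective_module_def)
  let ?N = "const_module R"
  interpret N: module R ?N by (rule const_module_module)
  have aR: "y \<in> carrier R" if "y \<in> a" for y using ideal.Icarr[OF a that] .
  let ?a = "a <+> PIdl s"
  have a': "ideal ?a R" using adjoin_ideal[OF a s] .
  have a'R: "y \<in> carrier R" if "y \<in> ?a" for y using ideal.Icarr[OF a' that] .
  define H where "H = (\<lambda>r (_::nat). r) ` ?a"
  \<comment> \<open>Elements of the test module are constant functions, so \<open>f 0\<close>
    recovers the ring element. Independence of the chosen representation is the next fact.\<close>
  define \<phi> where "\<phi> = (\<lambda>f::nat \<Rightarrow> 'a. SOME z. \<exists>y\<in>a. \<exists>r\<in>carrier R. f 0 = y \<oplus> r \<otimes> s \<and> z = r \<odot>\<^bsub>E\<^esub> e)"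
  have phi: "\<phi> (\<lambda>_. y \<oplus> r \<otimes> s) = r \<odot>\<^bsub>E\<^esub> e" if y: "y \<in> a" and r: "r \<in> carrier R" for y r
    unfolding \<phi>_def
  proof (rule some_equality)
    show "\<exists>y'\<in>a. \<exists>r'\<in>carrier R. y \<oplus> r \<otimes> s = y' \<oplus> r' \<otimes> s \<and> r \<odot>\<^bsub>E\<^esub> e = r' \<odot>\<^bsub>E\<^esub> e" using y r by blast
    fix z assume "\<exists>y'\<in>a. \<exists>r'\<in>carrier R. y \<oplus> r \<otimes> s = y' \<oplus> r' \<otimes> s \<and> z = r' \<odot>\<^bsub>E\<^esub> e"
    then obtain y' r' where e': "y' \<in> a" "r' \<in> carrier R" "y \<oplus> r \<otimes> s = y' \<oplus> r' \<otimes> s" "z = r' \<odot>\<^bsub>E\<^esub> e" by blast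
    have c: "y \<in> carrier R" "y' \<in> carrier R" using aR y e' by auto
    have "(r' \<ominus> r) \<otimes> s = (y' \<oplus> r' \<otimes> s) \<ominus> y' \<ominus> r \<otimes> s" using c r e'(2) s by algebra
    also have "\<dots> = (y \<oplus> r \<otimes> s) \<ominus> y' \<ominus> r \<otimes> s" using e'(3) by simp
    also have "\<dots> = y \<ominus> y'" using c r e'(2) s by algebra
    also have "\<dots> \<in> a" using ideal_minus_mem[OF a y e'(1)] .
    finally have "r' \<ominus> r \<in> ideal_colon R a {s}" using r e'(2) by (simp add: mem_colon1)
    hence k: "(r' \<ominus> r) \<odot>\<^bsub>E\<^esub> e = \<zero>\<^bsub>E\<^esub>" using kill by blast
    have "r' = (r' \<ominus> r) \<oplus> r" using r e'(2) by algebra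
    hence "r' \<odot>\<^bsub>E\<^esub> e = (r' \<ominus> r) \<odot>\<^bsub>E\<^esub> e \<oplus>\<^bsub>E\<^esub> r \<odot>\<^bsub>E\<^esub> e"
      using E.smult_l_distr[of "r' \<ominus> r" r e] e r e'(2) by simp
    thus "z = r \<odot>\<^bsub>E\<^esub> e" using k e r e'(4) by simp
  qed
  have phi': "\<exists>r\<in>carrier R. \<exists>y\<in>a. x = y \<oplus> r \<otimes> s \<and> \<phi> (\<lambda>_. x) = r \<odot>\<^bsub>E\<^esub> e" if "x \<in> ?a" for x
    using that phi unfolding mem_adjoin by blast
  have Hs: "submodule H R ?N"
    by (rule N.submoduleI')
      (auto simp: H_def const_module_def a'R ideal_zero_mem[OF a'] intro!: imageI
        intro: ideal_add_mem[OF a'] ideal_mult_mem[OF a'])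
  have hom: "\<phi> \<in> mod_hom R (?N\<lparr>carrier := H\<rparr>) E"
    unfolding mod_hom_def
  proof (intro CollectI conjI ballI Pi_I)
    fix f assume "f \<in> carrier (?N\<lparr>carrier := H\<rparr>)"
    then obtain x where x: "x \<in> ?a" "f = (\<lambda>_. x)" by (auto simp: H_def)
    then obtain r y where r: "r \<in> carrier R" "y \<in> a" "x = y \<oplus> r \<otimes> s" "\<phi> f = r \<odot>\<^bsub>E\<^esub> e" using phi' by blast
    thus "\<phi> f \<in> carrier E" using e by simp
    { fix g assume "g \<in> carrier (?N\<lparr>carrier := H\<rparr>)"
      then obtain x' where x': "x' \<in> ?a" "g = (\<lambda>_. x')" by (auto simp: H_def)
      then obtain r' y' where r': "r' \<in> carrier R" "y' \<in> a" "x' = y' \<oplus> r' \<otimes> s" "\<phi> g = r' \<odot>\<^bsub>E\<^esub> e"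
        using phi' by blast
      have c: "y \<in> carrier R" "y' \<in> carrier R" using aR r r' by auto
      have "x \<oplus> x' = (y \<oplus> y') \<oplus> (r \<oplus> r') \<otimes> s" unfolding r(3) r'(3) using c r(1) r'(1) s by algebra
      hence "\<phi> (\<lambda>_. x \<oplus> x') = (r \<oplus> r') \<odot>\<^bsub>E\<^esub> e"
        using phi[of "y \<oplus> y'" "r \<oplus> r'"] ideal_add_mem[OF a r(2) r'(2)] r r' by simp
      thus "\<phi> (f \<oplus>\<^bsub>?N\<lparr>carrier := H\<rparr>\<^esub> g) = \<phi> f \<oplus>\<^bsub>E\<^esub> \<phi> g"
        using r r' x x' e by (simp add: const_module_def E.smult_l_distr) }
    fix b assume b: "b \<in> carrier R"
    { fix f assume "f \<in> carrier (?N\<lparr>carrier := H\<rparr>)"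
      then obtain x where x: "x \<in> ?a" "f = (\<lambda>_. x)" by (auto simp: H_def)
      then obtain r y where r: "r \<in> carrier R" "y \<in> a" "x = y \<oplus> r \<otimes> s" "\<phi> f = r \<odot>\<^bsub>E\<^esub> e" using phi' by blast
      have c: "y \<in> carrier R" using aR r by auto
      have "b \<otimes> x = b \<otimes> y \<oplus> (b \<otimes> r) \<otimes> s" unfolding r(3) using c r(1) b s by algebra
      hence "\<phi> (\<lambda>_. b \<otimes> x) = (b \<otimes> r) \<odot>\<^bsub>E\<^esub> e"
        using phi[of "b \<otimes> y" "b \<otimes> r"] ideal_mult_mem[OF a r(2) b] r b by simp
      thus "\<phi> (b \<odot>\<^bsub>?N\<lparr>carrier := H\<rparr>\<^esub> f) = b \<odot>\<^bsub>E\<^esub> \<phi> f"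
        using r x e b by (simp add: const_module_def E.smult_assoc1) }
  qed
  obtain g where g: "g \<in> mod_hom R ?N E" "\<And>x. x \<in> H \<Longrightarrow> g x = \<phi> x"
    using inj N.module_axioms Hs hom unfolding injective_module_def by blast
  have oneN: "(\<lambda>_. \<one>) \<in> carrier ?N" by (simp add: const_module_def)
  have g1: "g (\<lambda>_. r) = r \<odot>\<^bsub>E\<^esub> g (\<lambda>_. \<one>)" if r: "r \<in> carrier R" for r
  proof -
    have "g (r \<odot>\<^bsub>?N\<^esub> (\<lambda>_. \<one>)) = r \<odot>\<^bsub>E\<^esub> g (\<lambda>_. \<one>)" using g(1) r oneN unfolding mod_hom_def by blast
    thus ?thesis using r by (simp add: const_module_def)
  qed
  show ?thesis
  proof (intro bexI[of _ "g (\<lambda>_. \<one>)"] conjI ballI)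
    show "g (\<lambda>_. \<one>) \<in> carrier E" using g(1) oneN unfolding mod_hom_def by blast
    fix y assume y: "y \<in> a"
    have "y \<in> ?a" using y adjoin_upper[OF a s] by blast
    hence "g (\<lambda>_. y) = \<phi> (\<lambda>_. y)" using g(2)[of "\<lambda>_. y"] by (simp add: H_def)
    also have "\<dots> = \<zero>\<^bsub>E\<^esub>" using phi[OF y zero_closed] aR[OF y] s e by simp
    finally show "y \<odot>\<^bsub>E\<^esub> g (\<lambda>_. \<one>) = \<zero>\<^bsub>E\<^esub>" using g1[of y] aR[OF y] by simp
  next
    have "g (\<lambda>_. s) = \<phi> (\<lambda>_. s)" using g(2)[of "\<lambda>_. s"] adjoin_mem[OF a s] by (simp add: H_def)
    also have "\<dots> = e" using phi[OF ideal_zero_mem[OF a] one_closed] s e by simp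
    finally show "s \<odot>\<^bsub>E\<^esub> g (\<lambda>_. \<one>) = e" using g1[OF s] by simp
  qed
qed

lemma gorenstein_resolution:
  fixes R :: "('a, 'r) ring_scheme" (structure)
  assumes "gorenstein_local R m"
  shows "\<exists>(E :: nat \<Rightarrow> ('a, nat \<Rightarrow> 'a) module) d v0 n. local_injective_resolution R E d v0 n m"
proof -
  have loc: "local_ring R m" using assms by (simp add: gorenstein_local_def)
  interpret cring R using loc by (simp add: local_ring_def)
  interpret noetherian_cring R using loc by (simp add: local_ring_def noetherian_cring_def is_cring)
  obtain n and E :: "nat \<Rightarrow> ('a, nat \<Rightarrow> 'a) module" and d e where
    inj: "\<And>i. injective_module R (E i)" and d: "\<And>i. d i \<in> mod_hom R (E i) (E (Suc i))" and
    e: "e \<in> mod_hom R (self_module R) (E 0)" "inj_on e (carrier (self_module R))" and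
    im: "e ` carrier (self_module R) = {x \<in> carrier (E 0). d 0 x = \<zero>\<^bsub>E 1\<^esub>}" and
    ex: "\<And>i. d i ` carrier (E i) = {x \<in> carrier (E (Suc i)). d (Suc i) x = \<zero>\<^bsub>E (Suc (Suc i))\<^esub>}" and
    bd: "\<And>i. i > n \<Longrightarrow> carrier (E i) = {\<zero>\<^bsub>E i\<^esub>}"
    using assms unfolding gorenstein_local_def finite_injective_dimension_def by blast
  interpret E: module R "E i" for i using inj by (simp add: injective_module_def)
  have er: "e r = r \<odot>\<^bsub>E 0\<^esub> e \<one>" if r: "r \<in> carrier R" for r
  proof -
    have "\<forall>a\<in>carrier R. \<forall>x\<in>carrier R. e (a \<otimes> x) = a \<odot>\<^bsub>E 0\<^esub> e x"
      using e(1) by (simp add: mod_hom_def self_module_def)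
    hence "e (r \<otimes> \<one>) = r \<odot>\<^bsub>E 0\<^esub> e \<one>" using r one_closed by blast
    thus ?thesis using r by simp
  qed
  have e1: "e \<one> \<in> carrier (E 0)" using e(1) by (auto simp: mod_hom_def self_module_def)
  have "local_injective_resolution R E d (e \<one>) n m"
  proof (unfold_locales)
    show "local_ring R m" by (rule loc)
    show "d i \<in> mod_hom R (E i) (E (Suc i))" for i by (rule d)
    show "\<exists>e'\<in>carrier (E i). (\<forall>r\<in>a. r \<odot>\<^bsub>E i\<^esub> e' = \<zero>\<^bsub>E i\<^esub>) \<and> s \<odot>\<^bsub>E i\<^esub> e' = x"
      if "ideal a R" "s \<in> carrier R" "x \<in> carrier (E i)"
        "\<And>r. r \<in> ideal_colon R a {s} \<Longrightarrow> r \<odot>\<^bsub>E i\<^esub> x = \<zero>\<^bsub>E i\<^esub>" for a s x i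
      using injective_module_lift[OF inj that] .
    show "d i ` carrier (E i) = {x \<in> carrier (E (Suc i)). d (Suc i) x = \<zero>\<^bsub>E (Suc (Suc i))\<^esub>}" for i
      by (rule ex)
    show "e \<one> \<in> carrier (E 0)" by (rule e1)
    show "r = \<zero>" if r: "r \<in> carrier R" "r \<odot>\<^bsub>E 0\<^esub> e \<one> = \<zero>\<^bsub>E 0\<^esub>" for r
    proof -
      have "e r = e \<zero>" using r er[OF r(1)] er[OF zero_closed] e1 by simp
      thus ?thesis using e(2) r by (simp add: self_module_def inj_on_eq_iff)
    qed
    show "{x \<in> carrier (E 0). d 0 x = \<zero>\<^bsub>E 1\<^esub>} = (\<lambda>r. r \<odot>\<^bsub>E 0\<^esub> e \<one>) ` carrier R"
      unfolding im[symmetric] 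
    proof (rule image_cong)
      show "carrier (self_module R) = carrier R" by (simp add: self_module_def)
    qed (rule er)
    show "carrier (E i) = {\<zero>\<^bsub>E i\<^esub>}" if "n < i" for i using bd that .
  qed
  thus ?thesis by blast
qed

theorem gorenstein_sop_regular:
  fixes R :: "('a, 'r) ring_scheme"
  assumes "gorenstein_local R m" "sop R m (ws @ [w])" "r \<in> carrier R" "r \<otimes>\<^bsub>R\<^esub> w \<in> Idl\<^bsub>R\<^esub> (set ws)"
  shows "r \<in> Idl\<^bsub>R\<^esub> (set ws)"
proof -
  obtain E :: "nat \<Rightarrow> ('a, nat \<Rightarrow> 'a) module" and d v0 n where "local_injective_resolution R E d v0 n m" using gorenstein_resolution[OF assms(1)] by blast
  thus ?thesis using local_injective_resolution.sop_last_regular assms(2-4) by metis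
qed

theorem gorenstein_sop_socle:
  fixes R :: "('a, 'r) ring_scheme"
  assumes "gorenstein_local R m" "sop R m xs"
    and "u \<in> carrier R" "u \<notin> Idl\<^bsub>R\<^esub> (set xs)" "\<And>y. y \<in> m \<Longrightarrow> y \<otimes>\<^bsub>R\<^esub> u \<in> Idl\<^bsub>R\<^esub> (set xs)"
    and "u' \<in> carrier R" "\<And>y. y \<in> m \<Longrightarrow> y \<otimes>\<^bsub>R\<^esub> u' \<in> Idl\<^bsub>R\<^esub> (set xs)"
  shows "\<exists>r\<in>carrier R. u' \<ominus>\<^bsub>R\<^esub> r \<otimes>\<^bsub>R\<^esub> u \<in> Idl\<^bsub>R\<^esub> (set xs)"
proof -
  obtain E :: "nat \<Rightarrow> ('a, nat \<Rightarrow> 'a) module" and d v0 n where "local_injective_resolution R E d v0 n m" using gorenstein_resolution[OF assms(1)] by blast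
  from local_injective_resolution.sop_simple_socle[OF this assms(2-7)] show ?thesis .
qed

subsection \<open>Frobenius, ideal powers and reductions\<close>

context cring
begin

lemma binomial:
  fixes n :: nat
  assumes x: "x \<in> carrier R" and y: "y \<in> carrier R"
  shows "(x \<oplus> y) [^] n = (\<Oplus>k\<in>{..n}. [(n choose k)] \<cdot> (x [^] k \<otimes> y [^] (n - k)))"
proof (induction n)
  case 0
  show ?case using x y by simp
next
  case (Suc n)
  let ?t = "\<lambda>n k. [(n choose k)] \<cdot> (x [^] k \<otimes> y [^] (n - k))"
  let ?u = "\<lambda>k. [(n choose k)] \<cdot> (x [^] k \<otimes> y [^] (Suc n - k))"
  have c: "[(j::nat)] \<cdot> (x [^] (k::nat) \<otimes> y [^] (l::nat)) \<in> carrier R" for j k l using x y by simp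
  have X: "x \<otimes> (\<Oplus>k\<in>{..n}. ?t n k) = (\<Oplus>k\<in>{..n}. [(n choose k)] \<cdot> (x [^] Suc k \<otimes> y [^] (n - k)))"

  proof -
    have "x \<otimes> (\<Oplus>k\<in>{..n}. ?t n k) = (\<Oplus>k\<in>{..n}. x \<otimes> ?t n k)"
      using x y by (simp add: finsum_rdistr)
    also have "\<dots> = (\<Oplus>k\<in>{..n}. [(n choose k)] \<cdot> (x [^] Suc k \<otimes> y [^] (n - k)))"
      using x y by (intro finsum_cong') (auto simp: add_pow_rdistr m_ac)
    finally show ?thesis .
  qed
  have "y \<otimes> (\<Oplus>k\<in>{..n}. ?t n k) = (\<Oplus>k\<in>{..n}. y \<otimes> ?t n k)"
    using x y by (simp add: finsum_rdistr)
  also have "\<dots> = (\<Oplus>k\<in>{..n}. ?u k)"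
    using x y by (intro finsum_cong') (auto simp: add_pow_rdistr m_ac Suc_diff_le)
  also have "\<dots> = (\<Oplus>k\<in>{..Suc n}. ?u k)" using x y by (simp add: finsum_Suc binomial_eq_0)
  also have "\<dots> = (\<Oplus>k\<in>{..n}. ?u (Suc k)) \<oplus> ?u 0" using c by (intro finsum_Suc2) auto
  finally have Y: "y \<otimes> (\<Oplus>k\<in>{..n}. ?t n k) = (\<Oplus>k\<in>{..n}. ?u (Suc k)) \<oplus> ?u 0" .
  have "(x \<oplus> y) [^] Suc n = x \<otimes> (\<Oplus>k\<in>{..n}. ?t n k) \<oplus> y \<otimes> (\<Oplus>k\<in>{..n}. ?t n k)"
    using Suc x y c by (simp add: m_comm[of "finsum R _ _"] l_distr)
  also have "\<dots> = ((\<Oplus>k\<in>{..n}. [(n choose k)] \<cdot> (x [^] Suc k \<otimes> y [^] (n - k))) \<oplus>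
      (\<Oplus>k\<in>{..n}. ?u (Suc k))) \<oplus> ?u 0"
    unfolding X Y using x y by (simp add: a_assoc)
  also have "(\<Oplus>k\<in>{..n}. [(n choose k)] \<cdot> (x [^] Suc k \<otimes> y [^] (n - k))) \<oplus> (\<Oplus>k\<in>{..n}. ?u (Suc k)) =
      (\<Oplus>k\<in>{..n}. [(n choose k)] \<cdot> (x [^] Suc k \<otimes> y [^] (n - k)) \<oplus> ?u (Suc k))"
    using x y by (intro finsum_addf[symmetric]) auto
  also have "\<dots> = (\<Oplus>k\<in>{..n}. ?t (Suc n) (Suc k))"
  proof (rule finsum_cong')
    show "[(n choose k)] \<cdot> (x [^] Suc k \<otimes> y [^] (n - k)) \<oplus> ?u (Suc k) = ?t (Suc n) (Suc k)" for k
      using add.nat_pow_mult[of "x [^] Suc k \<otimes> y [^] (n - k)" "n choose k" "n choose Suc k"] x y by simp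
  qed (use x y in auto)
  also have "?u 0 = ?t (Suc n) 0" by simp
  also have "(\<Oplus>k\<in>{..n}. ?t (Suc n) (Suc k)) \<oplus> ?t (Suc n) 0 = (\<Oplus>k\<in>{..Suc n}. ?t (Suc n) k)"
    using c by (intro finsum_Suc2[symmetric]) auto
  finally show ?case .
qed

lemma frobenius_prime:
  fixes p :: nat
  assumes p: "Factorial_Ring.prime p" "[p] \<cdot> \<one> = \<zero>" and x: "x \<in> carrier R" and y: "y \<in> carrier R"
  shows "(x \<oplus> y) [^] p = x [^] p \<oplus> y [^] p"
proof -
  have p0: "p \<noteq> 0" using p(1) prime_gt_0_nat[of p] by simp
  obtain q where q: "p = Suc q" using p0 by (cases p) auto
  have van: "[(p choose k)] \<cdot> z = \<zero>" if k: "k \<noteq> 0" "k < p" and z: "z \<in> carrier R" for k z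
  proof -
    have "p dvd (p choose k)" using dvd_choose_prime[of k p] k p0 p(1) by simp
    then obtain j where j: "p choose k = p * j" by blast
    have "[p] \<cdot> z = [p] \<cdot> \<one> \<otimes> z" using z add_pow_ldistr[of \<one> z p] by simp
    hence "[p] \<cdot> z = \<zero>" using p(2) z by simp
    thus ?thesis using add.nat_pow_pow[OF z, of j p] j by simp
  qed
  let ?t = "\<lambda>k. [(p choose k)] \<cdot> (x [^] k \<otimes> y [^] (p - k))"
  have c: "?t \<in> A \<rightarrow> carrier R" for A using x y by simp
  have "(x \<oplus> y) [^] p = (\<Oplus>k\<in>{..p}. ?t k)" using binomial[OF x y] .
  also have "\<dots> = ?t p \<oplus> (\<Oplus>k\<in>{..q}. ?t k)" using c finsum_Suc[of ?t q] q by simp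
  also have "(\<Oplus>k\<in>{..q}. ?t k) = ?t 0"
  proof (cases q)
    case 0
    thus ?thesis using x y by simp
  next
    case (Suc r)
    have "(\<Oplus>k\<in>{..r}. ?t (Suc k)) = (\<Oplus>k\<in>{..r}. \<zero>)"
      
    proof (intro finsum_cong')
      show "?t (Suc i) = \<zero>" if "i \<in> {..r}" for i
        using Suc q x y that by (intro van) auto
    qed auto
    thus ?thesis using finsum_Suc2[of ?t r] c x y Suc by simp
  qed
  finally show ?thesis using x y by simp
qed

lemma nat_pow_Suc_mem: "ideal I R \<Longrightarrow> x \<in> I \<Longrightarrow> x [^] Suc n \<in> I"
  using ideal_mult_mem[of I x "x [^] n"] ideal.Icarr[of I R x] by simp

lemma nat_pow_mem: "ideal I R \<Longrightarrow> x \<in> I \<Longrightarrow> n > 0 \<Longrightarrow> x [^] (n::nat) \<in> I"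
  using nat_pow_Suc_mem[of I x "n - 1"] by simp

lemma nat_pow_mem_mono: "ideal I R \<Longrightarrow> x \<in> carrier R \<Longrightarrow> x [^] k \<in> I \<Longrightarrow> k \<le> n \<Longrightarrow> x [^] (n::nat) \<in> I"
  using nat_pow_mult[of x "n - k" k] ideal_mult_mem[of I "x [^] k" "x [^] (n - k)"] by simp

lemma ideal_prod_least:
  assumes "ideal T R" "\<And>i j. i \<in> I \<Longrightarrow> j \<in> J \<Longrightarrow> i \<otimes> j \<in> T"
  shows "I \<cdot> J \<subseteq> T"
proof
  fix x assume "x \<in> I \<cdot> J"
  thus "x \<in> T" by induction (use assms ideal_add_mem in auto)
qed

lemma ideal_prod_mono: "I \<subseteq> I' \<Longrightarrow> J \<subseteq> J' \<Longrightarrow> I \<cdot> J \<subseteq> I' \<cdot> J'"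
proof
  fix x assume "I \<subseteq> I'" "J \<subseteq> J'" "x \<in> I \<cdot> J"
  thus "x \<in> I' \<cdot> J'" by (induction rule: ideal_prod.induct[OF \<open>x \<in> I \<cdot> J\<close>]) (auto intro: ideal_prod.intros)
qed

abbreviation ideal_pow :: "'a set \<Rightarrow> nat \<Rightarrow> 'a set"
  where "ideal_pow I n \<equiv> I [^]\<^bsub>ideals_set R\<^esub> n"

sublocale ideals: comm_monoid "ideals_set R"
  by (rule ideals_set_is_comm_monoid)

lemma ideals_carrier: "I \<in> carrier (ideals_set R) \<longleftrightarrow> ideal I R"
  by (simp add: ideals_set_def)

lemma ideals_mult: "I \<otimes>\<^bsub>ideals_set R\<^esub> J = I \<cdot> J"
  by (simp add: ideals_set_def)

lemma ideals_one: "\<one>\<^bsub>ideals_set R\<^esub> = carrier R"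
  by (simp add: ideals_set_def)

lemma ideal_pow_Suc: "ideal_pow I (Suc n) = ideal_pow I n \<cdot> I"
  by (simp add: ideals_mult)

lemma ideal_pow_ideal: "ideal I R \<Longrightarrow> ideal (ideal_pow I n) R"
  using ideals.nat_pow_closed[of I n] by (simp add: ideals_carrier)

lemma ideal_pow_add: "ideal I R \<Longrightarrow> ideal_pow I n \<cdot> ideal_pow I k = ideal_pow I (n + k)"
  using ideals.nat_pow_mult[of I n k] by (simp add: ideals_carrier ideals_mult)

lemma ideal_pow_1: "ideal I R \<Longrightarrow> ideal_pow I (Suc 0) = I"
  using ideal_pow_Suc[of I 0] ideal_prod_one[of I] ideal_prod_commute[of I "carrier R"] oneideal
  by (simp add: ideals_one)

lemma nat_pow_in_ideal_pow: "ideal I R \<Longrightarrow> x \<in> I \<Longrightarrow> x [^] n \<in> ideal_pow I n"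
proof (induction n)
  case 0
  thus ?case by (simp add: ideals_one)
next
  case (Suc n)
  thus ?case unfolding ideal_pow_Suc by (simp add: ideal_prod.prod)
qed

text \<open>The multiples of \<open>a\<close> by elements of \<open>P\<close> already form an ideal,
  so no sums are needed.\<close>

lemma ideal_prod_principal:
  assumes P: "ideal P R" and a: "a \<in> carrier R" and x: "x \<in> P \<cdot> (PIdl a)"
  shows "\<exists>r\<in>P. x = r \<otimes> a"
proof -
  note PR = ideal.Icarr[OF P]
  have "ideal ((\<lambda>r. r \<otimes> a) ` P) R"
  proof (rule idealI')
    show "(\<lambda>r. r \<otimes> a) ` P \<subseteq> carrier R" using PR a by auto
    show "\<zero> \<in> (\<lambda>r. r \<otimes> a) ` P" using ideal_zero_mem[OF P] a by (auto intro!: image_eqI[of _ _ \<zero>])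
    show "x \<oplus> y \<in> (\<lambda>r. r \<otimes> a) ` P" if xy: "x \<in> (\<lambda>r. r \<otimes> a) ` P" "y \<in> (\<lambda>r. r \<otimes> a) ` P" for x y
    proof -
      obtain r r' where r: "r \<in> P" "x = r \<otimes> a" "r' \<in> P" "y = r' \<otimes> a" using xy by auto
      hence "x \<oplus> y = (r \<oplus> r') \<otimes> a" using PR a by (simp add: l_distr)
      thus ?thesis using ideal_add_mem[OF P] r by blast
    qed
    show "s \<otimes> x \<in> (\<lambda>r. r \<otimes> a) ` P" if xs: "x \<in> (\<lambda>r. r \<otimes> a) ` P" "s \<in> carrier R" for x s
    proof -
      obtain r where r: "r \<in> P" "x = r \<otimes> a" using xs by blast
      hence "s \<otimes> x = (s \<otimes> r) \<otimes> a" using PR a xs by (simp add: m_assoc)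
      thus ?thesis using ideal_mult_mem[OF P] r xs by blast
    qed
  qed
  moreover have "i \<otimes> j \<in> (\<lambda>r. r \<otimes> a) ` P" if ij: "i \<in> P" "j \<in> PIdl a" for i j
  proof -
    obtain s where s: "s \<in> carrier R" "j = s \<otimes> a" using ij unfolding cgenideal_def by blast
    have "i \<otimes> j = (i \<otimes> s) \<otimes> a" using s PR ij a by (simp add: m_assoc)
    thus ?thesis using ideal_mult_mem'[OF P] ij s by blast
  qed
  ultimately have "P \<cdot> (PIdl a) \<subseteq> (\<lambda>r. r \<otimes> a) ` P" by (rule ideal_prod_least)
  thus ?thesis using x by blast
qed

lemma reduction_mono:
  assumes "reduction R K I" "ideal K' R" "K \<subseteq> K'" "K' \<subseteq> I" and I: "ideal I R"
  shows "reduction R K' I"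
proof -
  obtain n where n: "K \<cdot> ideal_pow I n = ideal_pow I (Suc n)" using assms unfolding reduction_def by blast
  have "K' \<cdot> ideal_pow I n \<subseteq> I \<cdot> ideal_pow I n" using assms by (intro ideal_prod_mono) auto
  also have "\<dots> = ideal_pow I (Suc n)"
    using ideal_prod_commute[OF I ideal_pow_ideal[OF I]] by (simp add: ideals_mult)
  finally have "K' \<cdot> ideal_pow I n \<subseteq> ideal_pow I (Suc n)" .
  moreover have "ideal_pow I (Suc n) \<subseteq> K' \<cdot> ideal_pow I n"
    unfolding n[symmetric] using assms by (intro ideal_prod_mono) auto
  ultimately show ?thesis using assms unfolding reduction_def by blast
qed

end

text \<open>Elimination of generators one at a time replaces the determinant of the usual
  Cayley--Hamilton argument; the exponent doubles in each step.\<close>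

lemma (in domain) determinant_trick:
  assumes K: "ideal K R" and I: "ideal I R" "K \<subseteq> I"
  shows "as \<noteq> [] \<Longrightarrow> set as \<subseteq> carrier R - {\<zero>} \<Longrightarrow>
    ideal_pow I (Suc k) \<cdot> (Idl (set as)) \<subseteq> (K \<cdot> ideal_pow I k) \<cdot> (Idl (set as)) \<Longrightarrow>
    \<exists>n. ideal_pow I (Suc n) \<subseteq> K \<cdot> ideal_pow I n"
proof (induction as arbitrary: k)
  case (Cons a as)
  let ?N = "ideal_pow I (Suc k)" and ?P = "K \<cdot> ideal_pow I k"
  have N: "ideal ?N R" and P: "ideal ?P R"
    using ideal_pow_ideal[OF I(1)] ideal_prod_is_ideal[OF K] by blast+
  have a: "a \<in> carrier R" "a \<noteq> \<zero>" and asR: "set as \<subseteq> carrier R" using Cons.prems by auto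
  note NR = ideal.Icarr[OF N] and PR = ideal.Icarr[OF P]
  show ?case
  proof (cases "as = []")
    \<comment> \<open>With one generator left, it can be cancelled in the domain.\<close>
    case True
    have "Idl (set (a # as)) = PIdl a" using True a cgenideal_eq_genideal by simp
    hence sub: "?N \<cdot> (PIdl a) \<subseteq> ?P \<cdot> (PIdl a)" using Cons.prems by simp
    have "?N \<subseteq> ?P"
    proof
      fix g assume g: "g \<in> ?N"
      hence "g \<otimes> a \<in> ?P \<cdot> (PIdl a)" using sub cgenideal_self[OF a(1)] by (auto intro: ideal_prod.prod)
      then obtain r where r: "r \<in> ?P" "g \<otimes> a = r \<otimes> a" using ideal_prod_principal[OF P a(1)] by blast
      hence "g = r" using m_rcancel[of a g r] a NR g PR by auto
      thus "g \<in> ?P" using r by simp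
    qed
    thus ?thesis by blast
  next
    case False
    \<comment> \<open>Two relations are combined, which multiplies two factors from
      \<open>I^(k+1)\<close>; hence \<open>I^(2k+2)\<close> and the new exponent
      \<open>2k+1\<close>.\<close>
    let ?M = "Idl (set as)" and ?k = "Suc (k + k)"
    let ?P' = "K \<cdot> ideal_pow I ?k"
    have M: "ideal ?M R" using genideal_ideal[OF asR] .
    note MR = ideal.Icarr[OF M]
    have P': "ideal ?P' R" using ideal_pow_ideal[OF I(1)] ideal_prod_is_ideal[OF K] by blast
    let ?T = "?P' \<cdot> ?M"
    have T: "ideal ?T R" using P' M ideal_prod_is_ideal by auto
    have PM: "ideal (?P \<cdot> ?M) R" using P M ideal_prod_is_ideal by auto
    note PMR = ideal.Icarr[OF PM]
    have gen: "Idl (set (a # as)) = ?M <+> PIdl a" using genideal_insert[OF a(1) asR] by simp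
    have iP: "ideal (ideal_pow I n) R" for n using ideal_pow_ideal[OF I(1)] .
    have PN: "?P \<cdot> ?N = ?P'"
      using ideal_prod_assoc[OF K iP iP, of k "Suc k"] ideal_pow_add[OF I(1), of k "Suc k"] by simp
    have NPT: "g \<otimes> b \<in> ?T" if g: "g \<in> ?N" and b: "b \<in> ?P \<cdot> ?M" for g b
    proof -
      have "g \<otimes> b \<in> ?N \<cdot> (?P \<cdot> ?M)" using g b by (rule ideal_prod.prod)
      also have "\<dots> = ?T" using ideal_prod_assoc[OF N P M] ideal_prod_commute[OF N P] PN by simp
      finally show ?thesis .
    qed
    have PsubN: "?P \<subseteq> ?N"
    proof -
      have "?P \<subseteq> I \<cdot> ideal_pow I k" using I by (intro ideal_prod_mono) auto
      also have "\<dots> = ?N" using ideal_prod_commute[OF I(1) iP] by (simp add: ideals_mult)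
      finally show ?thesis .
    qed
    have rel: "\<exists>r\<in>?P. \<exists>\<beta>\<in>?P \<cdot> ?M. g \<otimes> b = \<beta> \<oplus> r \<otimes> a" if g: "g \<in> ?N" and b: "b \<in> ?M <+> PIdl a" for g b
    proof -
      have "g \<otimes> b \<in> ?P \<cdot> (?M <+> PIdl a)"
        using Cons.prems(3) g b unfolding gen by (auto intro: ideal_prod.prod)
      also have "\<dots> = ?P \<cdot> ?M <+> ?P \<cdot> (PIdl a)" using ideal_prod_distr(1)[OF P M cgenideal_ideal[OF a(1)]] .
      finally obtain \<beta> x where "\<beta> \<in> ?P \<cdot> ?M" "x \<in> ?P \<cdot> (PIdl a)" "g \<otimes> b = \<beta> \<oplus> x" unfolding mem_set_add by blast
      thus ?thesis using ideal_prod_principal[OF P a(1)] by blast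
    qed
    have "ideal_pow I (Suc ?k) \<cdot> ?M \<subseteq> ?T"
    proof (rule ideal_prod_least[OF T])
      fix s b assume s: "s \<in> ideal_pow I (Suc ?k)" and b: "b \<in> ?M"
      have "?N \<cdot> ?N \<subseteq> ideal_colon R ?T ?M"
      proof (rule ideal_prod_least)
        show "ideal (ideal_colon R ?T ?M) R" using T ideal_carrier[OF M] by (rule colon_ideal)
        fix g' g assume g': "g' \<in> ?N" and g: "g \<in> ?N"
        have "g' \<otimes> g \<otimes> b \<in> ?T" if b: "b \<in> ?M" for b
        proof -
          have bR: "b \<in> carrier R" "g \<in> carrier R" "g' \<in> carrier R" using MR b NR g g' by auto
          have "b \<in> ?M <+> PIdl a" using set_add_upper1[OF M cgenideal_ideal[OF a(1)]] b by blast
          then obtain r \<beta> where r: "r \<in> ?P" "\<beta> \<in> ?P \<cdot> ?M" "g \<otimes> b = \<beta> \<oplus> r \<otimes> a" using rel[OF g] by blast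
          have "a \<in> ?M <+> PIdl a" using adjoin_mem[OF M a(1)] .
          then obtain r' \<beta>' where r': "r' \<in> ?P" "\<beta>' \<in> ?P \<cdot> ?M" "g' \<otimes> a = \<beta>' \<oplus> r' \<otimes> a" using rel[OF g'] by blast
          have c: "r \<in> carrier R" "r' \<in> carrier R" "\<beta> \<in> carrier R" "\<beta>' \<in> carrier R"
            using r r' PR PMR by auto
          \<comment> \<open>The second relation rewrites \<open>g' a\<close>, and the term
            \<open>r' r a\<close> that remains is removed by solving the first relation for
            \<open>r a\<close>. The result no longer involves \<open>a\<close>.\<close>
          have e1: "g' \<otimes> g \<otimes> b = g' \<otimes> \<beta> \<oplus> r \<otimes> (g' \<otimes> a)"
            using r(3) bR c a by (simp add: m_assoc r_distr m_lcomm)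
          have e2: "r \<otimes> (g' \<otimes> a) = r \<otimes> \<beta>' \<oplus> r' \<otimes> (r \<otimes> a)"
            using r'(3) c a by (simp add: r_distr m_lcomm)
          have "g \<otimes> b \<ominus> \<beta> = r \<otimes> a" unfolding r(3) using c a by algebra
          hence "r' \<otimes> (r \<otimes> a) = r' \<otimes> (g \<otimes> b \<ominus> \<beta>)" by simp
          also have "\<dots> = r' \<otimes> (g \<otimes> b) \<ominus> r' \<otimes> \<beta>" using bR c by algebra
          finally have e3: "r' \<otimes> (r \<otimes> a) = r' \<otimes> (g \<otimes> b) \<ominus> r' \<otimes> \<beta>" .
          have "g' \<otimes> g \<otimes> b = g' \<otimes> \<beta> \<oplus> (r \<otimes> \<beta>' \<oplus> (g \<otimes> (r' \<otimes> b) \<ominus> r' \<otimes> \<beta>))"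
            unfolding e1 e2 e3 using bR c by (simp add: m_lcomm)
          also have "\<dots> \<in> ?T"
          proof (intro ideal_add_mem[OF T] ideal_minus_mem[OF T] NPT)
            show "r' \<otimes> b \<in> ?P \<cdot> ?M" using r'(1) b by (rule ideal_prod.prod)
            show "r \<in> ?N" "r' \<in> ?N" using r r' PsubN by auto
          qed (use g g' r r' in auto)
          finally show ?thesis .
        qed
        thus "g' \<otimes> g \<in> ideal_colon R ?T ?M" using g g' NR by (auto simp: ideal_colon_def)
      qed
      moreover have "?N \<cdot> ?N = ideal_pow I (Suc ?k)" using ideal_pow_add[OF I(1), of "Suc k" "Suc k"] by simp
      ultimately show "s \<otimes> b \<in> ?T" using s b by (auto simp: ideal_colon_def)
    qed
    thus ?thesis using Cons.IH[OF False, of ?k] Cons.prems by auto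
  qed
qed simp

text \<open>Zero is dropped from the generators, since elimination ends with the cancellation of a
  generator.\<close>

lemma (in noetherian_ring) ideal_list:
  assumes "ideal I R" shows "\<exists>as. set as \<subseteq> carrier R - {\<zero>} \<and> Idl (set as) = I"
proof -
  obtain A where A: "A \<subseteq> carrier R" "finite A" "I = Idl A" using finetely_gen[OF assms] by blast
  obtain as where as: "set as = A - {\<zero>}" using finite_list[of "A - {\<zero>}"] A(2) by auto
  have "Idl (A - {\<zero>}) = Idl A"
  proof (intro equalityI genideal_minimal genideal_ideal)
    show "A - {\<zero>} \<subseteq> Idl A" using genideal_self[OF A(1)] by blast
    have i: "ideal (Idl (A - {\<zero>})) R" using A by (intro genideal_ideal) auto
    have "A - {\<zero>} \<subseteq> Idl (A - {\<zero>})" using A by (intro genideal_self) auto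
    thus "A \<subseteq> Idl (A - {\<zero>})" using additive_subgroup.zero_closed[OF ideal.axioms(1)[OF i]] by auto
  qed (use A in auto)
  thus ?thesis using as A by (intro exI[of _ as]) auto
qed

locale noetherian_cring_domain = noetherian_cring + domain

text \<open>The usual criterion for integral dependence with the faithful module \<open>M\<close>,
  as the case \<open>k = 0\<close> of the elimination.\<close>

lemma (in noetherian_cring_domain) reduction_of_prod_subset:
  assumes K: "ideal K R" and I: "ideal I R" "K \<subseteq> I" and M: "ideal M R" "M \<noteq> {\<zero>}"
    and sub: "M \<cdot> I \<subseteq> M \<cdot> K"
  shows "reduction R K I"
proof -
  obtain as where as: "set as \<subseteq> carrier R - {\<zero>}" "Idl (set as) = M" using ideal_list[OF M(1)] by blast
  have "as \<noteq> []" using as M(2) genideal_empty by auto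
  moreover have "ideal_pow I (Suc 0) \<cdot> M \<subseteq> (K \<cdot> ideal_pow I 0) \<cdot> M"
    using sub ideal_pow_1[OF I(1)] ideal_prod_one[OF K] ideal_prod_commute[OF M(1)] K I
    by (simp add: ideals_one)
  ultimately obtain n where n: "ideal_pow I (Suc n) \<subseteq> K \<cdot> ideal_pow I n"
    using determinant_trick[OF K I, of as 0] as by auto
  have "K \<cdot> ideal_pow I n \<subseteq> I \<cdot> ideal_pow I n" using I by (intro ideal_prod_mono) auto
  also have "\<dots> = ideal_pow I (Suc n)"
    using ideal_prod_commute[OF I(1) ideal_pow_ideal[OF I(1)]] by (simp add: ideals_mult)
  finally show ?thesis using n K I unfolding reduction_def by blast
qed

text \<open>Let \<open>B\<close> be maximal among the ideals above \<open>A\<close> that do not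
  contain \<open>M\<close>, and \<open>x\<close> in \<open>M\<close> outside \<open>B\<close>. Then
  \<open>M \<subseteq> B + (x)\<close>, so \<open>x\<close> lies in \<open>B + m x\<close>, and
  \<open>1 - a\<close> with \<open>a\<close> in \<open>m\<close> is a unit.\<close>

lemma (in noetherian_cring) nakayama:
  assumes loc: "local_ring R m" and M: "ideal M R" and A: "ideal A R" and sub: "M \<subseteq> A <+> m \<cdot> M"
  shows "M \<subseteq> A"
proof (rule ccontr)
  assume "\<not> M \<subseteq> A"
  from ideal_maximal_exists[OF A, of "\<lambda>B. \<not> M \<subseteq> B", OF this]
  obtain B where B: "ideal B R" "A \<subseteq> B" "\<not> M \<subseteq> B" and max: "\<forall>C. ideal C R \<longrightarrow> B \<subset> C \<longrightarrow> M \<subseteq> C"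
    by auto
  have m: "ideal m R" using local_prime[OF loc] primeideal_ideal by blast
  obtain x where x: "x \<in> M" "x \<notin> B" using B by blast
  have xR: "x \<in> carrier R" using ideal.Icarr[OF M x(1)] .
  have C: "ideal (B <+> PIdl x) R" using adjoin_ideal[OF B(1) xR] .
  have MC: "M \<subseteq> B <+> PIdl x"
    using max[rule_format, OF C] adjoin_upper[OF B(1) xR] adjoin_mem[OF B(1) xR] x by blast
  have D: "ideal {b \<oplus> a \<otimes> x | b a. b \<in> B \<and> a \<in> m} R" (is "ideal ?D R")
  proof (rule idealI')
    note BR = ideal.Icarr[OF B(1)] and mR = ideal.Icarr[OF m]
    show "?D \<subseteq> carrier R" using BR mR xR by auto
    show "\<zero> \<in> ?D" using ideal_zero_mem[OF B(1)] ideal_zero_mem[OF m] xR by force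
    show "y \<oplus> z \<in> ?D" if yz: "y \<in> ?D" "z \<in> ?D" for y z
    proof -
      obtain b a b' a' where e: "b \<in> B" "a \<in> m" "y = b \<oplus> a \<otimes> x" "b' \<in> B" "a' \<in> m" "z = b' \<oplus> a' \<otimes> x"
        using yz by blast
      have c: "b \<in> carrier R" "b' \<in> carrier R" "a \<in> carrier R" "a' \<in> carrier R" using e BR mR by auto
      have "y \<oplus> z = (b \<oplus> b') \<oplus> (a \<oplus> a') \<otimes> x" unfolding e(3,6) using c xR by algebra
      thus ?thesis using e ideal_add_mem[OF B(1)] ideal_add_mem[OF m] by blast
    qed
    show "r \<otimes> y \<in> ?D" if yr: "y \<in> ?D" "r \<in> carrier R" for y r
    proof -
      obtain b a where e: "b \<in> B" "a \<in> m" "y = b \<oplus> a \<otimes> x" using yr by blast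
      have c: "b \<in> carrier R" "a \<in> carrier R" using e BR mR by auto
      have "r \<otimes> y = r \<otimes> b \<oplus> (r \<otimes> a) \<otimes> x" unfolding e(3) using c xR yr(2) by algebra
      thus ?thesis using e yr(2) ideal_mult_mem[OF B(1)] ideal_mult_mem[OF m] by blast
    qed
  qed
  have BD: "B \<subseteq> ?D"
  proof
    fix b assume b: "b \<in> B"
    hence "b = b \<oplus> \<zero> \<otimes> x" using ideal.Icarr[OF B(1)] xR by simp
    thus "b \<in> ?D" using b ideal_zero_mem[OF m] by blast
  qed
  have "m \<cdot> M \<subseteq> ?D"
  proof (rule ideal_prod_least[OF D])
    fix a y assume a: "a \<in> m" and y: "y \<in> M"
    then obtain b r where e: "b \<in> B" "r \<in> carrier R" "y = b \<oplus> r \<otimes> x" using subsetD[OF MC y] unfolding mem_adjoin by blast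
    have c: "a \<in> carrier R" "b \<in> carrier R" using ideal.Icarr[OF m a] ideal.Icarr[OF B(1) e(1)] by auto
    have "a \<otimes> y = a \<otimes> b \<oplus> (a \<otimes> r) \<otimes> x" unfolding e(3) using c e(2) xR by algebra
    moreover have "a \<otimes> b \<in> B" using ideal_mult_mem[OF B(1) e(1) c(1)] .
    moreover have "a \<otimes> r \<in> m" using ideal_mult_mem'[OF m a e(2)] .
    ultimately show "a \<otimes> y \<in> ?D" by blast
  qed
  hence "A <+> m \<cdot> M \<subseteq> ?D" using set_add_least[OF D] B(2) BD by blast
  then obtain b a where e: "b \<in> B" "a \<in> m" "x = b \<oplus> a \<otimes> x" using x sub by blast
  have c: "a \<in> carrier R" "b \<in> carrier R" using ideal.Icarr[OF m e(2)] ideal.Icarr[OF B(1) e(1)] by auto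
  have "(\<one> \<ominus> a) \<otimes> x = (b \<oplus> a \<otimes> x) \<ominus> a \<otimes> x" using c xR e(3) by algebra
  also have "\<dots> = b" using c xR by algebra
  finally have bx: "(\<one> \<ominus> a) \<otimes> x = b" .
  have u: "\<one> \<ominus> a \<in> Units R" using local_one_minus_unit[OF loc e(2)] .
  have "inv (\<one> \<ominus> a) \<otimes> b = inv (\<one> \<ominus> a) \<otimes> (\<one> \<ominus> a) \<otimes> x"
    using m_assoc[OF Units_inv_closed[OF u] Units_closed[OF u] xR] bx by simp
  hence "x = inv (\<one> \<ominus> a) \<otimes> b" using u xR by simp
  thus False using ideal_mult_mem[OF B(1) e(1)] u x by auto
qed

subsection \<open>Tight closure when the test ideal is the maximal ideal\<close>

text \<open>The Gorenstein hypothesis is present through \<open>sop_regular\<close> and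
  \<open>sop_socle\<close>, the test ideal through \<open>test\<close>.\<close>

locale test_ideal_maximal = noetherian_cring_domain R for R :: "('a, 'r) ring_scheme" (structure) +
  fixes m :: "'a set" and p :: nat
  assumes local: "local_ring R m"
    and p_prime: "Factorial_Ring.prime p" and char_p: "[p] \<cdot> \<one> = \<zero>"
    and m_nonzero: "m \<noteq> {\<zero>}"
    and test: "ideal L R \<Longrightarrow> z \<in> tight_closure R p L \<Longrightarrow> c \<in> m \<Longrightarrow> c \<otimes> z \<in> L"
    and sop_regular: "sop R m (ws @ [w]) \<Longrightarrow> r \<in> carrier R \<Longrightarrow> r \<otimes> w \<in> Idl (set ws) \<Longrightarrow> r \<in> Idl (set ws)"
    and sop_socle: "sop R m xs \<Longrightarrow> u \<in> carrier R \<Longrightarrow> u \<notin> Idl (set xs) \<Longrightarrow>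
      (\<And>y. y \<in> m \<Longrightarrow> y \<otimes> u \<in> Idl (set xs)) \<Longrightarrow> u' \<in> carrier R \<Longrightarrow>
      (\<And>y. y \<in> m \<Longrightarrow> y \<otimes> u' \<in> Idl (set xs)) \<Longrightarrow> \<exists>r\<in>carrier R. u' \<ominus> r \<otimes> u \<in> Idl (set xs)"
begin

abbreviation Fr :: "nat \<Rightarrow> 'a set \<Rightarrow> 'a set"
  where "Fr e L \<equiv> frobenius_power R (p ^ e) L"

abbreviation tc :: "'a set \<Rightarrow> 'a set"
  where "tc L \<equiv> tight_closure R p L"

lemma m_prime: "primeideal m R"
  using local by (rule local_prime)

lemma m_ideal: "ideal m R"
  using m_prime by (rule primeideal_ideal)

lemma m_carrier: "x \<in> m \<Longrightarrow> x \<in> carrier R"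
  using ideal.Icarr[OF m_ideal] .

lemma p_ge_2: "p \<ge> 2"
  using p_prime by (rule prime_ge_2_nat)

lemma pe_pos: "p ^ e > 0"
  using p_ge_2 by simp

lemma pe_ge: "e \<le> p ^ e"
  using power_gt_expt[of p e] p_ge_2 by simp

lemma frob_mult: "x \<in> carrier R \<Longrightarrow> y \<in> carrier R \<Longrightarrow> (x \<otimes> y) [^] (n::nat) = x [^] n \<otimes> y [^] n"
  by (rule nat_pow_distrib)

lemma frob_add: "x \<in> carrier R \<Longrightarrow> y \<in> carrier R \<Longrightarrow> (x \<oplus> y) [^] (p ^ e) = x [^] (p ^ e) \<oplus> y [^] (p ^ e)"
proof (induction e)
  case (Suc e)
  have eq: "z [^] (p ^ Suc e) = (z [^] (p ^ e)) [^] p" if "z \<in> carrier R" for z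
    using nat_pow_pow[OF that, of "p ^ e" p] by (simp add: mult.commute)
  show ?case using Suc frobenius_prime[OF p_prime char_p, of "x [^] (p ^ e)" "y [^] (p ^ e)"]
    by (simp only: eq a_closed nat_pow_closed)
qed simp

lemma frob_zero: "\<zero> [^] (p ^ e) = \<zero>"
  using pe_pos[of e] nat_pow_zero by auto

text \<open>Raising to the power \<open>p^e\<close> is a ring endomorphism. With this, an inclusion
  between powers of elements of ideals has to be checked only on generators.\<close>

lemma frob_preimage_ideal: "ideal T R \<Longrightarrow> ideal {x \<in> carrier R. x [^] (p ^ e) \<in> T} R"
  by (rule idealI') (auto simp: frob_zero frob_add frob_mult ideal_zero_mem ideal_add_mem ideal_mult_mem)

lemma Fr_ideal: "L \<subseteq> carrier R \<Longrightarrow> ideal (Fr e L) R"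
  unfolding frobenius_power_def by (intro genideal_ideal) auto

lemma Fr_mem: "L \<subseteq> carrier R \<Longrightarrow> x \<in> L \<Longrightarrow> x [^] (p ^ e) \<in> Fr e L"
  unfolding frobenius_power_def by (rule subsetD[OF genideal_self]) auto

lemma Fr_least: "ideal T R \<Longrightarrow> (\<And>x. x \<in> L \<Longrightarrow> x [^] (p ^ e) \<in> T) \<Longrightarrow> Fr e L \<subseteq> T"
  unfolding frobenius_power_def by (rule genideal_minimal) auto

lemma Fr_mono: "L' \<subseteq> carrier R \<Longrightarrow> L \<subseteq> L' \<Longrightarrow> Fr e L \<subseteq> Fr e L'"
  by (rule Fr_least[OF Fr_ideal]) (auto intro: Fr_mem)

lemma Fr_genideal:
  assumes "S \<subseteq> carrier R"
  shows "Fr e (Idl S) = Idl ((\<lambda>x. x [^] (p ^ e)) ` S)"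
proof
  let ?T = "Idl ((\<lambda>x. x [^] (p ^ e)) ` S)"
  have im: "(\<lambda>x. x [^] (p ^ e)) ` S \<subseteq> carrier R" using assms by auto
  have T: "ideal ?T R" using genideal_ideal[OF im] .
  have SR: "Idl S \<subseteq> carrier R" using ideal_carrier[OF genideal_ideal[OF assms]] .
  have "Idl S \<subseteq> {x \<in> carrier R. x [^] (p ^ e) \<in> ?T}"
    using assms genideal_self[OF im] by (intro genideal_minimal frob_preimage_ideal T) auto
  thus "Fr e (Idl S) \<subseteq> ?T" by (intro Fr_least T) auto
  show "?T \<subseteq> Fr e (Idl S)"
    using genideal_self[OF assms] by (intro genideal_minimal Fr_ideal SR) (auto intro!: Fr_mem SR)
qed

lemma Fr_genideal_insert:
  assumes "S \<subseteq> carrier R" "y \<in> carrier R"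
  shows "Fr e (Idl (insert y S)) = Idl ((\<lambda>x. x [^] (p ^ e)) ` S) <+> PIdl (y [^] (p ^ e))"
  using assms by (subst Fr_genideal) (auto intro!: genideal_insert)

lemma off_minimal_primes_eq: "off_minimal_primes R = carrier R - {\<zero>}"
proof -
  have "minimal_prime R P \<longleftrightarrow> P = {\<zero>}" for P
    using zeroprimeideal ideal_zero_mem[OF primeideal_ideal] unfolding minimal_prime_def Spec_def by auto
  thus ?thesis unfolding off_minimal_primes_def by auto
qed

lemma tc_iff_multiplier: "z \<in> tc L \<longleftrightarrow> z \<in> carrier R \<and>
    (\<exists>c\<in>carrier R - {\<zero>}. \<exists>N. \<forall>e\<ge>N. c \<otimes> z [^] (p ^ e) \<in> Fr e L)"
  unfolding tight_closure_def off_minimal_primes_eq by blast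

text \<open>If \<open>z\<close> is in the tight closure of \<open>L\<close>, then \<open>z^q\<close> is in that of \<open>L^[q]\<close>, and \<open>m\<close> multiplies
  the latter into \<open>L^[q]\<close>.\<close>

lemma tc_multiplier:
  assumes L: "ideal L R" and z: "z \<in> tc L" and c: "c \<in> m"
  shows "c \<otimes> z [^] (p ^ e) \<in> Fr e L"
proof -
  have LR: "L \<subseteq> carrier R" using ideal_carrier[OF L] .
  obtain c0 N where zR: "z \<in> carrier R" and c0: "c0 \<in> carrier R - {\<zero>}"
    "\<And>e. e \<ge> N \<Longrightarrow> c0 \<otimes> z [^] (p ^ e) \<in> Fr e L" using z unfolding tc_iff_multiplier by blast
  have FL: "ideal (Fr e L) R" "Fr e L \<subseteq> carrier R" using Fr_ideal[OF LR] ideal_carrier by auto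
  have "c0 \<otimes> (z [^] (p ^ e)) [^] (p ^ k) \<in> Fr k (Fr e L)" if "k \<ge> N" for k
  proof -
    have pp: "(x [^] (p ^ e)) [^] (p ^ k) = x [^] (p ^ (e + k))" if "x \<in> carrier R" for x
      using nat_pow_pow[OF that] by (simp add: power_add)
    have "Fr (e + k) L \<subseteq> Fr k (Fr e L)"
    proof (rule Fr_least[OF Fr_ideal[OF FL(2)]])
      fix x assume x: "x \<in> L"
      show "x [^] (p ^ (e + k)) \<in> Fr k (Fr e L)"
        using Fr_mem[OF FL(2) Fr_mem[OF LR x, of e], of k] pp[of x] x LR by auto
    qed
    thus ?thesis using c0(2)[of "e + k"] that pp[OF zR] by auto
  qed
  hence "z [^] (p ^ e) \<in> tc (Fr e L)" unfolding tc_iff_multiplier using zR c0 by auto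
  thus ?thesis using test[OF FL(1) _ c] by blast
qed

lemma nonzero_multiplier: "\<exists>c\<in>m. c \<noteq> \<zero>"
  using m_nonzero ideal_zero_mem[OF m_ideal] by blast

text \<open>The multiplier may be any element of \<open>m\<close> and the exponent may be arbitrary,
  so elements of a tight closure share their multipliers.\<close>

lemma tc_iff:
  "ideal L R \<Longrightarrow> z \<in> tc L \<longleftrightarrow> z \<in> carrier R \<and> (\<forall>c\<in>m. \<forall>e. c \<otimes> z [^] (p ^ e) \<in> Fr e L)"
  using tc_multiplier[of L z] nonzero_multiplier m_carrier unfolding tc_iff_multiplier by blast

lemma tc_ideal: assumes L: "ideal L R" shows "ideal (tc L) R"
proof (rule idealI')
  have LR: "L \<subseteq> carrier R" using ideal_carrier[OF L] .
  note F = Fr_ideal[OF LR]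
  show "tc L \<subseteq> carrier R" using tc_iff[OF L] by blast
  show "\<zero> \<in> tc L" unfolding tc_iff[OF L] using F by (auto simp: frob_zero m_carrier ideal_zero_mem)
  show "x \<oplus> y \<in> tc L" if "x \<in> tc L" "y \<in> tc L" for x y
    using that F unfolding tc_iff[OF L] by (auto simp: frob_add r_distr m_carrier ideal_add_mem)
  show "r \<otimes> x \<in> tc L" if rx: "x \<in> tc L" "r \<in> carrier R" for x r
  proof -
    have "c \<otimes> (r \<otimes> x) [^] (p ^ e) = r [^] (p ^ e) \<otimes> (c \<otimes> x [^] (p ^ e))" if "c \<in> m" for c e
      using rx m_carrier[OF that] unfolding tc_iff[OF L] by (simp add: frob_mult m_lcomm)
    thus ?thesis using rx F unfolding tc_iff[OF L] by (auto intro: ideal_mult_mem)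
  qed
qed

lemma tc_upper: assumes L: "ideal L R" shows "L \<subseteq> tc L"
proof
  fix x assume x: "x \<in> L"
  have LR: "L \<subseteq> carrier R" using ideal_carrier[OF L] .
  show "x \<in> tc L" unfolding tc_iff[OF L] using x LR Fr_mem[OF LR x] Fr_ideal[OF LR] m_carrier
    by (auto intro: ideal_mult_mem)
qed

lemma tc_mono: assumes L: "ideal L R" "ideal L' R" "L \<subseteq> L'" shows "tc L \<subseteq> tc L'"
  using Fr_mono[OF ideal_carrier[OF L(2)] L(3)] unfolding tc_iff[OF L(1)] tc_iff[OF L(2)] subset_iff by blast

text \<open>One factor \<open>c\<close> leads from \<open>z^q\<close> into the Frobenius power of
  the tight closure, a second one from there into that of \<open>L\<close>.\<close>

lemma tc_idem: assumes L: "ideal L R" shows "tc (tc L) \<subseteq> tc L"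
proof
  fix z assume z: "z \<in> tc (tc L)"
  note T = tc_ideal[OF L]
  have LR: "L \<subseteq> carrier R" using ideal_carrier[OF L] .
  have zR: "z \<in> carrier R" using z unfolding tc_iff[OF T] by blast
  obtain c where c: "c \<in> m" "c \<noteq> \<zero>" using nonzero_multiplier by blast
  have cR: "c \<in> carrier R" using m_carrier c by blast
  have "(c \<otimes> c) \<otimes> z [^] (p ^ e) \<in> Fr e L" for e
  proof -
    have FL: "ideal (Fr e L) R" using Fr_ideal[OF LR] .
    have "Fr e (tc L) \<subseteq> ideal_colon R (Fr e L) {c}"
    proof (rule Fr_least[OF colon1_ideal[OF FL cR]])
      fix x assume x: "x \<in> tc L"
      hence "c \<otimes> x [^] (p ^ e) \<in> Fr e L" "x \<in> carrier R" using c unfolding tc_iff[OF L] by auto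
      thus "x [^] (p ^ e) \<in> ideal_colon R (Fr e L) {c}" using cR by (simp add: mem_colon1 m_comm)
    qed
    moreover have "c \<otimes> z [^] (p ^ e) \<in> Fr e (tc L)" using z c unfolding tc_iff[OF T] by blast
    ultimately have "(c \<otimes> z [^] (p ^ e)) \<otimes> c \<in> Fr e L" unfolding mem_colon1 subset_iff by blast
    thus ?thesis using cR zR by (simp add: m_ac)
  qed
  moreover have "c \<otimes> c \<in> carrier R - {\<zero>}" using c cR integral_iff[of c c] by auto
  ultimately show "z \<in> tc L" unfolding tc_iff_multiplier using zR by blast
qed

lemma m_not_square: "\<not> m \<subseteq> m \<cdot> m"
proof
  assume "m \<subseteq> m \<cdot> m"
  also have "\<dots> \<subseteq> {\<zero>} <+> m \<cdot> m"
    using set_add_upper2[OF zeroideal ideal_prod_is_ideal[OF m_ideal m_ideal]] .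
  finally have "m \<subseteq> {\<zero>}" using nakayama[OF local m_ideal zeroideal] by blast
  thus False using nonzero_multiplier by blast
qed

lemma pow_in_m_square: "x \<in> m \<Longrightarrow> n \<ge> 2 \<Longrightarrow> x [^] (n::nat) \<in> m \<cdot> m"
proof -
  assume x: "x \<in> m" and n: "n \<ge> 2"
  have "x [^] (2::nat) \<in> m \<cdot> m" using ideal_prod.prod[OF x x, of R] m_carrier[OF x] by (simp add: numeral_2_eq_2)
  thus ?thesis using nat_pow_mem_mono[OF ideal_prod_is_ideal[OF m_ideal m_ideal] m_carrier[OF x] _ n] by blast
qed

text \<open>A unit \<open>z\<close> in the tight closure would put every \<open>c\<close> in
  \<open>m\<close> into \<open>L^[p]\<close>, hence into \<open>m^2\<close>.\<close>

lemma tc_proper: assumes L: "ideal L R" "L \<subseteq> m" shows "tc L \<subseteq> m"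
proof
  fix z assume z: "z \<in> tc L"
  have zR: "z \<in> carrier R" using z unfolding tc_iff[OF L(1)] by blast
  show "z \<in> m"
  proof (rule ccontr)
    assume "z \<notin> m"
    hence "z [^] p \<in> carrier R - m" using prime_pow[OF m_prime zR, of p] zR by auto
    hence u: "z [^] p \<in> Units R" using local_unit[OF local] by blast
    have mm: "ideal (m \<cdot> m) R" using ideal_prod_is_ideal[OF m_ideal m_ideal] .
    have "m \<subseteq> m \<cdot> m"
    proof
      fix c assume c: "c \<in> m"
      have "c \<otimes> z [^] (p ^ 1) \<in> Fr 1 L" using tc_multiplier[OF L(1) z c] .
      also have "\<dots> \<subseteq> m \<cdot> m" using L(2) p_ge_2 by (intro Fr_least mm) (auto intro!: pow_in_m_square)
      finally have "c \<otimes> z [^] p \<in> m \<cdot> m" by simp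
      from ideal_mult_mem'[OF mm this Units_inv_closed[OF u]]
      have "(c \<otimes> z [^] p) \<otimes> inv (z [^] p) \<in> m \<cdot> m" .
      thus "c \<in> m \<cdot> m" using u m_carrier[OF c] zR by (simp add: m_assoc)
    qed
    thus False using m_not_square by blast
  qed
qed

section \<open>Radicals and changes of parameters\<close>

lemma radical_iff:
  assumes A: "ideal A R"
  shows "x \<in> radical R A \<longleftrightarrow> x \<in> carrier R \<and> (\<exists>e. x [^] (p ^ e) \<in> A)"
  unfolding radical_def using nat_pow_mem_mono[OF A _ _ pe_ge] by blast

lemma radical_ideal: assumes A: "ideal A R" shows "ideal (radical R A) R"
proof (rule idealI')
  show "radical R A \<subseteq> carrier R" unfolding radical_def by blast
  show "\<zero> \<in> radical R A" unfolding radical_iff[OF A] using frob_zero ideal_zero_mem[OF A] by auto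
  show "x \<oplus> y \<in> radical R A" if xy: "x \<in> radical R A" "y \<in> radical R A" for x y
  proof -
    obtain e f where e: "x \<in> carrier R" "y \<in> carrier R" "x [^] (p ^ e) \<in> A" "y [^] (p ^ f) \<in> A"
      using xy unfolding radical_iff[OF A] by blast
    have "p ^ e \<le> p ^ max e f" "p ^ f \<le> p ^ max e f" using p_ge_2 by (auto intro!: power_increasing)
    hence "(x \<oplus> y) [^] (p ^ max e f) \<in> A"
      using nat_pow_mem_mono[OF A] e by (auto simp: frob_add intro!: ideal_add_mem[OF A])
    thus ?thesis unfolding radical_iff[OF A] using e by blast
  qed
  show "r \<otimes> x \<in> radical R A" if rx: "x \<in> radical R A" "r \<in> carrier R" for x r
    using rx unfolding radical_iff[OF A] by (auto simp: frob_mult intro!: ideal_mult_mem[OF A])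
qed

lemma sop_m: "sop R m xs \<Longrightarrow> set xs \<subseteq> m"
  unfolding sop_def by blast

lemma sop_R: "sop R m xs \<Longrightarrow> set xs \<subseteq> carrier R"
  using sop_m ideal_carrier[OF m_ideal] by blast

text \<open>Equal length and the same radical suffice, and the radical need only be tested on the
  old parameters.\<close>

lemma sop_radical:
  assumes sop: "sop R m xs" and len: "length ys = length xs" and ys: "set ys \<subseteq> m"
    and rad: "set xs \<subseteq> radical R (Idl (set ys))"
  shows "sop R m ys"
proof -
  have Y: "ideal (Idl (set ys)) R" using ys ideal_carrier[OF m_ideal] by (intro genideal_ideal) auto
  have "radical R (Idl (set ys)) = m"
  proof
    show "radical R (Idl (set ys)) \<subseteq> m"
      using prime_pow[OF m_prime] genideal_minimal[OF m_ideal ys] unfolding radical_def by blast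
    show "m \<subseteq> radical R (Idl (set ys))"
    proof
      fix y assume y: "y \<in> m"
      hence "y \<in> radical R (Idl (set xs))" using sop unfolding sop_def by simp
      then obtain n :: nat where n: "y [^] n \<in> Idl (set xs)" unfolding radical_def by blast
      have "Idl (set xs) \<subseteq> radical R (Idl (set ys))" using genideal_minimal[OF radical_ideal[OF Y] rad] .
      then obtain k :: nat where "(y [^] n) [^] k \<in> Idl (set ys)" using n unfolding radical_def by blast
      thus "y \<in> radical R (Idl (set ys))" unfolding radical_def
        using nat_pow_pow[OF m_carrier[OF y], of n k] m_carrier[OF y] by auto
    qed
  qed
  thus ?thesis using sop len ys unfolding sop_def by simp
qed

lemma radical_upper: "ideal A R \<Longrightarrow> A \<subseteq> radical R A"
  unfolding radical_def using ideal.Icarr[of A R] by (auto intro!: exI[of _ 1])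

lemma sop_cong:
  assumes "sop R m xs" "length ys = length xs" "set ys \<subseteq> carrier R" "Idl (set ys) = Idl (set xs)"
  shows "sop R m ys"
proof (rule sop_radical[OF assms(1,2)])
  have "set xs \<subseteq> Idl (set ys)" using genideal_self[OF sop_R[OF assms(1)]] assms(4) by simp
  thus "set xs \<subseteq> radical R (Idl (set ys))" using radical_upper[OF genideal_ideal[OF assms(3)]] by blast
  have "Idl (set xs) \<subseteq> m" using genideal_minimal[OF m_ideal sop_m[OF assms(1)]] .
  thus "set ys \<subseteq> m" using genideal_self[OF assms(3)] assms(4) by simp
qed

lemma sop_set: "sop R m xs \<Longrightarrow> length ys = length xs \<Longrightarrow> set ys = set xs \<Longrightarrow> sop R m ys"
  using sop_cong sop_R by metis

lemma sop_frob: "sop R m xs \<Longrightarrow> sop R m (map (\<lambda>x. x [^] (p ^ e)) xs)"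
proof (rule sop_radical)
  assume s: "sop R m xs"
  show "set (map (\<lambda>x. x [^] (p ^ e)) xs) \<subseteq> m"
    using sop_m[OF s] pe_pos[of e] by (auto intro!: nat_pow_mem[OF m_ideal])
  have c: "set (map (\<lambda>x. x [^] (p ^ e)) xs) \<subseteq> carrier R" using sop_R[OF s] by auto
  show "set xs \<subseteq> radical R (Idl (set (map (\<lambda>x. x [^] (p ^ e)) xs)))"
    using sop_R[OF s] genideal_self[OF c] unfolding radical_def by fastforce
qed auto

text \<open>A permuted system of parameters is one again, so any of its elements may be taken as the
  last.\<close>

lemma sop_head_regular:
  assumes "sop R m (w # ws)" "r \<in> carrier R" "r \<otimes> w \<in> Idl (set ws)"
  shows "r \<in> Idl (set ws)"
  using sop_regular[of ws w r] sop_set[OF assms(1), of "ws @ [w]"] assms by simp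

lemma sop_pow_regular:
  assumes "sop R m (w # ws)"
  shows "r \<in> carrier R \<Longrightarrow> r \<otimes> w [^] (n::nat) \<in> Idl (set ws) \<Longrightarrow> r \<in> Idl (set ws)"
proof (induction n)
  case (Suc n)
  have w: "w \<in> carrier R" using sop_R[OF assms] by simp
  have "(r \<otimes> w [^] n) \<otimes> w \<in> Idl (set ws)" using Suc.prems w by (simp add: m_assoc)
  hence "r \<otimes> w [^] n \<in> Idl (set ws)" using sop_head_regular[OF assms] Suc.prems w by simp
  thus ?case using Suc by blast
qed simp

text \<open>The \<open>p^e\<close>-th powers of parameters again form a system of
  parameters.\<close>

lemma sop_frob_regular:
  assumes "sop R m (w # ws)" "r \<in> carrier R"
    "r \<otimes> (w [^] (p ^ e)) [^] (n::nat) \<in> Idl ((\<lambda>x. x [^] (p ^ e)) ` set ws)"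
  shows "r \<in> Idl ((\<lambda>x. x [^] (p ^ e)) ` set ws)"
  using sop_pow_regular[of "w [^] (p ^ e)" "map (\<lambda>x. x [^] (p ^ e)) ws" r n] sop_frob[OF assms(1), of e] assms
  by simp

lemma unit_mult_cancel: "ideal A R \<Longrightarrow> u \<in> Units R \<Longrightarrow> x \<in> carrier R \<Longrightarrow> u \<otimes> x \<in> A \<Longrightarrow> x \<in> A"
  using ideal_mult_mem[of A "u \<otimes> x" "inv u"] by (simp add: m_assoc[symmetric] Units_closed)

text \<open>Modulo \<open>ws\<close> let \<open>w1^N = a y\<close> and \<open>w2^N = b y\<close>.
  Then \<open>a w2^N = b w1^N\<close>, so \<open>a\<close> is a multiple \<open>a' w1^N\<close> by
  regularity, and \<open>(1 - a' y) w1^N = 0\<close> with a unit in front. This makes a power of the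
  parameter \<open>w1\<close> zero.\<close>

lemma sop_two_powers:
  assumes sop: "sop R m (w1 # w2 # ws)" and y: "y \<in> m" and N: "N > (0::nat)"
    and w1: "w1 [^] N \<in> Idl (set ws) <+> PIdl y" and w2: "w2 [^] N \<in> Idl (set ws) <+> PIdl y"
  shows False
proof -
  let ?A = "Idl (set ws)"
  have R: "w1 \<in> carrier R" "w2 \<in> carrier R" "set ws \<subseteq> carrier R" "y \<in> carrier R"
    using sop_R[OF sop] m_carrier[OF y] by auto
  have A: "ideal ?A R" using genideal_ideal[OF R(3)] .
  obtain x1 a where a: "x1 \<in> ?A" "a \<in> carrier R" "w1 [^] N = x1 \<oplus> a \<otimes> y" using w1 unfolding mem_adjoin by blast
  obtain x2 b where b: "x2 \<in> ?A" "b \<in> carrier R" "w2 [^] N = x2 \<oplus> b \<otimes> y" using w2 unfolding mem_adjoin by blast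
  have x: "x1 \<in> carrier R" "x2 \<in> carrier R" using ideal.Icarr[OF A] a b by auto
  \<comment> \<open>The parameter \<open>w1\<close> is replaced by its power and \<open>w2\<close>
    put in front, in order to cancel \<open>w2^N\<close> modulo \<open>ws\<close> and
    \<open>w1^N\<close>.\<close>
  have sop': "sop R m (w2 # w1 [^] N # ws)"
  proof (rule sop_radical[OF sop])
    show "set (w2 # w1 [^] N # ws) \<subseteq> m" using sop_m[OF sop] N by (auto intro!: nat_pow_mem[OF m_ideal])
    have c: "set (w2 # w1 [^] N # ws) \<subseteq> carrier R" using R by auto
    have g: "set (w2 # w1 [^] N # ws) \<subseteq> Idl (set (w2 # w1 [^] N # ws))" using genideal_self[OF c] .
    have "w1 \<in> radical R (Idl (set (w2 # w1 [^] N # ws)))" using g R unfolding radical_def by auto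
    thus "set (w1 # w2 # ws) \<subseteq> radical R (Idl (set (w2 # w1 [^] N # ws)))"
      using g radical_upper[OF genideal_ideal[OF c]] by auto
  qed simp
  have gen: "Idl (set (w1 [^] N # ws)) = ?A <+> PIdl (w1 [^] N)" using genideal_insert[of "w1 [^] N" "set ws"] R by simp
  have "a \<otimes> w2 [^] N = (a \<otimes> x2 \<ominus> b \<otimes> x1) \<oplus> b \<otimes> (x1 \<oplus> a \<otimes> y)"
    unfolding b(3) using a(2) b(2) x R(4) by algebra
  also have "x1 \<oplus> a \<otimes> y = w1 [^] N" using a by simp
  finally have e: "a \<otimes> w2 [^] N = (a \<otimes> x2 \<ominus> b \<otimes> x1) \<oplus> b \<otimes> w1 [^] N" .
  have "a \<otimes> x2 \<ominus> b \<otimes> x1 \<in> ?A" 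
    by (rule ideal_minus_mem[OF A ideal_mult_mem[OF A b(1) a(2)] ideal_mult_mem[OF A a(1) b(2)]])
  hence "a \<otimes> w2 [^] N \<in> Idl (set (w1 [^] N # ws))" unfolding gen mem_adjoin using e b by blast
  hence "a \<in> Idl (set (w1 [^] N # ws))" using sop_pow_regular[OF sop' a(2)] by blast
  then obtain x3 a' where a': "x3 \<in> ?A" "a' \<in> carrier R" "a = x3 \<oplus> a' \<otimes> w1 [^] N" unfolding gen mem_adjoin by blast
  have x3: "x3 \<in> carrier R" using ideal.Icarr[OF A a'(1)] .
  define W where "W = w1 [^] N"
  have W: "W \<in> carrier R" unfolding W_def using R by simp
  have eqW: "W = x1 \<oplus> (x3 \<oplus> a' \<otimes> W) \<otimes> y" unfolding W_def a'(3)[symmetric] by (rule a(3))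
  have ay: "a' \<otimes> y \<in> carrier R" using a'(2) R(4) by simp
  have "(\<one> \<ominus> a' \<otimes> y) \<otimes> W = W \<ominus> a' \<otimes> y \<otimes> W"
    using W ay by (simp add: a_minus_def l_distr l_minus)
  also have "\<dots> = (x1 \<oplus> (x3 \<oplus> a' \<otimes> W) \<otimes> y) \<ominus> a' \<otimes> y \<otimes> W"
    by (rule arg_cong[OF eqW, of "\<lambda>z. z \<ominus> a' \<otimes> y \<otimes> W"])
  also have "\<dots> = x1 \<oplus> x3 \<otimes> y" using x x3 W a'(2) R(4) by algebra
  also have "\<dots> \<in> ?A" by (rule ideal_add_mem[OF A a(1) ideal_mult_mem'[OF A a'(1) R(4)]])
  finally have "W \<in> ?A"
    using unit_mult_cancel[OF A local_one_minus_unit[OF local] _] W ideal_mult_mem[OF m_ideal y a'(2)] by blast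
  \<comment> \<open>With the coefficient 1, cancelling \<open>w1^N\<close> puts 1 into the ideal of
    the other parameters.\<close>
  hence "\<one> \<otimes> w1 [^] N \<in> ?A" using W unfolding W_def by simp
  moreover have "?A \<subseteq> Idl (set (w2 # ws))" using R by (intro subset_Idl_subset) auto
  ultimately have "\<one> \<in> Idl (set (w2 # ws))" using sop_pow_regular[OF sop one_closed] by auto
  moreover have "Idl (set (w2 # ws)) \<subseteq> m" using sop_m[OF sop] by (intro genideal_minimal[OF m_ideal]) auto
  ultimately show False using prime_one[OF m_prime] by blast
qed

end

section \<open>Exchange of generators\<close>

context test_ideal_maximal
begin

lemma genideal_eq:
  assumes "S \<subseteq> carrier R" "T \<subseteq> carrier R" "S \<subseteq> Idl T" "T \<subseteq> Idl S"
  shows "Idl S = Idl T"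
  using assms by (intro equalityI genideal_minimal genideal_ideal)

lemma mprod_ideal: "ideal A R \<Longrightarrow> ideal (m \<cdot> A) R"
  using ideal_prod_is_ideal[OF m_ideal] .

text \<open>Steinitz exchange over the residue field: modulo \<open>ys\<close>, some coefficient of
  \<open>l\<close> with respect to \<open>zs\<close> is a unit, and \<open>l\<close> replaces that
  generator while \<open>ys\<close> is kept.\<close>

lemma exchange_one:
  assumes ys: "set ys \<subseteq> carrier R"
  shows "set zs \<subseteq> carrier R \<Longrightarrow> l \<in> Idl (set ys) <+> Idl (set zs) \<Longrightarrow>
    l \<notin> Idl (set ys) <+> m \<cdot> (Idl (set zs)) \<Longrightarrow>
    \<exists>us v vs. zs = us @ v # vs \<and> Idl (set (l # ys @ us @ vs)) = Idl (set (ys @ zs))"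
proof (induction zs arbitrary: l)
  case Nil
  thus ?case using ideal_prod_zero[OF m_ideal] by (simp add: genideal_empty)
next
  case (Cons v zs)
  let ?A = "Idl (set ys)" and ?B = "Idl (set zs)" and ?B' = "Idl (set (v # zs))"
  have v: "v \<in> carrier R" and zs: "set zs \<subseteq> carrier R" using Cons.prems by auto
  have A: "ideal ?A R" and B: "ideal ?B R" and B': "ideal ?B' R"
    using genideal_ideal ys Cons.prems zs by auto
  have B'eq: "?B' = ?B <+> PIdl v" using genideal_insert[OF v zs] by simp
  obtain \<alpha> \<beta> where ab: "\<alpha> \<in> ?A" "\<beta> \<in> ?B'" "l = \<alpha> \<oplus> \<beta>" using Cons.prems(2) unfolding mem_set_add by blast
  obtain \<beta>' b where b: "\<beta>' \<in> ?B" "b \<in> carrier R" "\<beta> = \<beta>' \<oplus> b \<otimes> v" using ab(2) unfolding B'eq mem_adjoin by blast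
  have c: "\<alpha> \<in> carrier R" "\<beta>' \<in> carrier R" using ideal.Icarr[OF A ab(1)] ideal.Icarr[OF B b(1)] by auto
  \<comment> \<open>The part of \<open>l\<close> without \<open>v\<close>. If the coefficient of
    \<open>v\<close> lies in \<open>m\<close>, this part still satisfies the hypotheses for the
    remaining generators.\<close>
  define \<gamma> where "\<gamma> = \<alpha> \<oplus> \<beta>'"
  have \<gamma>R: "\<gamma> \<in> carrier R" unfolding \<gamma>_def using c by simp
  have l: "l = \<gamma> \<oplus> b \<otimes> v" unfolding ab(3) b(3) \<gamma>_def using c b(2) v by algebra
  have lR: "l \<in> carrier R" unfolding l using \<gamma>R b(2) v by simp
  have \<gamma>: "\<gamma> \<in> ?A <+> ?B" unfolding \<gamma>_def mem_set_add using ab b by blast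
  have AB: "?A <+> ?B = Idl (set (ys @ zs))" using genideal_Un[OF ys zs] by simp
  have ysv: "set (ys @ v # zs) \<subseteq> carrier R" "set (ys @ zs) \<subseteq> carrier R" using ys v zs by auto
  note G = genideal_ideal[OF ysv(1)]
  have gs: "set (ys @ v # zs) \<subseteq> Idl (set (ys @ v # zs))" using genideal_self[OF ysv(1)] .
  have "Idl (set (ys @ zs)) \<subseteq> Idl (set (ys @ v # zs))" using ysv by (intro subset_Idl_subset) auto
  hence \<gamma>2: "\<gamma> \<in> Idl (set (ys @ v # zs))" using \<gamma> AB by blast
  have l2: "l \<in> Idl (set (ys @ v # zs))" unfolding l
    using \<gamma>2 gs b(2) by (intro ideal_add_mem[OF G] ideal_mult_mem[OF G]) auto
  show ?case
  proof (cases "b \<in> m")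
    case True
    have "\<gamma> \<notin> ?A <+> m \<cdot> ?B"
    proof
      assume "\<gamma> \<in> ?A <+> m \<cdot> ?B"
      then obtain a \<mu> where a: "a \<in> ?A" "\<mu> \<in> m \<cdot> ?B" "\<gamma> = a \<oplus> \<mu>" unfolding mem_set_add by blast
      have "?B \<subseteq> ?B'" using Cons.prems(1) by (intro subset_Idl_subset) auto
      hence "\<mu> \<in> m \<cdot> ?B'" using ideal_prod_mono[of m m ?B ?B'] a by blast
      moreover have "b \<otimes> v \<in> m \<cdot> ?B'"
        using True genideal_self[OF Cons.prems(1)] by (intro ideal_prod.prod) auto
      ultimately have "\<mu> \<oplus> b \<otimes> v \<in> m \<cdot> ?B'" by (rule ideal_prod.sum)
      moreover have "l = a \<oplus> (\<mu> \<oplus> b \<otimes> v)" unfolding l a(3)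
        using ideal.Icarr[OF A a(1)] ideal.Icarr[OF mprod_ideal[OF B] a(2)] b(2) v by (simp add: a_assoc)
      ultimately show False using Cons.prems(3) a unfolding mem_set_add by blast
    qed
    from Cons.IH[OF zs \<gamma> this] obtain us v' vs where
      IH: "zs = us @ v' # vs" "Idl (set (\<gamma> # ys @ us @ vs)) = Idl (set (ys @ zs))" by blast
    let ?S = "set (l # ys @ (v # us) @ vs)"
    have SR: "?S \<subseteq> carrier R" using lR ysv IH(1) by auto
    note S = genideal_ideal[OF SR]
    have Ss: "?S \<subseteq> Idl ?S" using genideal_self[OF SR] .
    have "(\<gamma> \<oplus> b \<otimes> v) \<ominus> b \<otimes> v \<in> Idl ?S" unfolding l[symmetric]
      using Ss b(2) by (intro ideal_minus_mem[OF S] ideal_mult_mem[OF S]) auto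
    moreover have "(\<gamma> \<oplus> b \<otimes> v) \<ominus> b \<otimes> v = \<gamma>" using \<gamma>R b(2) v by algebra
    ultimately have "Idl (set (\<gamma> # ys @ us @ vs)) \<subseteq> Idl ?S"
      using Ss by (intro genideal_minimal[OF S]) auto
    hence yzS: "set (ys @ zs) \<subseteq> Idl ?S" using IH(2) genideal_self[OF ysv(2)] by blast
    have sub1: "?S \<subseteq> Idl (set (ys @ v # zs))"
    proof
      fix x assume "x \<in> ?S"
      hence "x = l \<or> x \<in> set (ys @ v # zs)" unfolding IH(1) by auto
      thus "x \<in> Idl (set (ys @ v # zs))" using l2 gs by blast
    qed
    have "v \<in> ?S" by simp
    hence "v \<in> Idl ?S" using Ss by blast
    hence "insert v (set (ys @ zs)) \<subseteq> Idl ?S" using yzS by (simp only: insert_subset)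
    moreover have "set (ys @ v # zs) = insert v (set (ys @ zs))" by simp
    ultimately have sub2: "set (ys @ v # zs) \<subseteq> Idl ?S" by (simp only:)
    have "Idl ?S = Idl (set (ys @ v # zs))" by (rule genideal_eq[OF SR ysv(1) sub1 sub2])
    moreover have "v # zs = (v # us) @ v' # vs" using IH(1) by simp
    ultimately show ?thesis by (intro exI[of _ "v # us"] exI[of _ v'] exI[of _ vs] conjI)
  next
    case False
    hence u: "b \<in> Units R" using local_unit[OF local] b(2) by blast
    let ?S = "set (l # ys @ zs)"
    have SR: "?S \<subseteq> carrier R" using lR ysv by auto
    note S = genideal_ideal[OF SR]
    have Ss: "?S \<subseteq> Idl ?S" using genideal_self[OF SR] .
    have "Idl (set (ys @ zs)) \<subseteq> Idl ?S" using SR by (intro subset_Idl_subset) auto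
    hence "(\<gamma> \<oplus> b \<otimes> v) \<ominus> \<gamma> \<in> Idl ?S" unfolding l[symmetric]
      using Ss subsetD[OF _ \<gamma>[unfolded AB]] by (intro ideal_minus_mem[OF S]) simp_all
    moreover have "(\<gamma> \<oplus> b \<otimes> v) \<ominus> \<gamma> = b \<otimes> v" using \<gamma>R b(2) v by algebra
    ultimately have "v \<in> Idl ?S" using unit_mult_cancel[OF S u v] by simp
    hence "Idl ?S = Idl (set (ys @ v # zs))"
      using Ss l2 gs by (intro genideal_eq SR ysv) auto
    thus ?thesis by (intro exI[of _ "[]"] exI[of _ v] exI[of _ zs] conjI) simp_all
  qed
qed

text \<open>A basis of the image of \<open>L\<close> in \<open>J/mJ\<close>, where \<open>J\<close>
  is generated by \<open>xs\<close>, is extended to a list of generators of \<open>J\<close>. Each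
  exchange moves one element of \<open>L\<close> into \<open>ys\<close> and shortens
  \<open>zs\<close>.\<close>

lemma basis_exchange:
  assumes xs: "set xs \<subseteq> carrier R" and L: "L \<subseteq> Idl (set xs)"
  shows "\<exists>ys zs. length (ys @ zs) = length xs \<and> set (ys @ zs) \<subseteq> carrier R \<and>
    Idl (set (ys @ zs)) = Idl (set xs) \<and> set ys \<subseteq> L \<and> L \<subseteq> Idl (set ys) <+> m \<cdot> (Idl (set xs))"
proof -
  let ?J = "Idl (set xs)"
  have "\<exists>ys' zs'. length (ys' @ zs') = length xs \<and> set (ys' @ zs') \<subseteq> carrier R \<and>
      Idl (set (ys' @ zs')) = ?J \<and> set ys' \<subseteq> L \<and> L \<subseteq> Idl (set ys') <+> m \<cdot> ?J"
    if "length (ys @ zs) = length xs" "set (ys @ zs) \<subseteq> carrier R" "Idl (set (ys @ zs)) = ?J" "set ys \<subseteq> L" for ys zs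
    using that
  proof (induction "length zs" arbitrary: ys zs rule: less_induct)
    case less
    show ?case
    proof (cases "L \<subseteq> Idl (set ys) <+> m \<cdot> ?J")
      case True
      thus ?thesis using less.prems by blast
    next
      case False
      then obtain l where l: "l \<in> L" "l \<notin> Idl (set ys) <+> m \<cdot> ?J" by blast
      have R: "set ys \<subseteq> carrier R" "set zs \<subseteq> carrier R" using less.prems by auto
      have un: "Idl (set ys) <+> Idl (set zs) = ?J" using genideal_Un[OF R] less.prems(3) by simp
      have "Idl (set zs) \<subseteq> ?J" unfolding less.prems(3)[symmetric]
        using less.prems(2) by (intro subset_Idl_subset) auto
      hence "Idl (set ys) <+> m \<cdot> (Idl (set zs)) \<subseteq> Idl (set ys) <+> m \<cdot> ?J"
        by (intro set_add_mono ideal_prod_mono) auto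
      hence n: "l \<notin> Idl (set ys) <+> m \<cdot> (Idl (set zs))" using l by blast
      have lJ: "l \<in> Idl (set ys) <+> Idl (set zs)" using l L un by blast
      from exchange_one[OF R(1) R(2) lJ n] obtain us v vs where
        s: "zs = us @ v # vs" "Idl (set (l # ys @ us @ vs)) = Idl (set (ys @ zs))" by blast
      have lR: "l \<in> carrier R" using l L ideal_carrier[OF genideal_ideal[OF xs]] by blast
      show ?thesis
        by (rule less.hyps[of "us @ vs" "l # ys"]) (use s l lR less.prems in auto)
    qed
  qed
  from this[of "[]" xs] show ?thesis using xs by simp
qed

text \<open>Otherwise \<open>a z\<close> is part of a system of parameters generating \<open>L = (a z) + X\<close>, and cancelling
  \<open>z^q\<close> from \<open>c z^q \<in> L^[q]\<close> puts every \<open>c \<in> m\<close> into \<open>(a^q) + X^[q]\<close>, that is, into \<open>m^2\<close>.\<close>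

lemma tc_mult_minimal:
  assumes sop: "sop R m ws" and z: "z \<in> tc (Idl (set ws))" and a: "a \<in> m"
  shows "a \<otimes> z \<in> m \<cdot> (Idl (set ws))"
proof (rule ccontr)
  assume n: "a \<otimes> z \<notin> m \<cdot> (Idl (set ws))"
  let ?L = "Idl (set ws)"
  have wsR: "set ws \<subseteq> carrier R" using sop_R[OF sop] .
  have L: "ideal ?L R" using genideal_ideal[OF wsR] .
  have zR: "z \<in> carrier R" using z unfolding tc_iff[OF L] by blast
  have aR: "a \<in> carrier R" using m_carrier[OF a] .
  have z0: "{\<zero>} <+> A = A" if "ideal A R" for A
    using ideal.Icarr[OF that] unfolding mem_set_add set_eq_iff by force
  have "a \<otimes> z \<in> ?L" using test[OF L z a] .
  \<comment> \<open>An element outside \<open>m L\<close> is a minimal generator, which is the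
    exchange with nothing to be kept.\<close>
  hence "a \<otimes> z \<in> Idl (set []) <+> ?L" by (simp add: genideal_empty z0[OF L])
  moreover have "a \<otimes> z \<notin> Idl (set []) <+> m \<cdot> ?L" using n by (simp add: genideal_empty z0[OF mprod_ideal[OF L]])
  ultimately obtain us v vs where s: "ws = us @ v # vs" "Idl (set (a \<otimes> z # us @ vs)) = ?L"
    using exchange_one[of "[]" ws "a \<otimes> z"] wsR by auto
  let ?X = "us @ vs"
  have XR: "set ?X \<subseteq> carrier R" using wsR s by auto
  have azR: "a \<otimes> z \<in> carrier R" using aR zR by simp
  have sop': "sop R m (a \<otimes> z # ?X)" using sop_cong[OF sop _ _ s(2)] s(1) XR azR by simp
  let ?Y = "Idl ((\<lambda>x. x [^] (p ^ 1)) ` set ?X)"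
  have Y: "ideal ?Y R" using XR by (intro genideal_ideal) auto
  have mm: "ideal (m \<cdot> m) R" using mprod_ideal[OF m_ideal] .
  have Ymm: "?Y \<subseteq> m \<cdot> m"
    using sop_m[OF sop'] p_ge_2 by (intro genideal_minimal[OF mm]) (auto intro!: pow_in_m_square)
  have "m \<subseteq> m \<cdot> m"
  proof
    fix c assume c: "c \<in> m"
    have cR: "c \<in> carrier R" using m_carrier[OF c] .
    have FL: "Fr 1 ?L = ?Y <+> PIdl ((a \<otimes> z) [^] (p ^ 1))"
      using Fr_genideal_insert[OF XR azR, of 1] s(2) by simp
    have "c \<otimes> z [^] (p ^ 1) \<in> Fr 1 ?L" using tc_multiplier[OF L z c] .
    then obtain x r where x: "x \<in> ?Y" "r \<in> carrier R" "c \<otimes> z [^] (p ^ 1) = x \<oplus> r \<otimes> (a \<otimes> z) [^] (p ^ 1)"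
      unfolding FL mem_adjoin by blast
    have xR: "x \<in> carrier R" using ideal.Icarr[OF Y x(1)] .
    define A where "A = a [^] (p ^ 1)"
    define W where "W = z [^] (p ^ 1)"
    have AW: "A \<in> carrier R" "W \<in> carrier R" "(a \<otimes> z) [^] (p ^ 1) = A \<otimes> W"
      unfolding A_def W_def using aR zR frob_mult by auto
    have e: "c \<otimes> W = x \<oplus> r \<otimes> (A \<otimes> W)" using x(3) AW(3) unfolding W_def by simp
    \<comment> \<open>It is \<open>(a z)^p\<close> whose regularity modulo the powers of the other
      parameters is known, so the relation for \<open>c z^p\<close> is multiplied by
      \<open>a^p\<close> before cancelling.\<close>
    have "(c \<ominus> r \<otimes> A) \<otimes> (A \<otimes> W) = A \<otimes> (c \<otimes> W \<ominus> r \<otimes> (A \<otimes> W))" using cR x(2) AW(1,2) by algebra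
    also have "c \<otimes> W \<ominus> r \<otimes> (A \<otimes> W) = x" unfolding e using xR x(2) AW(1,2) by algebra
    also have "A \<otimes> x \<in> ?Y" using ideal_mult_mem[OF Y x(1) AW(1)] .
    finally have "(c \<ominus> r \<otimes> A) \<otimes> ((a \<otimes> z) [^] (p ^ 1)) [^] (1::nat) \<in> ?Y" using AW by simp
    hence "c \<ominus> r \<otimes> A \<in> ?Y" using sop_frob_regular[OF sop', of "c \<ominus> r \<otimes> A" 1 1] cR x(2) AW(1) by simp
    moreover have "A \<in> m \<cdot> m" unfolding A_def using pow_in_m_square[OF a] p_ge_2 by simp
    ultimately have "(c \<ominus> r \<otimes> A) \<oplus> r \<otimes> A \<in> m \<cdot> m"
      using Ymm x(2) ideal_add_mem[OF mm] ideal_mult_mem[OF mm] by blast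
    moreover have "(c \<ominus> r \<otimes> A) \<oplus> r \<otimes> A = c" using cR x(2) AW(1) by algebra
    ultimately show "c \<in> m \<cdot> m" by simp
  qed
  thus False using m_not_square by blast
qed

section \<open>Subideals of the tight closure of a parameter ideal\<close>

lemma mprod_tc:
  assumes sop: "sop R m ws"
  shows "m \<cdot> (tc (Idl (set ws))) \<subseteq> m \<cdot> (Idl (set ws))"
  using tc_mult_minimal[OF sop] sop_R[OF sop] by (intro ideal_prod_least mprod_ideal genideal_ideal) auto

text \<open>The quotient of the tight closure by \<open>J\<close> is killed by \<open>m\<close>, and
  \<open>R/J\<close> has a one-dimensional socle.\<close>

lemma tc_generator:
  assumes sop: "sop R m xs"
  shows "\<exists>D\<in>tc (Idl (set xs)). \<forall>z\<in>tc (Idl (set xs)). \<exists>r\<in>carrier R. z \<ominus> r \<otimes> D \<in> Idl (set xs)"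
proof -
  let ?J = "Idl (set xs)"
  have J: "ideal ?J R" using genideal_ideal[OF sop_R[OF sop]] .
  have TR: "z \<in> carrier R" if "z \<in> tc ?J" for z using that unfolding tc_iff[OF J] by blast
  show ?thesis
  proof (cases "tc ?J \<subseteq> ?J")
    case True
    have "z \<ominus> \<zero> \<otimes> \<zero> = z" if "z \<in> carrier R" for z using that by algebra
    thus ?thesis using True TR ideal_zero_mem[OF tc_ideal[OF J]] by (metis subsetD zero_closed)
  next
    case False
    then obtain D where D: "D \<in> tc ?J" "D \<notin> ?J" by blast
    show ?thesis
    proof (intro bexI[OF _ D(1)] ballI)
      fix z assume z: "z \<in> tc ?J"
      show "\<exists>r\<in>carrier R. z \<ominus> r \<otimes> D \<in> ?J"
        using sop_socle[OF sop TR[OF D(1)] D(2) _ TR[OF z]] test[OF J] D z by blast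
    qed
  qed
qed

text \<open>The image of \<open>K\<close> in the quotient by \<open>J\<close> is at most
  one-dimensional and is spanned by \<open>y\<close>. The rest of \<open>K\<close> lies in
  \<open>J\<close>, where a basis of its image in \<open>J/mJ\<close> is extended by
  \<open>zs\<close>.\<close>

lemma ideal_decomposition:
  assumes sop: "sop R m xs" and K: "ideal K R" "K \<subseteq> tc (Idl (set xs))"
  shows "\<exists>y ys zs. y \<in> K \<and> sop R m (ys @ zs) \<and> Idl (set (ys @ zs)) = Idl (set xs) \<and> set ys \<subseteq> K \<and>
    K \<subseteq> (Idl (set ys) <+> m \<cdot> (Idl (set xs))) <+> PIdl y"
proof -
  let ?J = "Idl (set xs)"
  have J: "ideal ?J R" using genideal_ideal[OF sop_R[OF sop]] .
  note KR = ideal.Icarr[OF K(1)]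
  obtain D where D: "D \<in> tc ?J" "\<And>z. z \<in> tc ?J \<Longrightarrow> \<exists>r\<in>carrier R. z \<ominus> r \<otimes> D \<in> ?J" using tc_generator[OF sop] by blast
  have DR: "D \<in> carrier R" using D(1) unfolding tc_iff[OF J] by blast
  have "\<exists>y\<in>K. \<forall>k\<in>K. \<exists>r\<in>carrier R. k \<ominus> r \<otimes> y \<in> ?J"
  proof (cases "K \<subseteq> ?J")
    case True
    have "k \<ominus> \<zero> \<otimes> \<zero> = k" if "k \<in> carrier R" for k using that by algebra
    thus ?thesis using True KR ideal_zero_mem[OF K(1)] by (metis subsetD zero_closed)
  next
    case False
    then obtain y where y: "y \<in> K" "y \<notin> ?J" by blast
    obtain s where s: "s \<in> carrier R" "y \<ominus> s \<otimes> D \<in> ?J" using D(2) y K by blast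
    have yR: "y \<in> carrier R" using KR y by blast
    \<comment> \<open>Since \<open>m D\<close> lies in \<open>J\<close>, a coefficient in
      \<open>m\<close> would put \<open>y\<close> into \<open>J\<close>. So \<open>s\<close> is a
      unit and \<open>y\<close> can replace \<open>D\<close>.\<close>
    have "s \<notin> m"
    proof
      assume "s \<in> m"
      hence "s \<otimes> D \<in> ?J" using test[OF J D(1)] by blast
      hence "(y \<ominus> s \<otimes> D) \<oplus> s \<otimes> D \<in> ?J" using s ideal_add_mem[OF J] by blast
      moreover have "(y \<ominus> s \<otimes> D) \<oplus> s \<otimes> D = y" using yR s(1) DR by algebra
      ultimately show False using y by simp
    qed
    hence u: "s \<in> Units R" using local_unit[OF local] s by blast
    have i: "inv s \<in> carrier R" "inv s \<otimes> s = \<one>" using u by auto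
    show ?thesis
    proof (intro bexI[OF _ y(1)] ballI)
      fix k assume k: "k \<in> K"
      then obtain t where t: "t \<in> carrier R" "k \<ominus> t \<otimes> D \<in> ?J" using D(2) K by blast
      have kR: "k \<in> carrier R" using KR k by blast
      let ?r = "t \<otimes> inv s"
      have "(k \<ominus> t \<otimes> D) \<ominus> ?r \<otimes> (y \<ominus> s \<otimes> D) = (k \<ominus> ?r \<otimes> y) \<ominus> (t \<otimes> D \<ominus> t \<otimes> (inv s \<otimes> s) \<otimes> D)"
        using kR t(1) i(1) yR s(1) DR by algebra
      also have "\<dots> = k \<ominus> ?r \<otimes> y" unfolding i(2) using kR t(1) i(1) yR DR by algebra
      finally have "k \<ominus> ?r \<otimes> y \<in> ?J"
        using ideal_minus_mem[OF J t(2) ideal_mult_mem[OF J s(2), of ?r]] t(1) i(1) by simp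
      thus "\<exists>r\<in>carrier R. k \<ominus> r \<otimes> y \<in> ?J" using t(1) i(1) by blast
    qed
  qed
  then obtain y where y: "y \<in> K" "\<And>k. k \<in> K \<Longrightarrow> \<exists>r\<in>carrier R. k \<ominus> r \<otimes> y \<in> ?J" by blast
  have yR: "y \<in> carrier R" using KR y by blast
  obtain ys zs where yz: "length (ys @ zs) = length xs" "set (ys @ zs) \<subseteq> carrier R"
    "Idl (set (ys @ zs)) = ?J" "set ys \<subseteq> K \<inter> ?J" "K \<inter> ?J \<subseteq> Idl (set ys) <+> m \<cdot> ?J"
    using basis_exchange[OF sop_R[OF sop], of "K \<inter> ?J"] by auto
  have "K \<subseteq> (Idl (set ys) <+> m \<cdot> ?J) <+> PIdl y"
  proof
    fix k assume k: "k \<in> K"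
    obtain r where r: "r \<in> carrier R" "k \<ominus> r \<otimes> y \<in> ?J" using y(2)[OF k] by blast
    have "k \<ominus> r \<otimes> y \<in> K" using ideal_minus_mem[OF K(1) k ideal_mult_mem[OF K(1) y(1) r(1)]] .
    hence "k \<ominus> r \<otimes> y \<in> Idl (set ys) <+> m \<cdot> ?J" using r yz(5) by blast
    moreover have "k = (k \<ominus> r \<otimes> y) \<oplus> r \<otimes> y" using KR[OF k] r(1) yR by algebra
    ultimately show "k \<in> (Idl (set ys) <+> m \<cdot> ?J) <+> PIdl y" unfolding mem_adjoin using r(1) by blast
  qed
  thus ?thesis using y yz sop_cong[OF sop yz(1,2,3)] by blast
qed

text \<open>Each of the \<open>n\<close> factors \<open>z\<close> of a product satisfies
  \<open>c z^q \<in> (w^q) + ws^[q]\<close>, and multiplying these memberships collects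
  \<open>c^n\<close> and \<open>w^(qn)\<close>. Sums are harmless as the Frobenius map is
  additive.\<close>

lemma ideal_pow_tc_bound:
  assumes sop: "sop R m (w # ws)" and c: "c \<in> m"
  shows "g \<in> ideal_pow (tc (Idl (set (w # ws)))) n \<Longrightarrow>
    c [^] n \<otimes> g [^] (p ^ e) \<in> Idl ((\<lambda>x. x [^] (p ^ e)) ` set ws) <+> PIdl ((w [^] (p ^ e)) [^] n)"
proof (induction n arbitrary: g)
  case 0
  let ?X = "Idl ((\<lambda>x. x [^] (p ^ e)) ` set ws)"
  have X: "ideal ?X R" using sop_R[OF sop] by (intro genideal_ideal) auto
  have g: "g \<in> carrier R" using 0 by (simp add: ideals_one)
  have "c [^] (0::nat) \<otimes> g [^] (p ^ e) = \<zero> \<oplus> g [^] (p ^ e) \<otimes> (w [^] (p ^ e)) [^] (0::nat)"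
    using g by simp
  thus ?case unfolding mem_adjoin using ideal_zero_mem[OF X] g by blast
next
  case (Suc n)
  let ?X = "Idl ((\<lambda>x. x [^] (p ^ e)) ` set ws)" and ?W = "w [^] (p ^ e)" and ?L = "Idl (set (w # ws))"
  have wR: "w \<in> carrier R" "set ws \<subseteq> carrier R" using sop_R[OF sop] by auto
  have X: "ideal ?X R" using wR by (intro genideal_ideal) auto
  have L: "ideal ?L R" using genideal_ideal[OF sop_R[OF sop]] .
  have WR: "?W \<in> carrier R" using wR by simp
  let ?T = "?X <+> PIdl (?W [^] Suc n)"
  have T: "ideal ?T R" using adjoin_ideal[OF X] WR by blast
  have cR: "c \<in> carrier R" using m_carrier[OF c] .
  have iP: "ideal (ideal_pow (tc ?L) n) R" using ideal_pow_ideal[OF tc_ideal[OF L]] .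
  let ?C = "c [^] Suc n"
  have CR: "?C \<in> carrier R" using cR by blast
  have "g \<in> ideal_pow (tc ?L) n \<cdot> tc ?L" using Suc.prems unfolding ideal_pow_Suc .
  thus ?case
  proof (induction rule: ideal_prod.induct)
    case (prod g z)
    have gR: "g \<in> carrier R" and zR: "z \<in> carrier R"
      using ideal.Icarr[OF iP prod(1)] ideal.Icarr[OF tc_ideal[OF L] prod(2)] by auto
    obtain x r where x: "x \<in> ?X" "r \<in> carrier R" "c [^] n \<otimes> g [^] (p ^ e) = x \<oplus> r \<otimes> ?W [^] n"
      using Suc.IH[OF prod(1)] unfolding mem_adjoin by blast
    have "c \<otimes> z [^] (p ^ e) \<in> Fr e ?L" using tc_multiplier[OF L prod(2) c] .
    also have "Fr e ?L = ?X <+> PIdl ?W" using Fr_genideal_insert[OF wR(2,1), of e] by simp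
    finally obtain x' r' where x': "x' \<in> ?X" "r' \<in> carrier R" "c \<otimes> z [^] (p ^ e) = x' \<oplus> r' \<otimes> ?W"
      unfolding mem_adjoin by blast
    have xR: "x \<in> carrier R" "x' \<in> carrier R" using ideal.Icarr[OF X] x x' by auto
    define V where "V = ?W [^] n"
    define U where "U = ?W"
    have VU: "V \<in> carrier R" "U \<in> carrier R" unfolding V_def U_def using WR by auto
    have "?C \<otimes> (g \<otimes> z) [^] (p ^ e) = (c [^] n \<otimes> g [^] (p ^ e)) \<otimes> (c \<otimes> z [^] (p ^ e))"
      using cR gR zR by (simp add: frob_mult m_ac)
    also have "\<dots> = (x \<oplus> r \<otimes> V) \<otimes> (x' \<oplus> r' \<otimes> U)" unfolding x(3) x'(3) V_def U_def ..
    also have "\<dots> = (x \<otimes> (x' \<oplus> r' \<otimes> U) \<oplus> (r \<otimes> V) \<otimes> x') \<oplus> (r \<otimes> r') \<otimes> (V \<otimes> U)"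
      using xR x(2) x'(2) VU by algebra
    finally have e: "?C \<otimes> (g \<otimes> z) [^] (p ^ e) = (x \<otimes> (x' \<oplus> r' \<otimes> U) \<oplus> (r \<otimes> V) \<otimes> x') \<oplus> (r \<otimes> r') \<otimes> (V \<otimes> U)" .
    have "x \<otimes> (x' \<oplus> r' \<otimes> U) \<oplus> (r \<otimes> V) \<otimes> x' \<in> ?X"
      using xR x(2) x'(2) VU
      by (intro ideal_add_mem[OF X] ideal_mult_mem'[OF X x(1)] ideal_mult_mem[OF X x'(1)]) auto
    moreover have "V \<otimes> U = ?W [^] Suc n" unfolding V_def U_def by simp
    ultimately show ?case unfolding mem_adjoin using e x(2) x'(2) by (metis m_closed)
  next
    case (sum s1 s2)
    have sub: "ideal_pow (tc ?L) n \<cdot> tc ?L \<subseteq> carrier R" using ideal_prod_in_carrier[OF iP tc_ideal[OF L]] .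
    have s: "s1 \<in> carrier R" "s2 \<in> carrier R" using sum sub by auto
    have "?C \<otimes> (s1 \<oplus> s2) [^] (p ^ e) = ?C \<otimes> s1 [^] (p ^ e) \<oplus> ?C \<otimes> s2 [^] (p ^ e)"
      unfolding frob_add[OF s] using CR s by (simp only: r_distr nat_pow_closed)
    thus ?case using ideal_add_mem[OF T sum.IH] by simp
  qed
qed

section \<open>Reductions and \<open>*\<close>-reductions imply each other\<close>

lemma reduction_imp_star_reduction:
  assumes sop: "sop R m xs" and K: "reduction R K (tc (Idl (set xs)))"
  shows "tc (Idl (set xs)) \<subseteq> tc K"
proof -
  let ?J = "Idl (set xs)"
  let ?I = "tc ?J"
  have J: "ideal ?J R" using genideal_ideal[OF sop_R[OF sop]] .
  have I: "ideal ?I R" using tc_ideal[OF J] .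
  obtain n where Ki: "ideal K R" and KI: "K \<subseteq> ?I" and n: "K \<cdot> ideal_pow ?I n = ideal_pow ?I (Suc n)"
    using K unfolding reduction_def by blast
  obtain y ys zs where y: "y \<in> K" and s: "sop R m (ys @ zs)" "Idl (set (ys @ zs)) = ?J" and
    ys: "set ys \<subseteq> K" and dec: "K \<subseteq> (Idl (set ys) <+> m \<cdot> ?J) <+> PIdl y"
    using ideal_decomposition[OF sop Ki KI] by blast
  have R: "set ys \<subseteq> carrier R" "set zs \<subseteq> carrier R" using sop_R[OF s(1)] by auto
  have KR: "K \<subseteq> carrier R" using ideal_carrier[OF Ki] .
  have yR: "y \<in> carrier R" using KR y by blast
  have "?I \<subseteq> m" using tc_proper[OF J genideal_minimal[OF m_ideal sop_m[OF sop]]] .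
  hence ym: "y \<in> m" using y KI by blast
  let ?Y = "Idl (set ys)" and ?In = "ideal_pow ?I n" and ?In1 = "ideal_pow ?I (Suc n)"
  have Y: "ideal ?Y R" using genideal_ideal[OF R(1)] .
  have In: "ideal ?In R" "ideal ?In1 R" using ideal_pow_ideal[OF I] by blast+
  have Py: "ideal (PIdl y) R" using cgenideal_ideal[OF yR] .
  \<comment> \<open>From \<open>I^(n+1) = K I^n\<close> and the shape of \<open>K\<close> one gets
    \<open>I^(n+1) \<subseteq> ?A + m I^(n+1)\<close>, so Nakayama's lemma removes the error term
    \<open>m J\<close> in \<open>K\<close>.\<close>
  let ?A = "?Y <+> (PIdl y) \<cdot> ?In"
  have PI: "ideal ((PIdl y) \<cdot> ?In) R" using ideal_prod_is_ideal[OF Py In(1)] .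
  have A: "ideal ?A R" using add_ideals[OF Y PI] .
  let ?B = "?A <+> m \<cdot> ?In1"
  have B: "ideal ?B R" using add_ideals[OF A mprod_ideal[OF In(2)]] .
  have AB: "?A \<subseteq> ?B" "m \<cdot> ?In1 \<subseteq> ?B" using set_add_upper1[OF A mprod_ideal[OF In(2)]]
    set_add_upper2[OF A mprod_ideal[OF In(2)]] by auto
  have YA: "?Y \<subseteq> ?A" "(PIdl y) \<cdot> ?In \<subseteq> ?A" using set_add_upper1[OF Y PI] set_add_upper2[OF Y PI] by auto
  have mJ: "(m \<cdot> ?J) \<cdot> ?In \<subseteq> m \<cdot> ?In1"
  proof -
    have "(m \<cdot> ?J) \<cdot> ?In \<subseteq> (m \<cdot> ?I) \<cdot> ?In" using tc_upper[OF J] by (intro ideal_prod_mono) auto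
    also have "\<dots> = m \<cdot> (?I \<cdot> ?In)" using ideal_prod_assoc[OF m_ideal I In(1)] .
    also have "?I \<cdot> ?In = ?In1" using ideal_prod_commute[OF I In(1)] ideal_pow_Suc by simp
    finally show ?thesis .
  qed
  have "K \<cdot> ?In \<subseteq> ?B"
  proof (rule ideal_prod_least[OF B])
    fix k g assume k: "k \<in> K" and g: "g \<in> ?In"
    have gR: "g \<in> carrier R" using ideal.Icarr[OF In(1) g] .
    obtain h r where h: "h \<in> ?Y <+> m \<cdot> ?J" "r \<in> carrier R" "k = h \<oplus> r \<otimes> y"
      using subsetD[OF dec k] unfolding mem_adjoin by blast
    obtain x \<mu> where x: "x \<in> ?Y" "\<mu> \<in> m \<cdot> ?J" "h = x \<oplus> \<mu>" using h(1) unfolding mem_set_add by blast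
    have c: "x \<in> carrier R" "\<mu> \<in> carrier R"
      using ideal.Icarr[OF Y x(1)] ideal.Icarr[OF mprod_ideal[OF J] x(2)] by auto
    have e: "k \<otimes> g = (x \<otimes> g \<oplus> (r \<otimes> y) \<otimes> g) \<oplus> \<mu> \<otimes> g" unfolding h(3) x(3) using c h(2) yR gR by algebra
    have "x \<otimes> g \<in> ?B" using ideal_mult_mem'[OF Y x(1) gR] YA AB by blast
    moreover have "r \<otimes> y \<in> PIdl y" using h(2) unfolding cgenideal_def by blast
    hence "(r \<otimes> y) \<otimes> g \<in> ?B" using ideal_prod.prod[OF _ g] YA AB by blast
    moreover have "\<mu> \<otimes> g \<in> ?B" using ideal_prod.prod[OF x(2) g, of R] mJ AB by blast
    ultimately show "k \<otimes> g \<in> ?B" unfolding e by (intro ideal_add_mem[OF B])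
  qed
  hence "?In1 \<subseteq> ?B" unfolding n .
  hence InA: "?In1 \<subseteq> ?A" using nakayama[OF local In(2) A] by blast
  have wJ: "w \<in> ?I" if "w \<in> set (ys @ zs)" for w
    using that genideal_self[OF sop_R[OF s(1)]] s(2) tc_upper[OF J] by blast
  \<comment> \<open>The list \<open>zs\<close> consists of the generators of \<open>J\<close> that
    are missing in \<open>K\<close>; the single element \<open>y\<close> can make up for at most one
    of them.\<close>
  consider "zs = []" | w where "zs = [w]" | w1 w2 zs' where "zs = w1 # w2 # zs'"
    by (cases zs rule: list.exhaust) (metis list.exhaust)+
  thus ?thesis
  proof cases
    case 1
    hence "?J = ?Y" using s(2) by simp
    hence "?J \<subseteq> K" using genideal_minimal[OF Ki ys] by simp
    thus ?thesis using tc_mono[OF J Ki] by blast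
  next
    case (3 w1 w2 zs')
    let ?Z = "Idl (set (ys @ zs')) <+> PIdl y"
    have ysR: "set (ys @ zs') \<subseteq> carrier R" using R 3 by auto
    have Z0: "ideal (Idl (set (ys @ zs'))) R" using genideal_ideal[OF ysR] .
    have "?Y \<subseteq> Idl (set (ys @ zs'))" using ysR by (intro subset_Idl_subset) auto
    hence "?Y \<subseteq> ?Z" using set_add_upper1[OF Z0 Py] by blast
    moreover have "(PIdl y) \<cdot> ?In \<subseteq> ?Z" using ideal_prod_inter[OF Py In(1)] set_add_upper2[OF Z0 Py] by blast
    ultimately have AZ: "?A \<subseteq> ?Z" using set_add_least[OF add_ideals[OF Z0 Py]] by blast
    have pw: "w [^] Suc n \<in> ?Z" if "w \<in> set (ys @ zs)" for w
      using nat_pow_in_ideal_pow[OF I wJ[OF that], of "Suc n"] InA AZ by blast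
    have "sop R m (w1 # w2 # (ys @ zs'))" using sop_set[OF s(1)] 3 by auto
    thus ?thesis using sop_two_powers[OF _ ym, of w1 w2 "ys @ zs'" "Suc n"] pw[of w1] pw[of w2] 3 by auto
  next
    case (2 w)
    have sw: "sop R m (w # ys)" using sop_set[OF s(1)] 2 by auto
    have Jw: "Idl (set (w # ys)) = ?J" using s(2) 2 by simp
    have wR: "w \<in> carrier R" using R 2 by simp
    obtain c where c: "c \<in> m" "c \<noteq> \<zero>" using nonzero_multiplier by blast
    have cR: "c \<in> carrier R" using m_carrier c by blast
    have "w [^] Suc n \<in> ?A" using nat_pow_in_ideal_pow[OF I wJ, of w "Suc n"] InA 2 by auto
    then obtain x h where xh: "x \<in> ?Y" "h \<in> (PIdl y) \<cdot> ?In" "w [^] Suc n = x \<oplus> h" unfolding mem_set_add by blast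
    have "h \<in> ?In \<cdot> (PIdl y)" using xh(2) ideal_prod_commute[OF Py In(1)] by simp
    then obtain g where g: "g \<in> ?In" "h = g \<otimes> y" using ideal_prod_principal[OF In(1) yR] by blast
    have gR: "g \<in> carrier R" using ideal.Icarr[OF In(1) g(1)] .
    have xR: "x \<in> carrier R" using ideal.Icarr[OF Y xh(1)] .
    have "c [^] n \<otimes> w [^] (p ^ e) \<in> Fr e K" for e
    proof -
      let ?X = "Idl ((\<lambda>x. x [^] (p ^ e)) ` set ys)"
      have XR: "(\<lambda>x. x [^] (p ^ e)) ` set ys \<subseteq> carrier R" using R by auto
      have X: "ideal ?X R" using genideal_ideal[OF XR] .
      define W where "W = w [^] (p ^ e)"
      define V where "V = W [^] n"
      define C where "C = c [^] n"
      define Q where "Q = y [^] (p ^ e)"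
      define G where "G = g [^] (p ^ e)"
      define H where "H = x [^] (p ^ e)"
      have car: "W \<in> carrier R" "V \<in> carrier R" "C \<in> carrier R" "Q \<in> carrier R" "G \<in> carrier R" "H \<in> carrier R"
        unfolding W_def V_def C_def Q_def G_def H_def using wR cR yR gR xR by auto
      have "?Y \<subseteq> {x \<in> carrier R. x [^] (p ^ e) \<in> ?X}"
        using R genideal_self[OF XR] by (intro genideal_minimal frob_preimage_ideal X) auto
      hence HX: "H \<in> ?X" unfolding H_def using xh(1) by blast
      have "V \<otimes> W = (w [^] Suc n) [^] (p ^ e)"
        unfolding V_def W_def using wR by (simp add: frob_mult nat_pow_pow mult.commute)
      also have "\<dots> = H \<oplus> G \<otimes> Q" unfolding xh(3) g(2) H_def G_def Q_def
        using xR gR yR by (simp add: frob_add frob_mult)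
      finally have VW: "V \<otimes> W = H \<oplus> G \<otimes> Q" .
      have "g \<in> ideal_pow (tc (Idl (set (w # ys)))) n" using g(1) Jw by simp
      from ideal_pow_tc_bound[OF sw c(1) this, of e]
      obtain x' r where x': "x' \<in> ?X" "r \<in> carrier R" "C \<otimes> G = x' \<oplus> r \<otimes> V"
        unfolding mem_adjoin C_def G_def V_def W_def by blast
      have x'R: "x' \<in> carrier R" using ideal.Icarr[OF X x'(1)] .
      \<comment> \<open>The \<open>q\<close>-th power of \<open>w^(n+1) = x + g y\<close> reads
        \<open>V W = H + G Q\<close>. Multiplying by \<open>c^n\<close> replaces \<open>G\<close> by
        \<open>r V\<close> modulo \<open>?X\<close>, and then the common factor
        \<open>V = w^(qn)\<close> can be cancelled.\<close>
      have "(C \<otimes> W \<ominus> r \<otimes> Q) \<otimes> V = C \<otimes> (V \<otimes> W) \<ominus> r \<otimes> Q \<otimes> V" using car x'(2) by algebra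
      also have "\<dots> = C \<otimes> H \<oplus> (C \<otimes> G) \<otimes> Q \<ominus> r \<otimes> Q \<otimes> V" unfolding VW using car x'(2) by algebra
      also have "\<dots> = C \<otimes> H \<oplus> x' \<otimes> Q" unfolding x'(3) using car x'(2) x'R by algebra
      also have "\<dots> \<in> ?X"
        using ideal_add_mem[OF X ideal_mult_mem[OF X HX car(3)] ideal_mult_mem'[OF X x'(1) car(4)]] .
      finally have "C \<otimes> W \<ominus> r \<otimes> Q \<in> ?X"
        using sop_frob_regular[OF sw, of "C \<otimes> W \<ominus> r \<otimes> Q" e n] car x'(2) unfolding V_def W_def by simp
      moreover have "?X \<subseteq> Fr e K" using ys by (intro genideal_minimal Fr_ideal KR) (auto intro: Fr_mem[OF KR])
      moreover have "r \<otimes> Q \<in> Fr e K" unfolding Q_def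
        using ideal_mult_mem[OF Fr_ideal[OF KR] Fr_mem[OF KR y] x'(2)] .
      ultimately have "(C \<otimes> W \<ominus> r \<otimes> Q) \<oplus> r \<otimes> Q \<in> Fr e K" using ideal_add_mem[OF Fr_ideal[OF KR]] by blast
      moreover have "(C \<otimes> W \<ominus> r \<otimes> Q) \<oplus> r \<otimes> Q = C \<otimes> W" using car x'(2) by algebra
      ultimately show ?thesis unfolding C_def W_def by simp
    qed
    moreover have "c [^] n \<in> carrier R - {\<zero>}"
      using prime_pow[OF zeroprimeideal cR, of n] c cR by auto
    ultimately have "w \<in> tc K" unfolding tc_iff_multiplier using wR by blast
    hence "?J \<subseteq> tc K" unfolding Jw[symmetric]
      using ys tc_upper[OF Ki] by (intro genideal_minimal tc_ideal Ki) auto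
    hence "?I \<subseteq> tc (tc K)" using tc_mono[OF J tc_ideal[OF Ki]] by blast
    thus ?thesis using tc_idem[OF Ki] by blast
  qed
qed

lemma star_reduction_imp_reduction:
  assumes sop: "sop R m xs" and K: "ideal K R" "K \<subseteq> tc (Idl (set xs))" "tc (Idl (set xs)) \<subseteq> tc K"
  shows "reduction R K (tc (Idl (set xs)))"
proof -
  let ?J = "Idl (set xs)"
  let ?I = "tc ?J"
  have J: "ideal ?J R" using genideal_ideal[OF sop_R[OF sop]] .
  have I: "ideal ?I R" using tc_ideal[OF J] .
  obtain y ys zs where y: "y \<in> K" and s: "sop R m (ys @ zs)" "Idl (set (ys @ zs)) = ?J" and
    ys: "set ys \<subseteq> K" and dec: "K \<subseteq> (Idl (set ys) <+> m \<cdot> ?J) <+> PIdl y"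
    using ideal_decomposition[OF sop K(1,2)] by blast
  have R: "set ys \<subseteq> carrier R" "set zs \<subseteq> carrier R" using sop_R[OF s(1)] by auto
  have KR: "K \<subseteq> carrier R" and JR: "?J \<subseteq> carrier R" using ideal_carrier K(1) J by auto
  have yR: "y \<in> carrier R" using KR y by blast
  have Im: "?I \<subseteq> m" using tc_proper[OF J genideal_minimal[OF m_ideal sop_m[OF sop]]] .
  hence ym: "y \<in> m" using y K(2) by blast
  let ?Y = "Idl (set ys)"
  have Y: "ideal ?Y R" using genideal_ideal[OF R(1)] .
  \<comment> \<open>As \<open>m I \<subseteq> m J\<close>, the inclusion
    \<open>m J \<subseteq> m K'\<close> gives \<open>m I \<subseteq> m K'\<close>, to which the
    integral dependence criterion applies.\<close>
  have red: "reduction R K' ?I"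
    if K': "ideal K' R" "K' \<subseteq> ?I" "m \<cdot> ?J \<subseteq> m \<cdot> K'" for K'
    using reduction_of_prod_subset[OF K'(1) I K'(2) m_ideal m_nonzero] mprod_tc[OF sop] K'(3) by blast
  let ?A = "\<lambda>e. Idl ((\<lambda>x. x [^] (p ^ e)) ` set ys) <+> PIdl (y [^] (p ^ e))"
  \<comment> \<open>From \<open>m J^[q] \<subseteq> K^[q]\<close> and the shape of \<open>K\<close>
    one gets \<open>m J^[q] \<subseteq> ?A e + m (m J^[q])\<close>, and Nakayama's lemma removes the
    last term.\<close>
  have mA: "m \<cdot> (Fr e ?J) \<subseteq> ?A e" if e: "e > 0" for e
  proof -
    let ?X = "Idl ((\<lambda>x. x [^] (p ^ e)) ` set ys)" and ?F = "Fr e ?J"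
    have XR: "(\<lambda>x. x [^] (p ^ e)) ` set ys \<subseteq> carrier R" using R by auto
    have X: "ideal ?X R" using genideal_ideal[OF XR] .
    have A: "ideal (?A e) R" using adjoin_ideal[OF X] yR by blast
    have F: "ideal ?F R" using Fr_ideal[OF JR] .
    let ?M = "m \<cdot> ?F"
    have M: "ideal ?M R" "ideal (m \<cdot> ?M) R" using mprod_ideal[OF F] mprod_ideal[OF mprod_ideal[OF F]] by auto
    let ?B = "?A e <+> m \<cdot> ?M"
    have B: "ideal ?B R" using add_ideals[OF A M(2)] .
    have AB: "?A e \<subseteq> ?B" "m \<cdot> ?M \<subseteq> ?B" using set_add_upper1[OF A M(2)] set_add_upper2[OF A M(2)] by auto
    have e2: "p ^ e \<ge> 2" using p_ge_2 e self_le_power[of p e] by linarith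
    let ?T = "{x \<in> carrier R. x [^] (p ^ e) \<in> ?B}"
    have T: "ideal ?T R" using frob_preimage_ideal[OF B] .
    have yeR: "y [^] (p ^ e) \<in> carrier R" using yR by simp
    have XB: "?X \<subseteq> ?B" using adjoin_upper[OF X yeR] AB(1) by blast
    have "?Y \<subseteq> ?T"
      using R genideal_self[OF XR] XB by (intro genideal_minimal T) auto
    moreover have "m \<cdot> ?J \<subseteq> ?T"
    proof (rule ideal_prod_least[OF T])
      fix a j assume a: "a \<in> m" and j: "j \<in> ?J"
      have c: "a \<in> carrier R" "j \<in> carrier R" using m_carrier[OF a] JR j by auto
      \<comment> \<open>Since \<open>q \<ge> 2\<close>, the power \<open>a^q\<close> lies in
        \<open>m^2\<close>: one factor of \<open>m\<close> belongs to the ideal \<open>?M\<close>,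
        the other is the one needed for Nakayama's lemma. This is why \<open>e > 0\<close> is
        required.\<close>
      have "a [^] (p ^ e) \<otimes> j [^] (p ^ e) \<in> (m \<cdot> m) \<cdot> ?F"
        using pow_in_m_square[OF a e2] Fr_mem[OF JR j] by (rule ideal_prod.prod)
      hence "(a \<otimes> j) [^] (p ^ e) \<in> ?B"
        using ideal_prod_assoc[OF m_ideal m_ideal F] AB c by (auto simp: frob_mult)
      thus "a \<otimes> j \<in> ?T" using c by simp
    qed
    moreover have "y \<in> ?T" using adjoin_mem[OF X yeR] yR AB(1) by blast
    ultimately have "K \<subseteq> ?T"
      using dec adjoin_least[OF T, of "?Y <+> m \<cdot> ?J" y] set_add_least[OF T] by blast
    hence FK: "Fr e K \<subseteq> ?B" by (intro Fr_least[OF B]) auto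
    have "?M \<subseteq> ?B"
    proof (rule ideal_prod_least[OF B])
      fix c z assume c: "c \<in> m" and z: "z \<in> ?F"
      have cR: "c \<in> carrier R" using m_carrier[OF c] .
      have "?F \<subseteq> ideal_colon R ?B {c}"
      proof (rule Fr_least[OF colon1_ideal[OF B cR]])
        fix j assume j: "j \<in> ?J"
        hence "j \<in> tc K" using tc_upper[OF J] K(3) by blast
        hence "c \<otimes> j [^] (p ^ e) \<in> ?B" using tc_multiplier[OF K(1) _ c] FK by blast
        thus "j [^] (p ^ e) \<in> ideal_colon R ?B {c}" using j JR cR by (auto simp: mem_colon1 m_comm)
      qed
      hence "z \<otimes> c \<in> ?B" "z \<in> carrier R" using z unfolding mem_colon1 subset_iff by blast+
      thus "c \<otimes> z \<in> ?B" using cR by (simp add: m_comm)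
    qed
    thus ?thesis using nakayama[OF local M(1) A] by blast
  qed
  have wJ: "w \<in> ?J" if "w \<in> set (ys @ zs)" for w
    using that genideal_self[OF sop_R[OF s(1)]] s(2) by blast
  consider "zs = []" | w where "zs = [w]" | w1 w2 zs' where "zs = w1 # w2 # zs'"
    by (cases zs rule: list.exhaust) (metis list.exhaust)+
  thus ?thesis
  proof cases
    case 1
    hence "?J = ?Y" using s(2) by simp
    hence "?J \<subseteq> K" using genideal_minimal[OF K(1) ys] by simp
    moreover have "reduction R ?J ?I" using red[OF J tc_upper[OF J]] by blast
    ultimately show ?thesis using reduction_mono[OF _ K(1) _ K(2) I] by blast
  next
    case (3 w1 w2 zs')
    let ?Z = "Idl (set (ys @ zs')) <+> PIdl y"
    have ysR: "set (ys @ zs') \<subseteq> carrier R" using R 3 by auto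
    have Z0: "ideal (Idl (set (ys @ zs'))) R" using genideal_ideal[OF ysR] .
    have Z: "ideal ?Z R" using adjoin_ideal[OF Z0 yR] .
    have "?A 1 \<subseteq> ?Z"
    proof (rule adjoin_least[OF Z])
      have "set ys \<subseteq> ?Z" using genideal_self[OF ysR] adjoin_upper[OF Z0 yR] by auto
      hence "x [^] (p ^ 1) \<in> ?Z" if "x \<in> set ys" for x
        using nat_pow_mem[OF Z _ pe_pos[of 1], of x] that by blast
      thus "Idl ((\<lambda>x. x [^] (p ^ 1)) ` set ys) \<subseteq> ?Z"
        by (intro genideal_minimal[OF Z] image_subsetI)
      show "y [^] (p ^ 1) \<in> ?Z" using adjoin_mem[OF Z0 yR] pe_pos[of 1] by (intro nat_pow_mem[OF Z])
    qed
    hence mZ: "m \<cdot> (Fr 1 ?J) \<subseteq> ?Z" using mA[of 1] by auto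
    \<comment> \<open>The exponent \<open>p + 1\<close> arises from
      \<open>w w^p \<in> m J^[p]\<close>.\<close>
    have pw: "w [^] Suc p \<in> ?Z" if w: "w \<in> set (ys @ zs)" for w
    proof -
      have wm: "w \<in> m" using w sop_m[OF s(1)] by blast
      have "w \<otimes> w [^] (p ^ 1) \<in> ?Z"
        using ideal_prod.prod[OF wm Fr_mem[OF JR wJ[OF w], of 1], of R] mZ by blast
      thus ?thesis using m_carrier[OF wm] by (simp add: m_comm)
    qed
    have "sop R m (w1 # w2 # (ys @ zs'))" using sop_set[OF s(1)] 3 by auto
    thus ?thesis using sop_two_powers[OF _ ym, of w1 w2 "ys @ zs'" "Suc p"] pw[of w1] pw[of w2] 3 by auto
  next
    case (2 w)
    have sw: "sop R m (w # ys)" using sop_set[OF s(1)] 2 by auto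
    have Jw: "Idl (set (w # ys)) = ?J" using s(2) 2 by simp
    have wm: "w \<in> m" using sop_m[OF sw] by simp
    have wR: "w \<in> carrier R" using m_carrier[OF wm] .
    \<comment> \<open>The generators of \<open>K\<close> found so far, without the part in
      \<open>m J\<close>. It is shown that this smaller ideal is already a reduction.\<close>
    let ?K = "Idl (set (y # ys))"
    have KsR: "set (y # ys) \<subseteq> carrier R" using yR R by auto
    have K': "ideal ?K R" using genideal_ideal[OF KsR] .
    have K'K: "?K \<subseteq> K" using y ys by (intro genideal_minimal[OF K(1)]) auto
    obtain c where c: "c \<in> m" "c \<noteq> \<zero>" using nonzero_multiplier by blast
    have "c \<otimes> w [^] (p ^ e) \<in> Fr e ?K" if "e \<ge> 1" for e
    proof -
      have "c \<otimes> w [^] (p ^ e) \<in> m \<cdot> (Fr e ?J)"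
        using ideal_prod.prod[OF c(1) Fr_mem[OF JR, of w e], of R] wJ 2 by simp
      thus ?thesis using mA[of e] that Fr_genideal_insert[OF R(1) yR, of e] by auto
    qed
    hence wK: "w \<in> tc ?K" unfolding tc_iff_multiplier using wR c m_carrier by blast
    have sK: "sop R m (y # ys)"
    proof (rule sop_radical[OF sw])
      show "set (y # ys) \<subseteq> m" using ym sop_m[OF sw] by auto
      \<comment> \<open>The test ideal contains \<open>w\<close> itself, so the square of
        \<open>w\<close> is in \<open>?K\<close> and \<open>y\<close> can replace \<open>w\<close>
        as a parameter.\<close>
      have "w \<otimes> w \<in> ?K" using test[OF K' wK wm] .
      hence "w [^] (2::nat) \<in> ?K" using wR by (simp add: numeral_2_eq_2)
      hence "w \<in> radical R ?K" using wR unfolding radical_def by blast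
      thus "set (w # ys) \<subseteq> radical R ?K" using radical_upper[OF K'] genideal_self[OF KsR] by auto
    qed simp
    have "m \<cdot> ?J \<subseteq> m \<cdot> ?K"
    proof (rule ideal_prod_least[OF mprod_ideal[OF K']])
      fix a j assume a: "a \<in> m" and j: "j \<in> ?J"
      have aR: "a \<in> carrier R" using m_carrier[OF a] .
      have "v \<in> ideal_colon R (m \<cdot> ?K) {a}" if v: "v \<in> set (w # ys)" for v
      proof -
        have "v \<in> tc ?K" using v wK tc_upper[OF K'] genideal_self[OF KsR] by auto
        hence "a \<otimes> v \<in> m \<cdot> ?K" using tc_mult_minimal[OF sK _ a] by blast
        thus ?thesis using v sop_R[OF sw] aR by (auto simp: mem_colon1 m_comm)
      qed
      hence "?J \<subseteq> ideal_colon R (m \<cdot> ?K) {a}" unfolding Jw[symmetric]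
        by (intro genideal_minimal colon1_ideal mprod_ideal K' aR) auto
      hence "j \<otimes> a \<in> m \<cdot> ?K" using j unfolding mem_colon1 subset_iff by blast
      thus "a \<otimes> j \<in> m \<cdot> ?K" using aR j JR by (auto simp: m_comm)
    qed
    hence "reduction R ?K ?I" using red[OF K'] K'K K(2) by blast
    thus ?thesis using reduction_mono[OF _ K(1) K'K K(2) I] by blast
  qed
qed

lemma reduction_iff_star_reduction:
  assumes "sop R m xs"
  shows "reduction R K (tc (Idl (set xs))) \<longleftrightarrow> star_reduction R p K (tc (Idl (set xs)))"
  using reduction_imp_star_reduction[OF assms] star_reduction_imp_reduction[OF assms]
  unfolding star_reduction_def by (auto simp: reduction_def)

end

lemma test_ideal_colon:
  assumes "c \<in> test_ideal R p" "ideal L R" "z \<in> tight_closure R p L"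
  shows "c \<otimes>\<^bsub>R\<^esub> z \<in> L"
  using assms unfolding test_ideal_def ideal_colon_def by blast

theorem corollary4p7:
  fixes R :: "('a, 'b) ring_scheme" and m I J :: "'a set" and p :: nat and xs :: "'a list"
  assumes "local_ring R m"
    and "excellent R"
    and "gorenstein_local R m"
    and "normal_domain R"
    and "isolated_singularity R m"
    and "Factorial_Ring.prime p" and "[p] \<cdot>\<^bsub>R\<^esub> \<one>\<^bsub>R\<^esub> = \<zero>\<^bsub>R\<^esub>"
    and "infinite (carrier (R Quot m))" and "perfect_field (R Quot m)"
    and "test_ideal R p = m"
    and "sop R m xs" and "J = Idl\<^bsub>R\<^esub> (set xs)"
    and "I = tight_closure R p J"
  shows "core R I = star_core R p I"
proof -
  interpret domain R using assms(4) by (simp add: normal_domain_def)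
  interpret noetherian_cring_domain R
    using assms(1) domain_axioms
    by (simp add: local_ring_def noetherian_cring_domain_def noetherian_cring_def)
  have test: "c \<otimes>\<^bsub>R\<^esub> z \<in> L" if "ideal L R" "z \<in> tight_closure R p L" "c \<in> m" for L z c
    using test_ideal_colon[of c R p L z] that assms(10) by simp
  \<comment> \<open>If \<open>m\<close> were zero, \<open>R\<close> would be a field with all ideals
    tightly closed, and its test ideal would be all of \<open>R\<close>.\<close>
  have "m \<noteq> {\<zero>\<^bsub>R\<^esub>}"
  proof
    assume m0: "m = {\<zero>\<^bsub>R\<^esub>}"
    have "\<one>\<^bsub>R\<^esub> \<otimes>\<^bsub>R\<^esub> z \<in> L" if L: "ideal L R" and z: "z \<in> tight_closure R p L" for L z
    proof (cases "L = carrier R")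
      case True
      thus ?thesis using z by (simp add: tight_closure_def)
    next
      case False
      hence L0: "L = {\<zero>\<^bsub>R\<^esub>}"
        using local_proper_subset[OF assms(1) L] ideal_zero_mem[OF L] m0 by blast
      obtain c N where c: "z \<in> carrier R" "c \<in> off_minimal_primes R"
        "\<And>e. e \<ge> N \<Longrightarrow> c \<otimes>\<^bsub>R\<^esub> z [^]\<^bsub>R\<^esub> (p ^ e) \<in> frobenius_power R (p ^ e) L"
        using z unfolding tight_closure_def by blast
      have "minimal_prime R {\<zero>\<^bsub>R\<^esub>}"
        using zeroprimeideal ideal_zero_mem[OF primeideal_ideal] unfolding minimal_prime_def Spec_def by auto
      hence c0: "c \<in> carrier R" "c \<noteq> \<zero>\<^bsub>R\<^esub>" using c(2) unfolding off_minimal_primes_def by auto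
      have "p ^ N \<noteq> 0" using assms(6) by (simp add: prime_gt_0_nat)
      hence "frobenius_power R (p ^ N) L = {\<zero>\<^bsub>R\<^esub>}"
        unfolding frobenius_power_def L0 using nat_pow_zero[of "p ^ N"] genideal_zero by simp
      hence "c \<otimes>\<^bsub>R\<^esub> z [^]\<^bsub>R\<^esub> (p ^ N) = \<zero>\<^bsub>R\<^esub>" using c(3)[of N] by simp
      hence "z [^]\<^bsub>R\<^esub> (p ^ N) \<in> {\<zero>\<^bsub>R\<^esub>}" using integral_iff[of c "z [^]\<^bsub>R\<^esub> (p ^ N)"] c0 c(1) by simp
      hence "z = \<zero>\<^bsub>R\<^esub>" using prime_pow[OF zeroprimeideal c(1)] by blast
      thus ?thesis using L0 by simp
    qed
    hence "\<one>\<^bsub>R\<^esub> \<in> test_ideal R p" unfolding test_ideal_def ideal_colon_def by auto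
    thus False using assms(10) m0 by simp
  qed
  then interpret T: test_ideal_maximal R m p
    by unfold_locales (use assms test gorenstein_sop_regular[OF assms(3)] gorenstein_sop_socle[OF assms(3)] in blast)+
  show ?thesis
    unfolding core_def star_core_def assms(12,13) T.reduction_iff_star_reduction[OF assms(11)] ..
qed

end
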